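(* Assume that $\mathbb{L}$ and its Green function $G^\Omega$ satisfy properties (L1)–(L4) and (G1)–(G3) listed in the context, and let $g:\mathbb{R}\to\mathbb{R}$ be a nondecreasing continuous function with $g(0)=0$. For any $f\in L^1(\Omega,\delta^\gamma)$, the problem $$\mathbb{L}u+g(u)=f\ \text{ in }\Omega,\qquad u=0\ \text{ on }\partial\Omega\ \text{ or in }\mathbb{R}^N\setminus\Omega\ \text{(if applicable)}$$ admits a unique weak-dual solution $u$. Furthermore, the map $f\mapsto u$ is increasing (i.e. if $f_1\le f_2$ a.e. and $u_1,u_2$ are the corresponding solutions, then $u_1\le u_2$ a.e. in $\Omega$).
   Context: Throughout, $N\ge 3$, $\Omega\subset\mathbb{R}^N$ is a bounded $C^2$ domain, $\delta(x)=\operatorname{dist}(x,\mathbb{R}^N\setminus\Omega)$, $D_\Omega=\{(x,x):x\in\Omega\}$, $a\wedge b=\min\{a,b\}$; $f\asymp g$ means $C^{-1}g\le f\le Cg$ for some constant $C>0$. Operator: (L1) $\mathbb{L}:C_c^\infty(\Omega)\to L^2(\Omega)$ is given by $\mathbb{L}u(x)=\lim_{\varepsilon\to0^+}\mathbb{L}_\varepsilon u(x)$, where $\mathbb{L}_\varepsilon u(x)=\int_{\{y\in\Omega:|x-y|>\varepsilon\}}J(x,y)(u(x)-u(y))\,dy+B(x)u(x)$; $J,B$ are measurable, $J$ is nonnegative, symmetric, finite on $(\Omega\times\Omega)\setminus D_\Omega$, $\int_\Omega\int_\Omega|x-y|^2J(x,y)\,dx\,dy<\infty$, and $B$ is nonnegative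 and locally bounded in $\Omega$. (L2) For every $u\in C_c^\infty(\Omega)$ there exist $\varphi_u\in L^1_{\rm loc}(\Omega)$ and $\varepsilon_0>0$ with $|\mathbb{L}_\varepsilon u|\le\varphi_u$ a.e. in $\Omega$ for all $\varepsilon\in(0,\varepsilon_0]$. Put $\mathcal{E}(u,v)=\frac12\int_\Omega\int_\Omega J(x,y)(u(x)-u(y))(v(x)-v(y))\,dx\,dy+\int_\Omega Buv\,dx$ on $\mathcal{D}(\mathcal{E})=\{u\in L^2(\Omega):\mathcal{E}(u,u)<\infty\}$, with inner product $\langle u,v\rangle_{L^2(\Omega)}+\mathcal{E}(u,v)$; $\mathbb{H}(\Omega)$ is the closure of $C_c^\infty(\Omega)$ in $\mathcal{D}(\mathcal{E})$. $\mathbb{L}$ also denotes its Friedrichs extension, the nonnegative self-adjoint operator on $L^2(\Omega)$ associated with $\mathcal{E}|_{\mathbb{H}(\Omega)}$. (L3) There is $\Lambda>0$ with $\|u\|_{L^2(\Omega)}^2\le\Lambda\langle\mathbb{L}u,u\rangle_{L^2(\Omega)}$ for all $u\in C_c^\infty(\Omega)$. (L4) $\mathbb{H}(\Omega)=H^s_{00}(\Omega):=\{u\in H^s(\Omega):u/\delta^s\in L^2(\Omega)\}$, a Banach space with norm $\|u\|^2_{H^s_{00}(\Omega)}=\int_\Omega(1+\delta^{-2s})|u|^2dx+\int_\Omega\int_\Omega\frac{|u(x)-u(y)|^2}{|x-y|^{N+2s}}dx\,dy$ ($s$ as in (G1)). Green operator: for $f\in L^2(\Omega)$, $\mathbb{G}^\Omega[f]$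 is the unique $u\in\mathbb{H}(\Omega)$ with $\mathcal{E}(u,v)=\int_\Omega fv\,dx$ for all $v\in\mathbb{H}(\Omega)$. (G1) $\mathbb{G}^\Omega[f](x)=\int_\Omega G^\Omega(x,y)f(y)\,dy$, where $G^\Omega:(\Omega\times\Omega)\setminus D_\Omega\to(0,\infty)$ is Borel measurable, symmetric, and for some $s,\gamma\in(0,1]$, $N>2s$, $$G^\Omega(x,y)\asymp\frac{1}{|x-y|^{N-2s}}\Big(\frac{\delta(x)}{|x-y|}\wedge1\Big)^\gamma\Big(\frac{\delta(y)}{|x-y|}\wedge1\Big)^\gamma,\quad x\ne y.$$ (G2) $G^\Omega$ is jointly continuous in $(\Omega\times\Omega)\setminus D_\Omega$. (G3) For every $x_0\in\Omega$, $z_0\in\partial\Omega$ the limit $M^\Omega(x_0,z_0)=\lim_{(x,y)\to(x_0,z_0)}\frac{G^\Omega(x,y)}{\delta(y)^\gamma}$ exists, and $M^\Omega:\Omega\times\partial\Omega\to\mathbb{R}^+$ is continuous. Spaces: $L^1(\Omega,\delta^\gamma)$ has norm $\int_\Omega|u|\delta^\gamma dx$; $\delta^\gamma L^\infty(\Omega)=\{\delta^\gamma u:u\in L^\infty(\Omega)\}$. For $f\in L^1(\Omega,\delta^\gamma)$, $\mathbb{G}^\Omega[f](x)=\int_\Omega G^\Omega(x,y)f(y)\,dy$. Weak-dual solution: $u$ is a weak-dual solution of the problem if $u\in L^1(\Omega,\delta^\gamma)$, $g(u)\in L^1(\Omega,\delta^\gamma)$ and $$\int_\Omega u\xi\,dx+\int_\Omega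 g(u)\mathbb{G}^\Omega[\xi]\,dx=\int_\Omega f\,\mathbb{G}^\Omega[\xi]\,dx\quad\text{for all }\xi\in\delta^\gamma L^\infty(\Omega).$$ *)

theory Defs
  imports "HOL-Analysis.Analysis"
begin

text \<open>Functions on \<open>\<Omega>\<close> are represented by functions on the whole space whose values off \<open>\<Omega>\<close> are
  irrelevant. Function spaces are sets of such functions, not of equivalence classes, and each is
  closed under modification on null subsets of \<open>\<Omega>\<close>. Integrals over \<open>\<Omega>\<close> and \<open>\<Omega> \<times> \<Omega>\<close> are Lebesgue
  integrals; the diagonal is a null set of \<open>\<Omega> \<times> \<Omega>\<close>, so values of kernels there play no role.\<close>

section \<open>Smooth functions and domains\<close>

primrec Ck :: "nat \<Rightarrow> ('a::euclidean_space \<Rightarrow> real) \<Rightarrow> bool" where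
  "Ck 0 f \<longleftrightarrow> continuous_on UNIV f"
| "Ck (Suc k) f \<longleftrightarrow>
     f differentiable_on UNIV \<and> (\<forall>b\<in>Basis. Ck k (\<lambda>x. frechet_derivative f (at x) b))"

definition Cc_inf :: "'a::euclidean_space set \<Rightarrow> ('a \<Rightarrow> real) set" where
  "Cc_inf \<Omega> = {u. (\<forall>k. Ck k u) \<and> compact (closure {x. u x \<noteq> 0}) \<and> closure {x. u x \<noteq> 0} \<subseteq> \<Omega>}"

text \<open>Near each boundary point, \<open>\<Omega>\<close> is the region above the graph of a \<open>C\<^sup>2\<close> function over the
  hyperplane orthogonal to some unit vector \<open>e\<close>. The function \<open>h\<close> is only evaluated on that hyperplane.\<close>

definition bounded_C2_domain :: "'a::euclidean_space set \<Rightarrow> bool" where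
  "bounded_C2_domain \<Omega> \<longleftrightarrow>
     open \<Omega> \<and> connected \<Omega> \<and> \<Omega> \<noteq> {} \<and> bounded \<Omega> \<and>
     (\<forall>z\<in>frontier \<Omega>. \<exists>r>0. \<exists>e h. norm e = 1 \<and> Ck 2 h \<and>
        \<Omega> \<inter> ball z r = {x \<in> ball z r. h (x - (x \<bullet> e) *\<^sub>R e) < x \<bullet> e})"

definition bdist :: "'a::euclidean_space set \<Rightarrow> 'a \<Rightarrow> real" where
  "bdist \<Omega> x = infdist x (- \<Omega>)"

definition offdiag :: "'a::euclidean_space set \<Rightarrow> ('a \<times> 'a) set" where
  "offdiag \<Omega> = \<Omega> \<times> \<Omega> - {(x, x) | x. x \<in> \<Omega>}"


section \<open>Function spaces\<close>

definition L2 :: "'a::euclidean_space set \<Rightarrow> ('a \<Rightarrow> real) set" where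
  "L2 \<Omega> = {u \<in> borel_measurable (lebesgue_on \<Omega>). integrable (lebesgue_on \<Omega>) (\<lambda>x. (u x)\<^sup>2)}"

definition L1loc :: "'a::euclidean_space set \<Rightarrow> ('a \<Rightarrow> real) set" where
  "L1loc \<Omega> = {u \<in> borel_measurable (lebesgue_on \<Omega>).
     \<forall>K. compact K \<and> K \<subseteq> \<Omega> \<longrightarrow> integrable (lebesgue_on K) u}"

definition Linf :: "'a::euclidean_space set \<Rightarrow> ('a \<Rightarrow> real) set" where
  "Linf \<Omega> = {u \<in> borel_measurable (lebesgue_on \<Omega>). \<exists>C. AE x in lebesgue_on \<Omega>. \<bar>u x\<bar> \<le> C}"

definition L1_weighted :: "'a::euclidean_space set \<Rightarrow> real \<Rightarrow> ('a \<Rightarrow> real) set" where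
  "L1_weighted \<Omega> \<gamma> = {u \<in> borel_measurable (lebesgue_on \<Omega>).
     integrable (lebesgue_on \<Omega>) (\<lambda>x. \<bar>u x\<bar> * bdist \<Omega> x powr \<gamma>)}"

definition Linf_weighted :: "'a::euclidean_space set \<Rightarrow> real \<Rightarrow> ('a \<Rightarrow> real) set" where
  "Linf_weighted \<Omega> \<gamma> = {\<xi>. \<exists>w\<in>Linf \<Omega>. \<forall>x\<in>\<Omega>. \<xi> x = bdist \<Omega> x powr \<gamma> * w x}"

text \<open>\<open>H\<^sup>s(\<Omega>)\<close> for \<open>0 < s \<le> 1\<close>: the Gagliardo space if \<open>s < 1\<close>, the classical Sobolev space of
  functions with weak gradient in \<open>L\<^sup>2\<close> if \<open>s = 1\<close>.\<close>

definition Hs :: "'a::euclidean_space set \<Rightarrow> real \<Rightarrow> ('a \<Rightarrow> real) set" where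
  "Hs \<Omega> s = {u \<in> L2 \<Omega>.
     if s < 1
     then integrable (lebesgue_on (\<Omega> \<times> \<Omega>))
            (\<lambda>(x, y). (u x - u y)\<^sup>2 / norm (x - y) powr (real DIM('a) + 2 * s))
     else \<forall>b\<in>Basis. \<exists>w\<in>L2 \<Omega>. \<forall>\<phi>\<in>Cc_inf \<Omega>.
            (LINT x|lebesgue_on \<Omega>. u x * frechet_derivative \<phi> (at x) b)
              = - (LINT x|lebesgue_on \<Omega>. w x * \<phi> x)}"

definition Hs00 :: "'a::euclidean_space set \<Rightarrow> real \<Rightarrow> ('a \<Rightarrow> real) set" where
  "Hs00 \<Omega> s = {u \<in> Hs \<Omega> s. (\<lambda>x. u x / bdist \<Omega> x powr s) \<in> L2 \<Omega>}"


section \<open>The operator and its quadratic form\<close>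

text \<open>\<open>J\<close> is the jump kernel and \<open>B\<close> the potential.\<close>

definition L_eps :: "'a::euclidean_space set \<Rightarrow> ('a \<Rightarrow> 'a \<Rightarrow> real) \<Rightarrow> ('a \<Rightarrow> real) \<Rightarrow>
    real \<Rightarrow> ('a \<Rightarrow> real) \<Rightarrow> 'a \<Rightarrow> real" where
  "L_eps \<Omega> J B \<epsilon> u x =
     (LINT y|lebesgue_on {y \<in> \<Omega>. norm (x - y) > \<epsilon>}. J x y * (u x - u y)) + B x * u x"

definition L_op :: "'a::euclidean_space set \<Rightarrow> ('a \<Rightarrow> 'a \<Rightarrow> real) \<Rightarrow> ('a \<Rightarrow> real) \<Rightarrow>
    ('a \<Rightarrow> real) \<Rightarrow> 'a \<Rightarrow> real" where
  "L_op \<Omega> J B u x = Lim (at_right 0) (\<lambda>\<epsilon>. L_eps \<Omega> J B \<epsilon> u x)"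

definition form :: "'a::euclidean_space set \<Rightarrow> ('a \<Rightarrow> 'a \<Rightarrow> real) \<Rightarrow> ('a \<Rightarrow> real) \<Rightarrow>
    ('a \<Rightarrow> real) \<Rightarrow> ('a \<Rightarrow> real) \<Rightarrow> real" where
  "form \<Omega> J B u v =
     1/2 * (LINT z|lebesgue_on (\<Omega> \<times> \<Omega>).
              (case z of (x, y) \<Rightarrow> J x y * (u x - u y) * (v x - v y)))
     + (LINT x|lebesgue_on \<Omega>. B x * u x * v x)"

definition form_dom :: "'a::euclidean_space set \<Rightarrow> ('a \<Rightarrow> 'a \<Rightarrow> real) \<Rightarrow> ('a \<Rightarrow> real) \<Rightarrow>
    ('a \<Rightarrow> real) set" where
  "form_dom \<Omega> J B = {u \<in> L2 \<Omega>.
     integrable (lebesgue_on (\<Omega> \<times> \<Omega>)) (\<lambda>(x, y). J x y * (u x - u y)\<^sup>2) \<and>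
     integrable (lebesgue_on \<Omega>) (\<lambda>x. B x * (u x)\<^sup>2)}"

text \<open>The closure of the test functions in the norm of \<open>\<langle>u, v\<rangle> + \<E>(u, v)\<close>.\<close>

definition HH :: "'a::euclidean_space set \<Rightarrow> ('a \<Rightarrow> 'a \<Rightarrow> real) \<Rightarrow> ('a \<Rightarrow> real) \<Rightarrow>
    ('a \<Rightarrow> real) set" where
  "HH \<Omega> J B = {u \<in> form_dom \<Omega> J B. \<forall>\<epsilon>>0. \<exists>\<phi>\<in>Cc_inf \<Omega>.
     (LINT x|lebesgue_on \<Omega>. (u x - \<phi> x)\<^sup>2)
       + form \<Omega> J B (\<lambda>x. u x - \<phi> x) (\<lambda>x. u x - \<phi> x) < \<epsilon>\<^sup>2}"

definition cond_L1 :: "'a::euclidean_space set \<Rightarrow> ('a \<Rightarrow> 'a \<Rightarrow> real) \<Rightarrow> ('a \<Rightarrow> real) \<Rightarrow> bool" where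
  "cond_L1 \<Omega> J B \<longleftrightarrow>
     (\<lambda>(x, y). J x y) \<in> borel_measurable (lebesgue_on (\<Omega> \<times> \<Omega>)) \<and>
     (\<forall>(x, y)\<in>offdiag \<Omega>. J x y \<ge> 0 \<and> J x y = J y x) \<and>
     integrable (lebesgue_on (\<Omega> \<times> \<Omega>)) (\<lambda>(x, y). (norm (x - y))\<^sup>2 * J x y) \<and>
     B \<in> borel_measurable (lebesgue_on \<Omega>) \<and>
     (\<forall>x\<in>\<Omega>. B x \<ge> 0) \<and>
     (\<forall>K. compact K \<and> K \<subseteq> \<Omega> \<longrightarrow> bounded (B ` K)) \<and>
     (\<forall>u\<in>Cc_inf \<Omega>.
        (AE x in lebesgue_on \<Omega>. \<exists>l. ((\<lambda>\<epsilon>. L_eps \<Omega> J B \<epsilon> u x) \<longlongrightarrow> l) (at_right 0)) \<and>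
        L_op \<Omega> J B u \<in> L2 \<Omega>)"

definition cond_L2 :: "'a::euclidean_space set \<Rightarrow> ('a \<Rightarrow> 'a \<Rightarrow> real) \<Rightarrow> ('a \<Rightarrow> real) \<Rightarrow> bool" where
  "cond_L2 \<Omega> J B \<longleftrightarrow>
     (\<forall>u\<in>Cc_inf \<Omega>. \<exists>\<phi>\<in>L1loc \<Omega>. \<exists>\<epsilon>0>0. \<forall>\<epsilon>\<in>{0<..\<epsilon>0}.
        AE x in lebesgue_on \<Omega>. \<bar>L_eps \<Omega> J B \<epsilon> u x\<bar> \<le> \<phi> x)"

definition cond_L3 :: "'a::euclidean_space set \<Rightarrow> ('a \<Rightarrow> 'a \<Rightarrow> real) \<Rightarrow> ('a \<Rightarrow> real) \<Rightarrow> bool" where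
  "cond_L3 \<Omega> J B \<longleftrightarrow>
     (\<exists>\<Lambda>>0. \<forall>u\<in>Cc_inf \<Omega>.
        (LINT x|lebesgue_on \<Omega>. (u x)\<^sup>2) \<le> \<Lambda> * (LINT x|lebesgue_on \<Omega>. L_op \<Omega> J B u x * u x))"

definition cond_L4 :: "'a::euclidean_space set \<Rightarrow> ('a \<Rightarrow> 'a \<Rightarrow> real) \<Rightarrow> ('a \<Rightarrow> real) \<Rightarrow> real \<Rightarrow> bool"
  where "cond_L4 \<Omega> J B s \<longleftrightarrow> HH \<Omega> J B = Hs00 \<Omega> s"


section \<open>The Green function\<close>

text \<open>\<open>u\<close> is a representative of the image of \<open>f\<close> under the Green operator.\<close>

definition is_green_image :: "'a::euclidean_space set \<Rightarrow> ('a \<Rightarrow> 'a \<Rightarrow> real) \<Rightarrow> ('a \<Rightarrow> real) \<Rightarrow>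
    ('a \<Rightarrow> real) \<Rightarrow> ('a \<Rightarrow> real) \<Rightarrow> bool" where
  "is_green_image \<Omega> J B f u \<longleftrightarrow>
     u \<in> HH \<Omega> J B \<and> (\<forall>v\<in>HH \<Omega> J B. form \<Omega> J B u v = (LINT x|lebesgue_on \<Omega>. f x * v x))"

definition green :: "'a::euclidean_space set \<Rightarrow> ('a \<Rightarrow> 'a \<Rightarrow> real) \<Rightarrow> ('a \<Rightarrow> real) \<Rightarrow> 'a \<Rightarrow> real" where
  "green \<Omega> G f x = (LINT y|lebesgue_on \<Omega>. G x y * f y)"

definition green_profile :: "'a::euclidean_space set \<Rightarrow> real \<Rightarrow> real \<Rightarrow> 'a \<Rightarrow> 'a \<Rightarrow> real" where
  "green_profile \<Omega> s \<gamma> x y =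
     1 / norm (x - y) powr (real DIM('a) - 2 * s)
     * (min (bdist \<Omega> x / norm (x - y)) 1) powr \<gamma>
     * (min (bdist \<Omega> y / norm (x - y)) 1) powr \<gamma>"

definition cond_G1 :: "'a::euclidean_space set \<Rightarrow> ('a \<Rightarrow> 'a \<Rightarrow> real) \<Rightarrow> ('a \<Rightarrow> real) \<Rightarrow>
    ('a \<Rightarrow> 'a \<Rightarrow> real) \<Rightarrow> real \<Rightarrow> real \<Rightarrow> bool" where
  "cond_G1 \<Omega> J B G s \<gamma> \<longleftrightarrow>
     (\<forall>f\<in>L2 \<Omega>. is_green_image \<Omega> J B f (green \<Omega> G f)) \<and>
     (\<lambda>(x, y). G x y) \<in> borel_measurable (restrict_space borel (offdiag \<Omega>)) \<and>
     (\<forall>(x, y)\<in>offdiag \<Omega>. G x y > 0 \<and> G x y = G y x) \<and>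
     s \<in> {0<..1} \<and> \<gamma> \<in> {0<..1} \<and> real DIM('a) > 2 * s \<and>
     (\<exists>C>0. \<forall>(x, y)\<in>offdiag \<Omega>.
        inverse C * green_profile \<Omega> s \<gamma> x y \<le> G x y \<and> G x y \<le> C * green_profile \<Omega> s \<gamma> x y)"

definition cond_G2 :: "'a::euclidean_space set \<Rightarrow> ('a \<Rightarrow> 'a \<Rightarrow> real) \<Rightarrow> bool" where
  "cond_G2 \<Omega> G \<longleftrightarrow> continuous_on (offdiag \<Omega>) (\<lambda>(x, y). G x y)"

definition cond_G3 :: "'a::euclidean_space set \<Rightarrow> ('a \<Rightarrow> 'a \<Rightarrow> real) \<Rightarrow> real \<Rightarrow> bool" where
  "cond_G3 \<Omega> G \<gamma> \<longleftrightarrow>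
     (\<exists>M. (\<forall>x0\<in>\<Omega>. \<forall>z0\<in>frontier \<Omega>.
             ((\<lambda>(x, y). G x y / bdist \<Omega> y powr \<gamma>) \<longlongrightarrow> M x0 z0) (at (x0, z0) within offdiag \<Omega>)
             \<and> M x0 z0 > 0) \<and>
          continuous_on (\<Omega> \<times> frontier \<Omega>) (\<lambda>(x, z). M x z))"


section \<open>Weak-dual solutions\<close>

definition weak_dual_solution :: "'a::euclidean_space set \<Rightarrow> ('a \<Rightarrow> 'a \<Rightarrow> real) \<Rightarrow> real \<Rightarrow>
    (real \<Rightarrow> real) \<Rightarrow> ('a \<Rightarrow> real) \<Rightarrow> ('a \<Rightarrow> real) \<Rightarrow> bool" where
  "weak_dual_solution \<Omega> G \<gamma> g f u \<longleftrightarrow>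
     u \<in> L1_weighted \<Omega> \<gamma> \<and> (\<lambda>x. g (u x)) \<in> L1_weighted \<Omega> \<gamma> \<and>
     (\<forall>\<xi>\<in>Linf_weighted \<Omega> \<gamma>.
        (LINT x|lebesgue_on \<Omega>. u x * \<xi> x) + (LINT x|lebesgue_on \<Omega>. g (u x) * green \<Omega> G \<xi> x)
          = (LINT x|lebesgue_on \<Omega>. f x * green \<Omega> G \<xi> x))"

end

theory Submission
  imports Defs
begin

text \<open>Write \<open>T\<close> for the Green operator, \<open>d = \<delta>\<^sup>\<gamma>\<close>, and note that weak-dual solutions are exactly the solutions
  of \<open>u = T (f - g(u))\<close> in the weighted space. The kernel bounds give \<open>T 1 \<le> C\<close> and \<open>c d \<le> T d \<le> C d\<close>, so \<open>T\<close> is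
  bounded on \<open>L\<^sup>2\<close> and on the weighted space. Everything else rests on Kato's inequality
  \<open>\<integral> w\<^sup>+ \<xi> \<le> \<integral> 1\<^bsub>{w > 0}\<^esub> h T \<xi>\<close> for \<open>w = T h\<close>, \<open>\<xi> \<ge> 0\<close>. The form being Markovian on test functions makes
  the resolvents \<open>m (L + m)\<^sup>-\<^sup>1\<close> of \<open>L = T\<^sup>-\<^sup>1\<close> positive, and Kato's inequality follows by testing the Yosida
  approximations of \<open>h\<close>. It yields comparison, uniqueness, the bound \<open>|u| \<le> C sup |f|\<close> and contraction
  estimates in the weighted space. For Lipschitz \<open>g\<close> and square-integrable \<open>f\<close> a damped Picard iteration
  converges in the energy norm \<open>\<integral> \<rho> T \<rho>\<close>; the contraction estimates then allow to pass to the limit in truncated data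
  and Lipschitz approximations of \<open>g\<close>.\<close>

section \<open>Square-integrable functions\<close>

text \<open>The natural test function in Kato's inequality, \<open>T \<xi>\<close> cut off to the
  set \<open>{w > 0}\<close>, is in general discontinuous and need not have finite energy, so
  \<open>h = L w\<close> cannot be paired with it through the form. The way out is that the Yosida
  approximations of \<open>h\<close> stay bounded in L^2 and converge to \<open>h\<close> in the
  energy norm. Hence they converge weakly against every L^2 limit of functions of finite energy, and
  the cut-off is such a limit. Before that limit, a pointwise inequality suffices. A second obstacle
  is that \<open>g\<close> has no growth bound, so solutions for two different nonlinearities are
  hard to compare in the weighted norm. Every approximation error is therefore moved into the datum:
  the approximants solve the equation exactly, with the given \<open>g\<close> and a perturbed
  \<open>f\<close>. A single stability estimate for fixed \<open>g\<close> then makes both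
  \<open>u\<close> and \<open>g(u)\<close> Cauchy, the latter because \<open>T d\<close> is bounded
  below by a multiple of \<open>d\<close>. The form enters only through a sign condition and an
  approximation property, so the middle of the proof concerns an abstract symmetric kernel on a
  finite measure space.\<close>

lemma discriminant_nonpos:
  fixes a b c :: real
  assumes "\<And>t. 0 \<le> a + 2 * t * b + t\<^sup>2 * c"
  shows "b\<^sup>2 \<le> a * c"
\<comment> \<open>The leading coefficient may vanish, since the quadratic forms to which this is
  applied are only semidefinite.\<close>
proof (cases "c = 0")
  case True
  have "b = 0"
  proof (rule ccontr)
    assume "b \<noteq> 0"
    \<comment> \<open>At this \<open>t\<close> the affine function \<open>a + 2 * t * b\<close> has
      the value -1.\<close>
    then have "2 * (- (a + 1) / (2 * b)) * b = - (a + 1)" by simp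
    with assms[of "- (a + 1) / (2 * b)"] True show False by simp
  qed
  with True show ?thesis by simp
next
  case False
  have "c > 0"
  proof (rule ccontr)
    assume "\<not> 0 < c"
    with False have c: "c < 0" by simp
    \<comment> \<open>Adding the assumptions at \<open>t\<close> and \<open>- t\<close> cancels the
      linear term and leaves \<open>2 * a - 2 * (\<bar>a\<bar> + 1)\<close>, which is
      negative.\<close>
    define t where "t = sqrt ((\<bar>a\<bar> + 1) / (- c))"
    have "t\<^sup>2 * c = - (\<bar>a\<bar> + 1)"
      using c unfolding t_def by (subst real_sqrt_pow2) (auto simp: divide_simps)
    with assms[of t] assms[of "- t"] show False unfolding power2_minus by linarith
  qed
  \<comment> \<open>The minimiser of the quadratic, where its value times \<open>c\<close> is
    \<open>a * c - b\<^sup>2\<close>.\<close>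
  moreover have "0 \<le> a + 2 * (- b / c) * b + (- b / c)\<^sup>2 * c" by (rule assms)
  moreover have "(a + 2 * (- b / c) * b + (- b / c)\<^sup>2 * c) * c = a * c - b\<^sup>2"
    using False by (simp add: power2_eq_square algebra_simps)
  ultimately show ?thesis by (metis diff_ge_0_iff_ge less_eq_real_def mult_nonneg_nonneg)
qed

text \<open>Stated for an arbitrary measure because it serves both for functions on the domain and
  for their increments on the product of the domain with itself.\<close>

definition square_integrable :: "'a measure \<Rightarrow> ('a \<Rightarrow> real) \<Rightarrow> bool" where
  "square_integrable M f \<longleftrightarrow> f \<in> borel_measurable M \<and> integrable M (\<lambda>x. (f x)\<^sup>2)"

lemma square_integrableI:
  "f \<in> borel_measurable M \<Longrightarrow> integrable M (\<lambda>x. (f x)\<^sup>2) \<Longrightarrow> square_integrable M f"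
  by (simp add: square_integrable_def)

lemma square_integrable_measurable [measurable_dest]:
  "square_integrable M f \<Longrightarrow> f \<in> borel_measurable M"
  by (simp add: square_integrable_def)

lemma square_integrableD:
  "square_integrable M f \<Longrightarrow> integrable M (\<lambda>x. (f x)\<^sup>2)"
  by (simp add: square_integrable_def)

lemma square_integrable_mult:
  assumes "square_integrable M f" "square_integrable M g"
  shows "integrable M (\<lambda>x. f x * g x)"
proof (rule Bochner_Integration.integrable_bound)
  show "integrable M (\<lambda>x. (f x)\<^sup>2 + (g x)\<^sup>2)"
    using assms by (simp add: square_integrable_def)
  have "\<bar>a * b\<bar> \<le> a\<^sup>2 + b\<^sup>2" for a b :: real
    using sum_squares_bound[of "\<bar>a\<bar>" "\<bar>b\<bar>"] mult_nonneg_nonneg[of "\<bar>a\<bar>" "\<bar>b\<bar>"]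
    unfolding abs_mult power2_abs by linarith
  then show "AE x in M. norm (f x * g x) \<le> norm ((f x)\<^sup>2 + (g x)\<^sup>2)"
    by auto
  show "(\<lambda>x. f x * g x) \<in> borel_measurable M"
    using assms by (auto simp: square_integrable_def)
qed

lemma square_integrable_bound:
  assumes "square_integrable M f" "g \<in> borel_measurable M" "\<And>x. x \<in> space M \<Longrightarrow> \<bar>g x\<bar> \<le> \<bar>f x\<bar>"
  shows "square_integrable M g"
proof (rule square_integrableI)
  show "integrable M (\<lambda>x. (g x)\<^sup>2)"
  proof (rule Bochner_Integration.integrable_bound)
    show "integrable M (\<lambda>x. (f x)\<^sup>2)" using assms(1) by (rule square_integrableD)
    show "AE x in M. norm ((g x)\<^sup>2) \<le> norm ((f x)\<^sup>2)"
      using assms(3) by (auto simp: abs_le_square_iff)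
  qed (use assms(2) in auto)
qed (fact assms(2))

lemma square_integrable_cmult:
  assumes "square_integrable M f"
  shows "square_integrable M (\<lambda>x. c * f x)"
  using assms by (auto simp: square_integrable_def power_mult_distrib)

lemma square_integrable_uminus:
  "square_integrable M f \<Longrightarrow> square_integrable M (\<lambda>x. - f x)"
  by (auto simp: square_integrable_def)

lemma square_integrable_add:
  assumes "square_integrable M f" "square_integrable M g"
  shows "square_integrable M (\<lambda>x. f x + g x)"
proof (rule square_integrableI)
  have "(\<lambda>x. (f x + g x)\<^sup>2) = (\<lambda>x. (f x)\<^sup>2 + 2 * (f x * g x) + (g x)\<^sup>2)"
    by (auto simp: power2_eq_square algebra_simps)
  with assms square_integrable_mult[OF assms] show "integrable M (\<lambda>x. (f x + g x)\<^sup>2)"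
    by (simp add: square_integrable_def)
qed (use assms in \<open>auto simp: square_integrable_def\<close>)

lemma square_integrable_diff:
  assumes "square_integrable M f" "square_integrable M g"
  shows "square_integrable M (\<lambda>x. f x - g x)"
  using square_integrable_add[OF assms(1) square_integrable_uminus[OF assms(2)]] by simp

lemma square_integrable_lipschitz:
  fixes g :: "real \<Rightarrow> real"
  assumes f: "square_integrable M f" and g: "\<And>a b. \<bar>g a - g b\<bar> \<le> l * \<bar>a - b\<bar>" and g0: "g 0 = 0"
  shows "square_integrable M (\<lambda>x. g (f x))"
proof (rule square_integrable_bound)
  show "square_integrable M (\<lambda>x. l * f x)" by (rule square_integrable_cmult[OF f])
  have l: "l \<ge> 0" using order_trans[OF abs_ge_zero g[of 1 0]] by simp
  have "continuous_on UNIV g"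
  proof (rule continuous_on_iff[THEN iffD2], intro ballI allI impI)
    fix x e :: real assume "e > 0"
    show "\<exists>d>0. \<forall>x'\<in>UNIV. dist x' x < d \<longrightarrow> dist (g x') (g x) < e"
    proof (intro exI conjI ballI impI)
      \<comment> \<open>\<open>l + 1\<close> instead of \<open>l\<close>, because \<open>l\<close>
        may be 0.\<close>
      show "e / (l + 1) > 0" using l \<open>e > 0\<close> by simp
      fix x' assume "dist x' x < e / (l + 1)"
      then have "(l + 1) * \<bar>x' - x\<bar> < e" using l by (simp add: dist_real_def field_simps)
      moreover have "\<bar>g x' - g x\<bar> \<le> (l + 1) * \<bar>x' - x\<bar>"
        by (rule order_trans[OF g mult_right_mono]) auto
      ultimately show "dist (g x') (g x) < e"
        unfolding dist_real_def by (rule le_less_trans[rotated])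
    qed
  qed
  then have "g \<in> borel_measurable borel" by (rule borel_measurable_continuous_onI)
  then show "(\<lambda>x. g (f x)) \<in> borel_measurable M" using f by (auto simp: square_integrable_def)
  show "\<bar>g (f x)\<bar> \<le> \<bar>l * f x\<bar>" for x using g[of "f x" 0] g0 l by (simp add: abs_mult)
qed

lemma Cauchy_Schwarz_integral:
  assumes "square_integrable M f" "square_integrable M g"
  shows "(LINT x|M. f x * g x)\<^sup>2 \<le> (LINT x|M. (f x)\<^sup>2) * (LINT x|M. (g x)\<^sup>2)"
proof (rule discriminant_nonpos)
  fix t
  have "0 \<le> (LINT x|M. (f x + t * g x)\<^sup>2)" by simp
  also have "(\<lambda>x. (f x + t * g x)\<^sup>2) = (\<lambda>x. (f x)\<^sup>2 + 2 * t * (f x * g x) + t\<^sup>2 * (g x)\<^sup>2)"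
    by (auto simp: power2_eq_square algebra_simps)
  also have "(LINT x|M. (f x)\<^sup>2 + 2 * t * (f x * g x) + t\<^sup>2 * (g x)\<^sup>2)
      = (LINT x|M. (f x)\<^sup>2) + 2 * t * (LINT x|M. f x * g x) + t\<^sup>2 * (LINT x|M. (g x)\<^sup>2)"
    using square_integrable_mult[OF assms] assms by (simp add: square_integrable_def)
  finally show "0 \<le> (LINT x|M. (f x)\<^sup>2) + 2 * t * (LINT x|M. f x * g x) + t\<^sup>2 * (LINT x|M. (g x)\<^sup>2)" .
qed

lemma abs_integral_mult_le:
  assumes "square_integrable M f" "square_integrable M g"
  shows "\<bar>LINT x|M. f x * g x\<bar> \<le> sqrt (LINT x|M. (f x)\<^sup>2) * sqrt (LINT x|M. (g x)\<^sup>2)"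
  using real_sqrt_le_mono[OF Cauchy_Schwarz_integral[OF assms]] by (simp add: real_sqrt_mult)

lemma integral_square_add_le:
  assumes "square_integrable M f" "square_integrable M g"
  shows "(LINT x|M. (f x + g x)\<^sup>2) \<le> 2 * (LINT x|M. (f x)\<^sup>2) + 2 * (LINT x|M. (g x)\<^sup>2)"
proof -
  have "(LINT x|M. (f x + g x)\<^sup>2) \<le> (LINT x|M. 2 * (f x)\<^sup>2 + 2 * (g x)\<^sup>2)"
  proof (rule integral_mono)
    show "integrable M (\<lambda>x. (f x + g x)\<^sup>2)"
      using square_integrable_add[OF assms] by (rule square_integrableD)
    show "integrable M (\<lambda>x. 2 * (f x)\<^sup>2 + 2 * (g x)\<^sup>2)"
      using assms by (simp add: square_integrable_def)
    show "(f x + g x)\<^sup>2 \<le> 2 * (f x)\<^sup>2 + 2 * (g x)\<^sup>2" for x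
      using zero_le_power2[of "f x - g x"] by (simp add: power2_eq_square algebra_simps)
  qed
  with assms show ?thesis by (simp add: square_integrable_def)
qed

lemma (in finite_measure) square_integrable_const_bound:
  assumes "f \<in> borel_measurable M" "\<And>x. x \<in> space M \<Longrightarrow> \<bar>f x\<bar> \<le> K"
  shows "square_integrable M f"
proof (rule square_integrable_bound)
  show "square_integrable M (\<lambda>_. K)" by (simp add: square_integrable_def)
  show "\<bar>f x\<bar> \<le> \<bar>K\<bar>" if "x \<in> space M" for x using assms(2)[OF that] by simp
qed (fact assms)

lemma (in finite_measure) square_integrable_integrable:
  "square_integrable M f \<Longrightarrow> integrable M f"
  by (auto simp: square_integrable_def intro: square_integrable_imp_integrable)

lemma (in finite_measure) integral_abs_le_L2:
  assumes "square_integrable M f"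
  shows "(LINT x|M. \<bar>f x\<bar>) \<le> sqrt (measure M (space M)) * sqrt (LINT x|M. (f x)\<^sup>2)"
proof -
  have "square_integrable M (\<lambda>x. \<bar>f x\<bar>)" "square_integrable M (\<lambda>_. 1)"
    using assms by (auto simp: square_integrable_def)
  from abs_integral_mult_le[OF this] show ?thesis by (simp add: mult.commute)
qed

text \<open>The completeness of L^1 in Riesz-Fischer form. Summable increments give almost
  everywhere convergence of the whole sequence, not only of a subsequence; this is what later allows
  Fatou's lemma and the passage to the limit inside a continuous nonlinearity.\<close>

lemma L1_limit_of_summable:
  fixes F :: "nat \<Rightarrow> 'a \<Rightarrow> real"
  assumes int: "\<And>n. integrable M (F n)"
    and sm: "summable (\<lambda>n. LINT x|M. \<bar>F (Suc n) x - F n x\<bar>)"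
  shows "\<exists>H. integrable M H \<and> (AE x in M. (\<lambda>n. F n x) \<longlonglongrightarrow> H x) \<and>
           (\<lambda>n. LINT x|M. \<bar>F n x - H x\<bar>) \<longlonglongrightarrow> 0"
proof -
  define f where "f = (\<lambda>n x. F (Suc n) x - F n x)"
  have fint: "integrable M (f n)" for n
    unfolding f_def by (intro Bochner_Integration.integrable_diff int)
  then have [measurable]: "f n \<in> borel_measurable M" for n by (rule borel_measurable_integrable)
  have sm': "summable (\<lambda>n. LINT x|M. norm (f n x))" using sm by (simp add: f_def)
  have "(\<integral>\<^sup>+x. (\<Sum>n. ennreal (norm (f n x))) \<partial>M) = (\<Sum>n. \<integral>\<^sup>+x. ennreal (norm (f n x)) \<partial>M)"
    by (rule nn_integral_suminf) measurable
  also have "\<dots> = (\<Sum>n. ennreal (LINT x|M. norm (f n x)))"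
    by (intro suminf_cong nn_integral_eq_integral integrable_norm fint) simp
  also have "\<dots> \<noteq> top"
    by (rule ennreal_suminf_neq_top[OF sm']) simp
  finally have "(\<integral>\<^sup>+x. (\<Sum>n. ennreal (norm (f n x))) \<partial>M) \<noteq> \<infinity>" by simp
  then have "AE x in M. (\<Sum>n. ennreal (norm (f n x))) \<noteq> \<infinity>"
    by (rule nn_integral_PInf_AE[rotated]) measurable
  then have ae: "AE x in M. summable (\<lambda>n. norm (f n x))"
  proof eventually_elim
    case (elim x)
    show ?case by (rule summable_suminf_not_top) (use elim in simp_all)
  qed
  \<comment> \<open>The sum of all absolute increments dominates every partial sum and the full sum,
    so \<open>2 * W\<close> is an integrable majorant for the distance to the limit.\<close>
  define W where "W x = (\<Sum>n. norm (f n x))" for x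
  define H where "H x = F 0 x + (\<Sum>n. f n x)" for x
  have Wint: "integrable M W"
    unfolding W_def
    by (rule integrable_suminf[where f="\<lambda>n x. norm (f n x)"]) (use fint ae sm' in simp_all)
  have Hint: "integrable M H"
    unfolding H_def
    by (intro Bochner_Integration.integrable_add int integrable_suminf fint ae sm')
  have tele: "F n x = F 0 x + (\<Sum>i<n. f i x)" for n x
    by (induction n) (auto simp: f_def)
  have conv: "AE x in M. (\<lambda>n. F n x) \<longlonglongrightarrow> H x"
    using ae
  proof eventually_elim
    case (elim x)
    have "(\<lambda>n. F 0 x + (\<Sum>i<n. f i x)) \<longlonglongrightarrow> H x"
      unfolding H_def by (rule tendsto_add[OF tendsto_const summable_LIMSEQ[OF summable_norm_cancel[OF elim]]])
    moreover have "(\<lambda>n. F n x) = (\<lambda>n. F 0 x + (\<Sum>i<n. f i x))" by (rule ext) (rule tele)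
    ultimately show ?case by (simp only:)
  qed
  have bd: "AE x in M. norm \<bar>F n x - H x\<bar> \<le> 2 * W x" for n
    using ae
  proof eventually_elim
    case (elim x)
    have "\<bar>\<Sum>i<n. f i x\<bar> \<le> (\<Sum>i<n. norm (f i x))" by (metis norm_sum real_norm_def)
    also have "\<dots> \<le> W x" unfolding W_def by (rule sum_le_suminf) (use elim in auto)
    finally have "\<bar>\<Sum>i<n. f i x\<bar> \<le> W x" .
    moreover have "\<bar>\<Sum>i. f i x\<bar> \<le> W x"
      unfolding W_def using summable_norm[OF elim] by simp
    moreover have "F n x - H x = (\<Sum>i<n. f i x) - (\<Sum>i. f i x)"
      using tele[of n x] unfolding H_def by linarith
    ultimately show ?case unfolding real_norm_def abs_abs by linarith
  qed
  have "(\<lambda>n. LINT x|M. \<bar>F n x - H x\<bar>) \<longlonglongrightarrow> (LINT x|M. 0)"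
  proof (rule integral_dominated_convergence[where w="\<lambda>x. 2 * W x"])
    show "AE x in M. (\<lambda>n. \<bar>F n x - H x\<bar>) \<longlonglongrightarrow> 0"
      using conv by eventually_elim (rule tendsto_rabs_zero, rule LIM_zero)
    show "integrable M (\<lambda>x. 2 * W x)" using Wint by simp
    show "(\<lambda>x. \<bar>F n x - H x\<bar>) \<in> borel_measurable M" for n
      by (intro borel_measurable_abs borel_measurable_diff borel_measurable_integrable int Hint)
    show "AE x in M. norm \<bar>F n x - H x\<bar> \<le> 2 * W x" for n by (rule bd)
  qed simp
  then have "(\<lambda>n. LINT x|M. \<bar>F n x - H x\<bar>) \<longlonglongrightarrow> 0" by simp
  with Hint conv show ?thesis by (intro exI[of _ H]) simp
qed

section \<open>Symmetric positive kernels\<close>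

definition kernel_op :: "'a measure \<Rightarrow> ('a \<Rightarrow> 'a \<Rightarrow> real) \<Rightarrow> ('a \<Rightarrow> real) \<Rightarrow> 'a \<Rightarrow> real" where
  "kernel_op M G f x = (LINT y|M. G x y * f y)"

text \<open>Sign and symmetry are required at all points, not only on \<open>space M\<close>; a
  Green function extended by zero has these properties. The last two assumptions are the Schur
  conditions for the weights 1 and \<open>d\<close>, with one common constant.\<close>

locale symmetric_kernel = finite_measure M for M :: "'a measure" +
  fixes G :: "'a \<Rightarrow> 'a \<Rightarrow> real" and d :: "'a \<Rightarrow> real" and C :: real
  assumes kernel_measurable: "case_prod G \<in> borel_measurable (M \<Otimes>\<^sub>M M)"
    and kernel_nonneg: "\<And>x y. 0 \<le> G x y"
    and kernel_sym: "\<And>x y. G x y = G y x"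
    and weight_measurable [measurable]: "d \<in> borel_measurable M"
    and weight_pos: "\<And>x. x \<in> space M \<Longrightarrow> 0 < d x"
    and weight_bounded: "\<exists>D. \<forall>x\<in>space M. d x \<le> D"
    and C_nonneg: "0 \<le> C"
    and kernel_integral_le: "\<And>x. x \<in> space M \<Longrightarrow> (\<integral>\<^sup>+y. ennreal (G x y) \<partial>M) \<le> ennreal C"
    and kernel_weight_le:
      "\<And>x. x \<in> space M \<Longrightarrow> (\<integral>\<^sup>+y. ennreal (G x y * d y) \<partial>M) \<le> ennreal (C * d x)"
begin

sublocale MM: pair_sigma_finite M M ..

abbreviation T :: "('a \<Rightarrow> real) \<Rightarrow> 'a \<Rightarrow> real" where
  "T \<equiv> kernel_op M G"

lemma kernel_measurable_compose [measurable (raw)]: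
  assumes [measurable]: "f \<in> N \<rightarrow>\<^sub>M M" "g \<in> N \<rightarrow>\<^sub>M M"
  shows "(\<lambda>z. G (f z) (g z)) \<in> borel_measurable N"
proof -
  have "(\<lambda>z. case_prod G (f z, g z)) \<in> borel_measurable N"
    by (rule measurable_compose[OF _ kernel_measurable]) measurable
  then show ?thesis by simp
qed

lemma T_measurable [measurable (raw)]:
  assumes [measurable]: "f \<in> borel_measurable M"
  shows "T f \<in> borel_measurable M"
  unfolding kernel_op_def by measurable

text \<open>Both the constant \<open>1\<close> and \<open>d\<close> are admissible in the following sense, which is what
  Schur's test needs.\<close>

definition schur_weight :: "('a \<Rightarrow> real) \<Rightarrow> bool" where
  "schur_weight e \<longleftrightarrow> e \<in> borel_measurable M \<and> (\<forall>x\<in>space M. 0 \<le> e x) \<and>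
     (\<forall>x\<in>space M. (\<integral>\<^sup>+y. ennreal (G x y * e y) \<partial>M) \<le> ennreal (C * e x))"

lemma schur_weight_one: "schur_weight (\<lambda>_. 1)"
  using kernel_integral_le by (simp add: schur_weight_def)

lemma schur_weight_weight: "schur_weight d"
  using kernel_weight_le weight_pos by (simp add: schur_weight_def less_imp_le)

text \<open>Tonelli with the \<open>x\<close>-integral inside: by symmetry of \<open>G\<close> the
  Schur condition bounds that integral of \<open>\<bar>a x\<bar> * G x y\<close> by
  \<open>\<bar>K\<bar> * C * e y\<close>, which leaves the integrable function
  \<open>\<bar>f y\<bar> * e y\<close>.\<close>

lemma integrable_kernel_pair:
  assumes e: "schur_weight e"
    and f: "f \<in> borel_measurable M" "integrable M (\<lambda>x. \<bar>f x\<bar> * e x)"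
    and a: "a \<in> borel_measurable M" "\<And>x. x \<in> space M \<Longrightarrow> \<bar>a x\<bar> \<le> K * e x"
  shows "integrable (M \<Otimes>\<^sub>M M) (\<lambda>(x, y). a x * (G x y * f y))"
proof (rule integrableI_bounded)
  note [measurable] = f(1) a(1)
  have [measurable]: "e \<in> borel_measurable M" using e by (simp add: schur_weight_def)
  have e0: "0 \<le> e x" if "x \<in> space M" for x using e that by (simp add: schur_weight_def)
  show "(\<lambda>(x, y). a x * (G x y * f y)) \<in> borel_measurable (M \<Otimes>\<^sub>M M)" by measurable
  have inner: "(\<integral>\<^sup>+x. ennreal \<bar>a x * (G x y * f y)\<bar> \<partial>M) \<le> ennreal (\<bar>K\<bar> * C * (\<bar>f y\<bar> * e y))"
    if y: "y \<in> space M" for y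
  proof -
    have "(\<integral>\<^sup>+x. ennreal \<bar>a x * (G x y * f y)\<bar> \<partial>M)
        \<le> (\<integral>\<^sup>+x. ennreal (\<bar>K\<bar> * \<bar>f y\<bar>) * ennreal (G y x * e x) \<partial>M)"
    proof (rule nn_integral_mono)
      fix x assume x: "x \<in> space M"
      have "\<bar>a x * (G x y * f y)\<bar> = \<bar>a x\<bar> * (G y x * \<bar>f y\<bar>)"
        using kernel_nonneg[of x y] kernel_sym[of x y] by (simp add: abs_mult)
      also have "\<dots> \<le> (\<bar>K\<bar> * e x) * (G y x * \<bar>f y\<bar>)"
      proof (rule mult_right_mono)
        have "\<bar>a x\<bar> \<le> K * e x" by (rule a(2)[OF x])
        also have "\<dots> \<le> \<bar>K\<bar> * e x" by (rule mult_right_mono) (use e0[OF x] in auto)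
        finally show "\<bar>a x\<bar> \<le> \<bar>K\<bar> * e x" .
      qed (use kernel_nonneg in simp)
      finally have "\<bar>a x * (G x y * f y)\<bar> \<le> (\<bar>K\<bar> * \<bar>f y\<bar>) * (G y x * e x)"
        by (simp add: mult_ac)
      then show "ennreal \<bar>a x * (G x y * f y)\<bar> \<le> ennreal (\<bar>K\<bar> * \<bar>f y\<bar>) * ennreal (G y x * e x)"
        using kernel_nonneg[of y x] e0[OF x] by (subst ennreal_mult[symmetric]) (auto intro: ennreal_leI)
    qed
    also have "\<dots> = ennreal (\<bar>K\<bar> * \<bar>f y\<bar>) * (\<integral>\<^sup>+x. ennreal (G y x * e x) \<partial>M)"
      by (rule nn_integral_cmult) (use y in measurable)
    also have "\<dots> \<le> ennreal (\<bar>K\<bar> * \<bar>f y\<bar>) * ennreal (C * e y)"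
      using e y by (intro mult_left_mono) (auto simp: schur_weight_def)
    also have "\<dots> = ennreal (\<bar>K\<bar> * C * (\<bar>f y\<bar> * e y))"
      using C_nonneg e0[OF y] by (simp add: ennreal_mult[symmetric] mult_ac)
    finally show ?thesis .
  qed
  have "(\<integral>\<^sup>+z. ennreal (norm (case z of (x, y) \<Rightarrow> a x * (G x y * f y))) \<partial>(M \<Otimes>\<^sub>M M))
      = (\<integral>\<^sup>+y. \<integral>\<^sup>+x. ennreal \<bar>a x * (G x y * f y)\<bar> \<partial>M \<partial>M)"
    by (subst MM.nn_integral_snd[symmetric]) (auto simp: split_beta)
  also have "\<dots> \<le> (\<integral>\<^sup>+y. ennreal (\<bar>K\<bar> * C * (\<bar>f y\<bar> * e y)) \<partial>M)"
    by (rule nn_integral_mono) (rule inner)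
  also have "\<dots> = ennreal (LINT y|M. \<bar>K\<bar> * C * (\<bar>f y\<bar> * e y))"
  proof (rule nn_integral_eq_integral)
    show "integrable M (\<lambda>y. \<bar>K\<bar> * C * (\<bar>f y\<bar> * e y))"
      using f(2) by (rule integrable_mult_right)
    show "AE y in M. 0 \<le> \<bar>K\<bar> * C * (\<bar>f y\<bar> * e y)"
      by (rule AE_I2) (use C_nonneg e0 in simp)
  qed
  also have "\<dots> < \<infinity>" by simp
  finally show "(\<integral>\<^sup>+z. ennreal (norm (case z of (x, y) \<Rightarrow> a x * (G x y * f y))) \<partial>(M \<Otimes>\<^sub>M M)) < \<infinity>" .
qed

text \<open>Young's inequality bounds the product by
  \<open>G x y * (f y)\<^sup>2 + G x y * (a x)\<^sup>2\<close>. Each term is a pair of the constant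
  1 with an integrable square, the second one after exchanging the variables.\<close>

lemma integrable_kernel_pair_L2:
  assumes "square_integrable M a" "square_integrable M f"
  shows "integrable (M \<Otimes>\<^sub>M M) (\<lambda>(x, y). a x * (G x y * f y))"
proof (rule Bochner_Integration.integrable_bound)
  note [measurable] = assms[THEN square_integrable_measurable]
  have *: "integrable (M \<Otimes>\<^sub>M M) (\<lambda>(x, y). 1 * (G x y * (u y)\<^sup>2))" if u: "square_integrable M u" for u
    by (rule integrable_kernel_pair[OF schur_weight_one, where K=1])
       (use u in \<open>auto simp: square_integrable_def\<close>)
  from *[OF assms(1)] have "integrable (M \<Otimes>\<^sub>M M) (\<lambda>(x, y). G x y * (a x)\<^sup>2)"
    by (subst (asm) MM.integrable_product_swap_iff[symmetric]) (simp add: kernel_sym split_beta')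
  with *[OF assms(2)]
  show "integrable (M \<Otimes>\<^sub>M M) (\<lambda>z. (case z of (x, y) \<Rightarrow> 1 * (G x y * (f y)\<^sup>2)) +
      (case z of (x, y) \<Rightarrow> G x y * (a x)\<^sup>2))"
    by (rule Bochner_Integration.integrable_add)
  have ineq: "\<bar>s * (g * t)\<bar> \<le> g * t\<^sup>2 + g * s\<^sup>2" if "g \<ge> 0" for s g t :: real
  proof -
    have "\<bar>s\<bar> * \<bar>t\<bar> \<le> t\<^sup>2 + s\<^sup>2"
      using sum_squares_bound[of "\<bar>s\<bar>" "\<bar>t\<bar>"] mult_nonneg_nonneg[of "\<bar>s\<bar>" "\<bar>t\<bar>"]
      unfolding power2_abs by linarith
    then have "g * (\<bar>s\<bar> * \<bar>t\<bar>) \<le> g * (t\<^sup>2 + s\<^sup>2)" using that by (rule mult_left_mono)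
    with that show ?thesis by (simp add: abs_mult algebra_simps)
  qed
  show "AE z in M \<Otimes>\<^sub>M M. norm (case z of (x, y) \<Rightarrow> a x * (G x y * f y))
      \<le> norm ((case z of (x, y) \<Rightarrow> 1 * (G x y * (f y)\<^sup>2)) + (case z of (x, y) \<Rightarrow> G x y * (a x)\<^sup>2))"
    by (rule AE_I2) (auto simp: kernel_nonneg intro!: order_trans[OF ineq])
  show "(\<lambda>(x, y). a x * (G x y * f y)) \<in> borel_measurable (M \<Otimes>\<^sub>M M)" by measurable
qed

lemma kernel_pair:
  assumes "integrable (M \<Otimes>\<^sub>M M) (\<lambda>(x, y). a x * (G x y * f y))"
  shows integrable_mult_T: "integrable M (\<lambda>x. a x * T f x)"
    and integrable_mult_T': "integrable M (\<lambda>x. f x * T a x)"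
    and integral_mult_T_swap: "(LINT x|M. a x * T f x) = (LINT x|M. f x * T a x)"
proof -
  have 1: "(\<lambda>x. LINT y|M. a x * (G x y * f y)) = (\<lambda>x. a x * T f x)"
    by (simp add: kernel_op_def)
  have 2: "(\<lambda>y. LINT x|M. a x * (G x y * f y)) = (\<lambda>y. f y * T a y)"
  proof
    fix y
    have "(\<lambda>x. a x * (G x y * f y)) = (\<lambda>x. f y * (G y x * a x))"
      by (auto simp: kernel_sym mult_ac)
    then show "(LINT x|M. a x * (G x y * f y)) = f y * T a y" by (simp add: kernel_op_def)
  qed
  show "integrable M (\<lambda>x. a x * T f x)" using MM.integrable_fst[OF assms] unfolding 1 .
  show "integrable M (\<lambda>x. f x * T a x)" using MM.integrable_snd[OF assms] unfolding 2 .
  show "(LINT x|M. a x * T f x) = (LINT x|M. f x * T a x)"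
    using MM.Fubini_integral[OF assms] unfolding 1 2 by simp
qed

section \<open>The weighted L^1 space and the linearity of \<open>T\<close> on it\<close>

definition weighted_integrable :: "('a \<Rightarrow> real) \<Rightarrow> bool" where
  "weighted_integrable f \<longleftrightarrow> f \<in> borel_measurable M \<and> integrable M (\<lambda>x. \<bar>f x\<bar> * d x)"

lemma weighted_integrable_measurable [measurable_dest]:
  "weighted_integrable f \<Longrightarrow> f \<in> borel_measurable M"
  by (simp add: weighted_integrable_def)

lemma weighted_integrableD:
  "weighted_integrable f \<Longrightarrow> integrable M (\<lambda>x. \<bar>f x\<bar> * d x)"
  by (simp add: weighted_integrable_def)

text \<open>The duality between weighted L^1 and multiples of \<open>d\<close>; it makes all
  pairings with test functions and with their images under \<open>T\<close> finite.\<close>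

lemma weighted_integrable_mult:
  assumes f: "weighted_integrable f" and a: "a \<in> borel_measurable M"
    "\<And>x. x \<in> space M \<Longrightarrow> \<bar>a x\<bar> \<le> K * d x"
  shows "integrable M (\<lambda>x. f x * a x)"
proof (rule Bochner_Integration.integrable_bound)
  show "integrable M (\<lambda>x. K * (\<bar>f x\<bar> * d x))"
    by (intro integrable_mult_right weighted_integrableD f)
  have "\<bar>f x * a x\<bar> \<le> \<bar>K * (\<bar>f x\<bar> * d x)\<bar>" if "x \<in> space M" for x
  proof -
    have "\<bar>f x\<bar> * \<bar>a x\<bar> \<le> \<bar>f x\<bar> * (K * d x)" by (rule mult_left_mono[OF a(2)[OF that]]) simp
    also have "\<dots> \<le> \<bar>K * (\<bar>f x\<bar> * d x)\<bar>" by (simp add: mult_ac)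
    finally show ?thesis by (simp add: abs_mult)
  qed
  then show "AE x in M. norm (f x * a x) \<le> norm (K * (\<bar>f x\<bar> * d x))" by simp
  show "(\<lambda>x. f x * a x) \<in> borel_measurable M" using f a(1) by measurable
qed

lemma weighted_integrable_bound:
  assumes f: "weighted_integrable f" and g: "g \<in> borel_measurable M"
    and le: "AE x in M. \<bar>g x\<bar> \<le> \<bar>f x\<bar>"
  shows "weighted_integrable g"
  unfolding weighted_integrable_def
proof
  show "integrable M (\<lambda>x. \<bar>g x\<bar> * d x)"
  proof (rule Bochner_Integration.integrable_bound[OF weighted_integrableD[OF f]])
    show "(\<lambda>x. \<bar>g x\<bar> * d x) \<in> borel_measurable M" using g by measurable
    show "AE x in M. norm (\<bar>g x\<bar> * d x) \<le> norm (\<bar>f x\<bar> * d x)"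
      using le by eventually_elim (auto simp: abs_mult intro: mult_right_mono)
  qed
qed fact

lemma weighted_integrable_add:
  assumes "weighted_integrable f" "weighted_integrable g"
  shows "weighted_integrable (\<lambda>x. f x + g x)"
proof -
  have "weighted_integrable (\<lambda>x. \<bar>f x\<bar> + \<bar>g x\<bar>)"
    using assms by (auto simp: weighted_integrable_def distrib_right)
  then show ?thesis
    by (rule weighted_integrable_bound) (use assms in \<open>auto simp: weighted_integrable_def\<close>)
qed

lemma weighted_integrable_cmult:
  assumes "weighted_integrable f"
  shows "weighted_integrable (\<lambda>x. k * f x)"
  using assms by (auto simp: weighted_integrable_def abs_mult mult.assoc)

lemma weighted_integrable_diff:
  assumes "weighted_integrable f" "weighted_integrable g"
  shows "weighted_integrable (\<lambda>x. f x - g x)"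
  using weighted_integrable_add[OF assms(1) weighted_integrable_cmult[OF assms(2), of "-1"]] by simp

lemma weighted_integrable_integrable:
  assumes "integrable M f"
  shows "weighted_integrable f"
proof -
  obtain D where D: "\<And>x. x \<in> space M \<Longrightarrow> d x \<le> D" using weight_bounded by blast
  have "integrable M (\<lambda>x. \<bar>f x\<bar> * d x)"
  proof (rule Bochner_Integration.integrable_bound)
    show "integrable M (\<lambda>x. D * f x)" using assms by (rule integrable_mult_right)
    have "\<bar>\<bar>f x\<bar> * d x\<bar> \<le> \<bar>D * f x\<bar>" if "x \<in> space M" for x
      using mult_left_mono[of "\<bar>d x\<bar>" "\<bar>D\<bar>" "\<bar>f x\<bar>"] D[OF that] weight_pos[OF that]
      by (simp add: abs_mult mult_ac)
    then show "AE x in M. norm (\<bar>f x\<bar> * d x) \<le> norm (D * f x)" by simp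
    show "(\<lambda>x. \<bar>f x\<bar> * d x) \<in> borel_measurable M" using assms by measurable
  qed
  with assms show ?thesis by (auto simp: weighted_integrable_def)
qed

lemma weighted_integrable_square_integrable:
  "square_integrable M f \<Longrightarrow> weighted_integrable f"
  by (intro weighted_integrable_integrable square_integrable_integrable)

text \<open>A Bochner integral is 0 by convention where the integrand is not integrable, so
  \<open>T\<close> is additive only where both integrands are integrable. Fubini for the pairing
  with \<open>d\<close> shows that this is almost everywhere; positivity of \<open>d\<close> allows
  it to be divided out.\<close>

lemma AE_integrable_kernel:
  assumes "weighted_integrable f"
  shows "AE x in M. integrable M (\<lambda>y. G x y * f y)"
proof -
  have "integrable (M \<Otimes>\<^sub>M M) (\<lambda>(x, y). d x * (G x y * f y))"
    by (rule integrable_kernel_pair[OF schur_weight_weight, where K=1])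
       (use assms weight_pos[THEN less_imp_le] in \<open>auto simp: weighted_integrable_def\<close>)
  from MM.AE_integrable_fst[OF this] AE_space show ?thesis
  proof eventually_elim
    case (elim x)
    from integrable_mult_right[OF elim(1), of "inverse (d x)"] weight_pos[OF elim(2)]
    show ?case by (simp add: mult.assoc[symmetric])
  qed
qed

lemma T_add:
  assumes "weighted_integrable f" "weighted_integrable g"
  shows "AE x in M. T (\<lambda>y. f y + g y) x = T f x + T g x"
  using AE_integrable_kernel[OF assms(1)] AE_integrable_kernel[OF assms(2)]
  by eventually_elim (simp add: kernel_op_def distrib_left)

lemma T_diff:
  assumes "weighted_integrable f" "weighted_integrable g"
  shows "AE x in M. T (\<lambda>y. f y - g y) x = T f x - T g x"
  using AE_integrable_kernel[OF assms(1)] AE_integrable_kernel[OF assms(2)]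
  by eventually_elim (simp add: kernel_op_def right_diff_distrib)

lemma T_cmult: "T (\<lambda>y. k * f y) x = k * T f x"
proof -
  have "(\<lambda>y. G x y * (k * f y)) = (\<lambda>y. k * (G x y * f y))" by (simp add: mult_ac)
  then show ?thesis by (simp add: kernel_op_def)
qed

lemma T_uminus: "T (\<lambda>y. - f y) x = - T f x"
  by (simp add: kernel_op_def)

lemma T_cong_AE:
  assumes "AE x in M. f x = g x" "f \<in> borel_measurable M" "g \<in> borel_measurable M" "x \<in> space M"
  shows "T f x = T g x"
  unfolding kernel_op_def
proof (rule integral_cong_AE)
  show "AE y in M. G x y * f y = G x y * g y" using assms(1) by eventually_elim simp
qed (use assms in measurable)

lemma T_nonneg: "(\<And>x. x \<in> space M \<Longrightarrow> 0 \<le> f x) \<Longrightarrow> 0 \<le> T f x"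
  unfolding kernel_op_def by (rule integral_nonneg_AE) (auto simp: kernel_nonneg)

lemma abs_T_le: "\<bar>T f x\<bar> \<le> T (\<lambda>y. \<bar>f y\<bar>) x"
proof -
  have "\<bar>T f x\<bar> \<le> (LINT y|M. \<bar>G x y * f y\<bar>)"
    unfolding kernel_op_def by (rule integral_abs_bound)
  also have "(\<lambda>y. \<bar>G x y * f y\<bar>) = (\<lambda>y. G x y * \<bar>f y\<bar>)"
    by (simp add: abs_mult kernel_nonneg)
  finally show ?thesis by (simp add: kernel_op_def)
qed

section \<open>Schur bounds: pointwise, in weighted L^1 and in L^2\<close>

lemma kernel_bounded:
  assumes e: "schur_weight e" and f: "f \<in> borel_measurable M" "\<And>x. x \<in> space M \<Longrightarrow> \<bar>f x\<bar> \<le> K * e x"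
    and x: "x \<in> space M"
  shows integrable_kernel_bounded: "integrable M (\<lambda>y. G x y * f y)"
    and abs_T_bounded: "\<bar>T f x\<bar> \<le> K * (C * e x)"
proof -
  have [measurable]: "e \<in> borel_measurable M" using e by (simp add: schur_weight_def)
  have e0: "0 \<le> e y" if "y \<in> space M" for y using e that by (simp add: schur_weight_def)
  have le: "(\<integral>\<^sup>+y. ennreal (G x y * e y) \<partial>M) \<le> ennreal (C * e x)"
    using e x by (simp add: schur_weight_def)
  have ge0: "AE y in M. 0 \<le> G x y * e y" by (rule AE_I2) (simp add: kernel_nonneg e0)
  have meas: "(\<lambda>y. G x y * e y) \<in> borel_measurable M" using x by measurable
  have int: "integrable M (\<lambda>y. G x y * e y)"
    by (rule integrableI_nonneg[OF meas ge0]) (use le in \<open>auto intro: le_less_trans\<close>)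
  have "ennreal (LINT y|M. G x y * e y) \<le> ennreal (C * e x)"
    using nn_integral_eq_integral[OF int ge0] le by simp
  then have Te: "T e x \<le> C * e x"
    unfolding kernel_op_def using C_nonneg e0[OF x] by (subst (asm) ennreal_le_iff) auto
  have bd: "\<bar>G x y * f y\<bar> \<le> K * (G x y * e y)" if "y \<in> space M" for y
    using mult_left_mono[OF f(2)[OF that] kernel_nonneg[of x y]] kernel_nonneg[of x y]
    by (simp add: abs_mult mult_ac)
  show int': "integrable M (\<lambda>y. G x y * f y)"
  proof (rule Bochner_Integration.integrable_bound)
    show "integrable M (\<lambda>y. K * (G x y * e y))" using int by (rule integrable_mult_right)
    show "AE y in M. norm (G x y * f y) \<le> norm (K * (G x y * e y))"
      by (rule AE_I2) (use bd in \<open>auto intro: order_trans[OF _ abs_ge_self]\<close>)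
    show "(\<lambda>y. G x y * f y) \<in> borel_measurable M" using x f(1) by measurable
  qed
  have K: "0 \<le> K * e x" using f(2)[OF x] by (rule order_trans[OF abs_ge_zero])
  have "\<bar>T f x\<bar> \<le> (LINT y|M. \<bar>G x y * f y\<bar>)"
    unfolding kernel_op_def by (rule integral_abs_bound)
  also have "\<dots> \<le> (LINT y|M. K * (G x y * e y))"
    by (rule integral_mono) (use int int' bd in auto)
  also have "\<dots> = K * T e x" by (simp add: kernel_op_def)
  also have "\<dots> \<le> K * (C * e x)"
  \<comment> \<open>The sign of \<open>K\<close> is not assumed, but a negative \<open>K\<close>
    together with \<open>K * e x \<ge> 0\<close> forces \<open>e x = 0\<close>.\<close>
  proof (cases "K \<ge> 0")
    case True then show ?thesis using Te by (rule mult_left_mono[rotated])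
  next
    case False
    with K e0[OF x] have "e x = 0" by (simp add: mult_nonneg_nonneg zero_le_mult_iff)
    moreover have "T e x \<ge> 0" by (rule T_nonneg) (rule e0)
    ultimately show ?thesis using Te by simp
  qed
  finally show "\<bar>T f x\<bar> \<le> K * (C * e x)" .
qed

text \<open>By duality: symmetry moves \<open>T\<close> from \<open>\<bar>f\<bar>\<close> to
  \<open>e\<close>, and \<open>T e \<le> C * e\<close> is the Schur condition. With
  \<open>e = 1\<close> this is the L^1 bound, with \<open>e = d\<close> the weighted one.\<close>

lemma integral_abs_T_le:
  assumes e: "schur_weight e" and f: "f \<in> borel_measurable M" "integrable M (\<lambda>x. \<bar>f x\<bar> * e x)"
  shows "integrable M (\<lambda>x. \<bar>T f x\<bar> * e x)"
    and "(LINT x|M. \<bar>T f x\<bar> * e x) \<le> C * (LINT x|M. \<bar>f x\<bar> * e x)"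
proof -
  have [measurable]: "e \<in> borel_measurable M" using e by (simp add: schur_weight_def)
  note [measurable] = f(1)
  have e0: "0 \<le> e y" if "y \<in> space M" for y using e that by (simp add: schur_weight_def)
  have P: "integrable (M \<Otimes>\<^sub>M M) (\<lambda>(x, y). e x * (G x y * \<bar>f y\<bar>))"
    by (rule integrable_kernel_pair[OF e, where K=1]) (use f e0 in auto)
  have le: "\<bar>T f x\<bar> * e x \<le> e x * T (\<lambda>y. \<bar>f y\<bar>) x" if "x \<in> space M" for x
    using mult_right_mono[OF abs_T_le e0[OF that]] by (simp add: mult.commute)
  show int: "integrable M (\<lambda>x. \<bar>T f x\<bar> * e x)"
  proof (rule Bochner_Integration.integrable_bound[OF integrable_mult_T[OF P]])
    show "AE x in M. norm (\<bar>T f x\<bar> * e x) \<le> norm (e x * T (\<lambda>y. \<bar>f y\<bar>) x)"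
      by (rule AE_I2) (use le e0 T_nonneg[of "\<lambda>y. \<bar>f y\<bar>"] in \<open>auto simp: abs_mult\<close>)
  qed measurable
  have "(LINT x|M. \<bar>T f x\<bar> * e x) \<le> (LINT x|M. e x * T (\<lambda>y. \<bar>f y\<bar>) x)"
    by (rule integral_mono[OF int integrable_mult_T[OF P] le])
  also have "\<dots> = (LINT x|M. \<bar>f x\<bar> * T e x)" by (rule integral_mult_T_swap[OF P])
  also have "\<dots> \<le> (LINT x|M. C * (\<bar>f x\<bar> * e x))"
  proof (rule integral_mono[OF integrable_mult_T'[OF P]])
    show "integrable M (\<lambda>x. C * (\<bar>f x\<bar> * e x))" using f(2) by (rule integrable_mult_right)
    show "\<bar>f x\<bar> * T e x \<le> C * (\<bar>f x\<bar> * e x)" if "x \<in> space M" for x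
    proof -
      have "T e x \<le> 1 * (C * e x)"
        by (rule order_trans[OF abs_ge_self], rule abs_T_bounded[OF e]) (use that e0 in auto)
      then show ?thesis using mult_left_mono[of "T e x" "C * e x" "\<bar>f x\<bar>"] by (simp add: mult_ac)
    qed
  qed
  also have "\<dots> = C * (LINT x|M. \<bar>f x\<bar> * e x)" by simp
  finally show "(LINT x|M. \<bar>T f x\<bar> * e x) \<le> C * (LINT x|M. \<bar>f x\<bar> * e x)" .
qed

lemma weighted_integrable_T: "weighted_integrable f \<Longrightarrow> weighted_integrable (T f)"
  using integral_abs_T_le(1)[OF schur_weight_weight, of f]
  by (auto simp: weighted_integrable_def)

text \<open>Schur's test. Cauchy-Schwarz for the measure with density \<open>G x y\<close> in
  \<open>y\<close> gives \<open>(T f)\<^sup>2 \<le> T 1 * T (f\<^sup>2)\<close>, where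
  \<open>T 1 \<le> C\<close>; the L^1 bound applied to \<open>f\<^sup>2\<close> contributes the
  second factor \<open>C\<close>.\<close>

lemma T_square_integrable:
  assumes f: "square_integrable M f"
  shows "square_integrable M (T f)"
    and "(LINT x|M. (T f x)\<^sup>2) \<le> C\<^sup>2 * (LINT x|M. (f x)\<^sup>2)"
proof -
  note [measurable] = square_integrable_measurable[OF f]
  have int2: "integrable M (\<lambda>x. (f x)\<^sup>2)" using f by (rule square_integrableD)
  have P: "integrable (M \<Otimes>\<^sub>M M) (\<lambda>(x, y). 1 * (G x y * (f y)\<^sup>2))"
    by (rule integrable_kernel_pair[OF schur_weight_one, where K=1]) (use int2 in auto)
  have le: "AE x in M. (T f x)\<^sup>2 \<le> C * (1 * T (\<lambda>y. (f y)\<^sup>2) x)"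
    using AE_integrable_kernel[OF weighted_integrable_integrable[OF int2]] AE_space
  proof eventually_elim
    case (elim x)
    have [measurable]: "(\<lambda>y. G x y) \<in> borel_measurable M" using elim(2) by measurable
    have iG: "integrable M (\<lambda>y. G x y * 1)"
      by (rule integrable_kernel_bounded[OF schur_weight_one, where K=1]) (use elim(2) in auto)
    have TG: "\<bar>T (\<lambda>_. 1) x\<bar> \<le> 1 * (C * 1)"
      by (rule abs_T_bounded[OF schur_weight_one]) (use elim(2) in auto)
    have 1: "square_integrable M (\<lambda>y. sqrt (G x y))"
      using iG by (intro square_integrableI) (auto simp: kernel_nonneg)
    have 2: "square_integrable M (\<lambda>y. sqrt (G x y) * f y)"
      using elim(1) by (intro square_integrableI) (auto simp: kernel_nonneg power_mult_distrib)
    have "(T f x)\<^sup>2 = (LINT y|M. sqrt (G x y) * (sqrt (G x y) * f y))\<^sup>2"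
      by (simp add: kernel_op_def kernel_nonneg mult.assoc[symmetric])
    also have "\<dots> \<le> (LINT y|M. (sqrt (G x y))\<^sup>2) * (LINT y|M. (sqrt (G x y) * f y)\<^sup>2)"
      by (rule Cauchy_Schwarz_integral[OF 1 2])
    also have "\<dots> = T (\<lambda>_. 1) x * T (\<lambda>y. (f y)\<^sup>2) x"
      by (simp add: kernel_op_def kernel_nonneg power_mult_distrib)
    also have "\<dots> \<le> C * T (\<lambda>y. (f y)\<^sup>2) x"
      using TG by (intro mult_right_mono T_nonneg) auto
    finally show ?case by simp
  qed
  have intR: "integrable M (\<lambda>x. C * (1 * T (\<lambda>y. (f y)\<^sup>2) x))"
    by (rule integrable_mult_right[OF integrable_mult_T[OF P]])
  have int: "integrable M (\<lambda>x. (T f x)\<^sup>2)"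
  proof (rule Bochner_Integration.integrable_bound[OF intR])
    show "AE x in M. norm ((T f x)\<^sup>2) \<le> norm (C * (1 * T (\<lambda>y. (f y)\<^sup>2) x))"
      using le by eventually_elim (auto intro: order_trans[OF _ abs_ge_self])
  qed measurable
  then show "square_integrable M (T f)" by (rule square_integrableI[rotated]) measurable
  have "(LINT x|M. (T f x)\<^sup>2) \<le> (LINT x|M. C * (1 * T (\<lambda>y. (f y)\<^sup>2) x))"
    by (rule integral_mono_AE[OF int intR le])
  also have "\<dots> = C * (LINT x|M. 1 * \<bar>T (\<lambda>y. (f y)\<^sup>2) x\<bar>)"
    by (simp add: T_nonneg)
  also have "\<dots> \<le> C * (C * (LINT x|M. (f x)\<^sup>2))"
    using integral_abs_T_le(2)[OF schur_weight_one, of "\<lambda>x. (f x)\<^sup>2"] int2 C_nonneg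
    by (intro mult_left_mono) auto
  finally show "(LINT x|M. (T f x)\<^sup>2) \<le> C\<^sup>2 * (LINT x|M. (f x)\<^sup>2)"
    by (simp add: power2_eq_square mult.assoc)
qed

lemma T_swap_L2:
  assumes "square_integrable M a" "square_integrable M f"
  shows "(LINT x|M. a x * T f x) = (LINT x|M. f x * T a x)"
  by (rule integral_mult_T_swap[OF integrable_kernel_pair_L2[OF assms]])

lemma T_swap_weighted:
  assumes f: "weighted_integrable f"
    and a: "a \<in> borel_measurable M" "\<And>x. x \<in> space M \<Longrightarrow> \<bar>a x\<bar> \<le> K * d x"
  shows "(LINT x|M. T f x * a x) = (LINT x|M. f x * T a x)"
  using integral_mult_T_swap[OF integrable_kernel_pair[OF schur_weight_weight _ _ a]] f
  by (simp add: weighted_integrable_def mult.commute)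

end

section \<open>The energy of a kernel satisfying a weak maximum principle\<close>

lemma Minkowski_L2:
  assumes "square_integrable M f" "square_integrable M g"
  shows "sqrt (LINT x|M. (f x + g x)\<^sup>2) \<le> sqrt (LINT x|M. (f x)\<^sup>2) + sqrt (LINT x|M. (g x)\<^sup>2)"
proof -
  have "(LINT x|M. (f x + g x)\<^sup>2) = (LINT x|M. (f x)\<^sup>2 + 2 * (f x * g x) + (g x)\<^sup>2)"
    by (rule Bochner_Integration.integral_cong) (auto simp: power2_eq_square algebra_simps)
  also have "\<dots> = (LINT x|M. (f x)\<^sup>2) + 2 * (LINT x|M. f x * g x) + (LINT x|M. (g x)\<^sup>2)"
    using square_integrable_mult[OF assms] assms by (simp add: square_integrable_def)
  also have "\<dots> \<le> (LINT x|M. (f x)\<^sup>2) + 2 * (sqrt (LINT x|M. (f x)\<^sup>2) * sqrt (LINT x|M. (g x)\<^sup>2))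
      + (LINT x|M. (g x)\<^sup>2)"
    using abs_integral_mult_le[OF assms] by simp
  also have "\<dots> = (sqrt (LINT x|M. (f x)\<^sup>2) + sqrt (LINT x|M. (g x)\<^sup>2))\<^sup>2"
    by (simp add: power2_sum)
  finally show ?thesis
    by (intro real_le_lsqrt) auto
qed

lemma lipschitz_imp_measurable:
  fixes g :: "real \<Rightarrow> real"
  assumes g: "\<And>a b. \<bar>g a - g b\<bar> \<le> l * \<bar>a - b\<bar>"
  shows "g \<in> borel_measurable borel"
proof -
  have "l \<ge> 0" using order_trans[OF abs_ge_zero g[of 1 0]] by simp
  then have "l-lipschitz_on UNIV g" using g by (auto simp: lipschitz_on_def dist_real_def)
  then show ?thesis by (intro borel_measurable_continuous_onI lipschitz_on_continuous_on)
qed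

text \<open>All that is retained of the form. With \<open>v = T k\<close>, so that
  \<open>k = L v\<close>, the weak maximum principle says that the form is nonnegative on the pair
  of \<open>v\<close> and \<open>min v 0\<close>. The approximation property says that the cut-off
  of \<open>T \<xi>\<close> is an L^2 limit of functions \<open>\<psi>\<close> for which
  \<open>k \<mapsto> \<integral> k \<psi>\<close> is bounded in the energy norm; this is how finite
  energy of \<open>\<psi>\<close> is expressed without the form.\<close>

locale maximum_principle_kernel = symmetric_kernel +
  fixes c :: real
  assumes c_pos: "0 < c"
    and weight_lower: "\<And>x. x \<in> space M \<Longrightarrow> c * d x \<le> T d x"
    and weak_maximum_principle:
      "\<And>k. square_integrable M k \<Longrightarrow> 0 \<le> (LINT x|M. k x * min (T k x) 0)"
    and energy_approximation:
      "\<And>h \<xi> K1 K2 \<epsilon>. h \<in> borel_measurable M \<Longrightarrow> \<xi> \<in> borel_measurable M \<Longrightarrow>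
         (\<And>x. x \<in> space M \<Longrightarrow> \<bar>h x\<bar> \<le> K1) \<Longrightarrow> (\<And>x. x \<in> space M \<Longrightarrow> \<bar>\<xi> x\<bar> \<le> K2) \<Longrightarrow> \<epsilon> > 0 \<Longrightarrow>
         \<exists>\<psi> K. square_integrable M \<psi> \<and>
           (LINT x|M. ((if 0 < T h x then T \<xi> x else 0) - \<psi> x)\<^sup>2) \<le> \<epsilon> \<and>
           (\<forall>k. square_integrable M k \<longrightarrow> (LINT x|M. k x * \<psi> x)\<^sup>2 \<le> K * (LINT x|M. k x * T k x))"
begin

text \<open>The form evaluated at \<open>T f\<close>, in other words the squared dual norm of
  \<open>f\<close>.\<close>

definition energy :: "('a \<Rightarrow> real) \<Rightarrow> real" where
  "energy f = (LINT x|M. f x * T f x)"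

lemma integrable_mult_T_L2:
  "square_integrable M f \<Longrightarrow> square_integrable M g \<Longrightarrow> integrable M (\<lambda>x. f x * T g x)"
  by (intro square_integrable_mult T_square_integrable)

text \<open>The weak maximum principle for \<open>f\<close> controls the part of \<open>T f\<close>
  below 0, the one for \<open>- f\<close> the part above 0; the two add up to
  \<open>T f\<close>.\<close>

lemma energy_nonneg:
  assumes f: "square_integrable M f"
  shows "0 \<le> energy f"
proof -
  note [measurable] = square_integrable_measurable[OF f]
  note Tf = T_square_integrable(1)[OF f]
  have i: "integrable M (\<lambda>x. f x * min (T f x) 0)" "integrable M (\<lambda>x. f x * max (T f x) 0)"
    by (intro square_integrable_mult[OF f] square_integrable_bound[OF Tf]; simp)+
  have m: "- min (- t) 0 = max t 0" for t :: real by auto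
  have "0 \<le> (LINT x|M. f x * min (T f x) 0)" by (rule weak_maximum_principle[OF f])
  moreover have "0 \<le> (LINT x|M. (- f x) * min (T (\<lambda>x. - f x) x) 0)"
    by (rule weak_maximum_principle[OF square_integrable_uminus[OF f]])
  then have "0 \<le> (LINT x|M. f x * max (T f x) 0)"
    by (simp add: T_uminus m[symmetric])
  moreover have "energy f = (LINT x|M. f x * min (T f x) 0 + f x * max (T f x) 0)"
    unfolding energy_def
    by (intro Bochner_Integration.integral_cong) (auto simp: min_def max_def)
  ultimately show ?thesis using i by simp
qed

lemma energy_lincomb:
  assumes f: "square_integrable M f" and g: "square_integrable M g"
  shows "energy (\<lambda>x. a * f x + b * g x)
    = a\<^sup>2 * energy f + 2 * a * b * (LINT x|M. g x * T f x) + b\<^sup>2 * energy g"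
proof -
  note [measurable] = square_integrable_measurable[OF f] square_integrable_measurable[OF g]
  have "AE x in M. T (\<lambda>y. a * f y + b * g y) x = T (\<lambda>y. a * f y) x + T (\<lambda>y. b * g y) x"
    by (intro T_add weighted_integrable_square_integrable square_integrable_cmult f g)
  then have ae: "AE x in M. T (\<lambda>y. a * f y + b * g y) x = a * T f x + b * T g x"
    by (simp add: T_cmult)
  note i = integrable_mult_T_L2[OF f f] integrable_mult_T_L2[OF f g] integrable_mult_T_L2[OF g f]
    integrable_mult_T_L2[OF g g]
  have "energy (\<lambda>x. a * f x + b * g x) = (LINT x|M. a\<^sup>2 * (f x * T f x) + a * b * (f x * T g x)
      + a * b * (g x * T f x) + b\<^sup>2 * (g x * T g x))"
    unfolding energy_def
  proof (rule integral_cong_AE)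
    show "AE x in M. (a * f x + b * g x) * T (\<lambda>x. a * f x + b * g x) x = a\<^sup>2 * (f x * T f x)
        + a * b * (f x * T g x) + a * b * (g x * T f x) + b\<^sup>2 * (g x * T g x)"
      using ae by eventually_elim (simp add: power2_eq_square algebra_simps)
  qed measurable
  also have "\<dots> = a\<^sup>2 * energy f + a * b * (LINT x|M. f x * T g x)
      + a * b * (LINT x|M. g x * T f x) + b\<^sup>2 * energy g"
    using i by (simp add: energy_def)
  finally show ?thesis using T_swap_L2[OF f g] by (simp add: algebra_simps)
qed

lemma energy_Cauchy_Schwarz:
  assumes f: "square_integrable M f" and g: "square_integrable M g"
  shows "(LINT x|M. g x * T f x)\<^sup>2 \<le> energy f * energy g"
proof (rule discriminant_nonpos)
  fix t
  have "0 \<le> energy (\<lambda>x. 1 * f x + t * g x)"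
    by (intro energy_nonneg square_integrable_add square_integrable_cmult f g)
  then show "0 \<le> energy f + 2 * t * (LINT x|M. g x * T f x) + t\<^sup>2 * energy g"
    unfolding energy_lincomb[OF f g] by simp
qed

lemma energy_le:
  assumes f: "square_integrable M f"
  shows "energy f \<le> C * (LINT x|M. (f x)\<^sup>2)"
proof (rule power2_le_imp_le)
  have "(energy f)\<^sup>2 \<le> (LINT x|M. (f x)\<^sup>2) * (LINT x|M. (T f x)\<^sup>2)"
    unfolding energy_def by (rule Cauchy_Schwarz_integral[OF f T_square_integrable(1)[OF f]])
  also have "\<dots> \<le> (LINT x|M. (f x)\<^sup>2) * (C\<^sup>2 * (LINT x|M. (f x)\<^sup>2))"
    by (rule mult_left_mono[OF T_square_integrable(2)[OF f]]) simp
  finally show "(energy f)\<^sup>2 \<le> (C * (LINT x|M. (f x)\<^sup>2))\<^sup>2"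
    by (simp add: power2_eq_square mult_ac)
qed (use C_nonneg in simp)

text \<open>Cauchy-Schwarz for the energy with second argument \<open>T f\<close>: the left side
  becomes the square of the L^2 integral of \<open>T f\<close>, and \<open>energy (T f)\<close> is
  at most \<open>C\<close> times that integral, which can then be cancelled.\<close>

lemma T_L2_le_energy:
  assumes f: "square_integrable M f"
  shows "(LINT x|M. (T f x)\<^sup>2) \<le> C * energy f"
proof (cases "(LINT x|M. (T f x)\<^sup>2) = 0")
  case True
  then show ?thesis using C_nonneg energy_nonneg[OF f] by simp
next
  case False
  then have pos: "(LINT x|M. (T f x)\<^sup>2) > 0" by (simp add: order.not_eq_order_implies_strict)
  note Tf = T_square_integrable(1)[OF f]
  have "(LINT x|M. (T f x)\<^sup>2)\<^sup>2 \<le> energy f * energy (T f)"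
    using energy_Cauchy_Schwarz[OF f Tf] by (simp add: power2_eq_square)
  also have "\<dots> \<le> energy f * (C * (LINT x|M. (T f x)\<^sup>2))"
    by (rule mult_left_mono[OF energy_le[OF Tf] energy_nonneg[OF f]])
  finally have "(LINT x|M. (T f x)\<^sup>2) * (LINT x|M. (T f x)\<^sup>2)
      \<le> (C * energy f) * (LINT x|M. (T f x)\<^sup>2)"
    by (simp add: power2_eq_square mult_ac)
  then show ?thesis using pos by simp
qed

section \<open>Lipschitz nonlinearities\<close>

text \<open>The unknown is \<open>\<rho> = f - g (T \<rho>)\<close>, with
  \<open>u = T \<rho>\<close>. In the inner product \<open>\<integral> \<rho> T \<sigma>\<close> the
  map \<open>\<rho> \<mapsto> g (T \<rho>)\<close> is monotone and Lipschitz, which makes the damped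
  step a contraction whatever the size of \<open>l\<close>. The energy norm controls only
  \<open>T \<rho>\<close> in L^2, so the limit is taken of \<open>T (rho n)\<close> and the equation
  is verified for it directly.\<close>

lemma lipschitz_existence:
  fixes g :: "real \<Rightarrow> real"
  assumes f: "square_integrable M f" and mono: "mono g"
    and lip: "\<And>a b. \<bar>g a - g b\<bar> \<le> l * \<bar>a - b\<bar>" and g0: "g 0 = 0"
  shows "\<exists>u. square_integrable M u \<and> (AE x in M. u x = T (\<lambda>y. f y - g (u y)) x)"
proof -
  have l0: "l \<ge> 0" using order_trans[OF abs_ge_zero lip[of 1 0]] by simp
  note [measurable] = lipschitz_imp_measurable[OF lip] square_integrable_measurable[OF f]
  note g_sq = square_integrable_lipschitz[OF _ lip g0]
  \<comment> \<open>The squared Lipschitz constant of \<open>\<rho> \<mapsto> g (T \<rho>)\<close>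
    in the energy norm: one factor \<open>C\<close> comes from \<open>energy_le\<close>, the other
    from \<open>T_L2_le_energy\<close>.\<close>
  define K where "K = C\<^sup>2 * l\<^sup>2"
  have K0: "K \<ge> 0" by (simp add: K_def)
  \<comment> \<open>The minimiser of \<open>(1 - t)\<^sup>2 + t\<^sup>2 * K\<close>, the contraction
    factor that remains when the cross term is dropped.\<close>
  define t where "t = 1 / (1 + K)"
  have t: "0 < t" "t \<le> 1" using K0 by (auto simp: t_def)
  define r where "r = (1 - t)\<^sup>2 + t\<^sup>2 * K"
  have r_eq: "r = K / (1 + K)"
  proof -
    have "1 - t = K / (1 + K)" using K0 by (simp add: t_def field_simps)
    then have "r = (K\<^sup>2 + K) / (1 + K)\<^sup>2"
      by (simp add: r_def t_def power_divide add_divide_distrib)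
    also have "\<dots> = (K * (1 + K)) / ((1 + K) * (1 + K))" by (simp add: power2_eq_square algebra_simps)
    also have "\<dots> = K / (1 + K)" using K0 by simp
    finally show ?thesis .
  qed
  have r: "0 \<le> r" "r < 1" using K0 by (auto simp: r_eq)
  define rho where "rho = rec_nat (\<lambda>_. 0) (\<lambda>_ p x. (1 - t) * p x + t * (f x - g (T p x)))"
  have rho_0: "rho 0 = (\<lambda>_. 0)" by (simp add: rho_def)
  have rho_Suc: "rho (Suc n) = (\<lambda>x. (1 - t) * rho n x + t * (f x - g (T (rho n) x)))" for n
    by (simp add: rho_def)
  have rho_sq: "square_integrable M (rho n)" for n
  proof (induction n)
    case 0 show ?case by (simp add: rho_0 square_integrable_def)
  next
    case (Suc n)
    then show ?case unfolding rho_Suc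
      by (intro square_integrable_add square_integrable_cmult square_integrable_diff f g_sq
          T_square_integrable)
  qed
  define \<delta> where "\<delta> n x = rho (Suc n) x - rho n x" for n x
  have \<delta>_sq: "square_integrable M (\<delta> n)" for n
    unfolding \<delta>_def by (intro square_integrable_diff rho_sq)
  define \<theta> where "\<theta> n x = g (T (rho (Suc n)) x) - g (T (rho n) x)" for n x
  have \<theta>_sq: "square_integrable M (\<theta> n)" for n
    unfolding \<theta>_def by (intro square_integrable_diff g_sq T_square_integrable rho_sq)
  have \<delta>_Suc: "\<delta> (Suc n) = (\<lambda>x. (1 - t) * \<delta> n x + (- t) * \<theta> n x)" for n
    unfolding \<delta>_def \<theta>_def rho_Suc[of "Suc n"] by (subst (3) rho_Suc) (auto simp: algebra_simps)
  have T\<delta>: "AE x in M. T (\<delta> n) x = T (rho (Suc n)) x - T (rho n) x" for n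
    unfolding \<delta>_def by (intro T_diff weighted_integrable_square_integrable rho_sq)
  have step: "energy (\<delta> (Suc n)) \<le> r * energy (\<delta> n)" for n
  proof -
    \<comment> \<open>Monotonicity of \<open>g\<close> fixes the sign of the cross term, which
      enters the energy of the next increment with a minus sign and can be discarded.\<close>
    have "AE x in M. 0 \<le> \<theta> n x * T (\<delta> n) x"
      using T\<delta>[of n]
    proof eventually_elim
      case (elim x)
      show ?case unfolding \<theta>_def elim
        using monoD[OF mono, of "T (rho (Suc n)) x" "T (rho n) x"]
          monoD[OF mono, of "T (rho n) x" "T (rho (Suc n)) x"]
        by (cases "T (rho (Suc n)) x \<le> T (rho n) x") (auto intro: mult_nonneg_nonneg mult_nonpos_nonpos)
    qed
    then have 1: "0 \<le> (LINT x|M. \<theta> n x * T (\<delta> n) x)" by (rule integral_nonneg_AE)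
    have "AE x in M. (\<theta> n x)\<^sup>2 \<le> l\<^sup>2 * (T (\<delta> n) x)\<^sup>2"
      using T\<delta>[of n]
    proof eventually_elim
      case (elim x)
      have "\<bar>\<theta> n x\<bar> \<le> \<bar>l * T (\<delta> n) x\<bar>"
        unfolding \<theta>_def elim using lip l0 by (simp add: abs_mult)
      then show ?case unfolding abs_le_square_iff by (simp add: power_mult_distrib)
    qed
    then have "(LINT x|M. (\<theta> n x)\<^sup>2) \<le> (LINT x|M. l\<^sup>2 * (T (\<delta> n) x)\<^sup>2)"
      by (intro integral_mono_AE integrable_mult_right square_integrableD \<theta>_sq T_square_integrable \<delta>_sq)
    also have "\<dots> \<le> l\<^sup>2 * (C * energy (\<delta> n))"
      using mult_left_mono[OF T_L2_le_energy[OF \<delta>_sq[of n]], of "l\<^sup>2"] by simp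
    finally have "C * (LINT x|M. (\<theta> n x)\<^sup>2) \<le> C * (l\<^sup>2 * (C * energy (\<delta> n)))"
      by (rule mult_left_mono[OF _ C_nonneg])
    with energy_le[OF \<theta>_sq[of n]] have 2: "energy (\<theta> n) \<le> K * energy (\<delta> n)"
      by (simp add: K_def power2_eq_square mult_ac)
    have "energy (\<delta> (Suc n)) = (1 - t)\<^sup>2 * energy (\<delta> n)
        - 2 * (1 - t) * t * (LINT x|M. \<theta> n x * T (\<delta> n) x) + t\<^sup>2 * energy (\<theta> n)"
      unfolding \<delta>_Suc energy_lincomb[OF \<delta>_sq \<theta>_sq] by simp
    also have "\<dots> \<le> (1 - t)\<^sup>2 * energy (\<delta> n) - 0 + t\<^sup>2 * (K * energy (\<delta> n))"
      using 1 t by (intro add_mono diff_mono mult_left_mono[OF 2]) auto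
    finally show ?thesis by (simp add: r_def algebra_simps)
  qed
  have decay: "energy (\<delta> n) \<le> r ^ n * energy (\<delta> 0)" for n
  proof (induction n)
    case (Suc n)
    have "energy (\<delta> (Suc n)) \<le> r * energy (\<delta> n)" by (rule step)
    also have "\<dots> \<le> r * (r ^ n * energy (\<delta> 0))" using Suc r by (intro mult_left_mono)
    finally show ?case by simp
  qed simp
  define A where "A = sqrt (C * energy (\<delta> 0))"
  have A0: "A \<ge> 0" using C_nonneg energy_nonneg[OF \<delta>_sq[of 0]] by (simp add: A_def)
  have T\<delta>_norm: "sqrt (LINT x|M. (T (\<delta> n) x)\<^sup>2) \<le> A * sqrt r ^ n" for n
  proof -
    have "(LINT x|M. (T (\<delta> n) x)\<^sup>2) \<le> C * energy (\<delta> n)" by (rule T_L2_le_energy[OF \<delta>_sq])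
    also have "\<dots> \<le> C * (r ^ n * energy (\<delta> 0))" by (rule mult_left_mono[OF decay C_nonneg])
    finally have "sqrt (LINT x|M. (T (\<delta> n) x)\<^sup>2) \<le> sqrt (C * energy (\<delta> 0) * r ^ n)"
      by (simp add: mult_ac)
    then show ?thesis by (simp add: A_def real_sqrt_mult real_sqrt_power)
  qed
  define u where "u n = T (rho n)" for n
  have u_sq: "square_integrable M (u n)" for n
    unfolding u_def by (intro T_square_integrable rho_sq)
  have u_diff: "(LINT x|M. \<bar>u (Suc n) x - u n x\<bar>) = (LINT x|M. \<bar>T (\<delta> n) x\<bar>)" for n
  proof (rule integral_cong_AE)
    note [measurable] = square_integrable_measurable[OF u_sq] square_integrable_measurable[OF \<delta>_sq]
    show "AE x in M. \<bar>u (Suc n) x - u n x\<bar> = \<bar>T (\<delta> n) x\<bar>"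
      using T\<delta>[of n] by eventually_elim (simp add: u_def)
    show "(\<lambda>x. \<bar>u (Suc n) x - u n x\<bar>) \<in> borel_measurable M" by measurable
    show "(\<lambda>x. \<bar>T (\<delta> n) x\<bar>) \<in> borel_measurable M" by measurable
  qed
  have sr: "0 \<le> sqrt r" "sqrt r < 1" using r by auto
  have "summable (\<lambda>n. LINT x|M. \<bar>u (Suc n) x - u n x\<bar>)"
  proof (rule summable_comparison_test')
    show "summable (\<lambda>n. sqrt (measure M (space M)) * A * sqrt r ^ n)"
      using sr by (intro summable_mult summable_geometric) simp
    fix n :: nat
    have "(LINT x|M. \<bar>T (\<delta> n) x\<bar>)
        \<le> sqrt (measure M (space M)) * sqrt (LINT x|M. (T (\<delta> n) x)\<^sup>2)"
      by (intro integral_abs_le_L2 T_square_integrable \<delta>_sq)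
    also have "\<dots> \<le> sqrt (measure M (space M)) * (A * sqrt r ^ n)"
      by (intro mult_left_mono T\<delta>_norm) simp
    finally show "norm (LINT x|M. \<bar>u (Suc n) x - u n x\<bar>) \<le> sqrt (measure M (space M)) * A * sqrt r ^ n"
      by (simp add: u_diff mult.assoc)
  qed
  then obtain v where v: "integrable M v" "AE x in M. (\<lambda>n. u n x) \<longlonglongrightarrow> v x"
    "(\<lambda>n. LINT x|M. \<bar>u n x - v x\<bar>) \<longlonglongrightarrow> 0"
    using L1_limit_of_summable[of M u] square_integrable_integrable[OF u_sq] by blast
  note [measurable] = borel_measurable_integrable[OF v(1)] square_integrable_measurable[OF u_sq]
  \<comment> \<open>So far the limit is only in L^1. This bound, uniform in \<open>n\<close> because
    the geometric series converges, and Fatou's lemma place \<open>v\<close> in L^2.\<close>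
  have u_norm: "sqrt (LINT x|M. (u n x)\<^sup>2) \<le> A * (\<Sum>i<n. sqrt r ^ i)" for n
  proof (induction n)
    case 0
    show ?case by (simp add: u_def rho_0 kernel_op_def)
  next
    case (Suc n)
    have "(LINT x|M. (u (Suc n) x)\<^sup>2) = (LINT x|M. (u n x + T (\<delta> n) x)\<^sup>2)"
    proof (rule integral_cong_AE)
      note [measurable] = square_integrable_measurable[OF \<delta>_sq]
      show "AE x in M. (u (Suc n) x)\<^sup>2 = (u n x + T (\<delta> n) x)\<^sup>2"
        using T\<delta>[of n] by eventually_elim (simp add: u_def)
      show "(\<lambda>x. (u n x + T (\<delta> n) x)\<^sup>2) \<in> borel_measurable M" by measurable
    qed measurable
    also have "sqrt \<dots> \<le> sqrt (LINT x|M. (u n x)\<^sup>2) + sqrt (LINT x|M. (T (\<delta> n) x)\<^sup>2)"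
      by (intro Minkowski_L2 u_sq T_square_integrable \<delta>_sq)
    also have "\<dots> \<le> A * (\<Sum>i<n. sqrt r ^ i) + A * sqrt r ^ n"
      by (intro add_mono Suc T\<delta>_norm)
    finally show ?case by (simp add: algebra_simps)
  qed
  define B where "B = A * (1 / (1 - sqrt r))"
  have u_bound: "(LINT x|M. (u n x)\<^sup>2) \<le> B\<^sup>2" for n
  proof -
    have "(\<Sum>i<n. sqrt r ^ i) \<le> (\<Sum>i. sqrt r ^ i)"
      by (rule sum_le_suminf) (use sr in \<open>auto intro: summable_geometric\<close>)
    also have "\<dots> = 1 / (1 - sqrt r)" by (rule suminf_geometric) (use sr in simp)
    finally have "A * (\<Sum>i<n. sqrt r ^ i) \<le> B" unfolding B_def by (rule mult_left_mono[OF _ A0])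
    with u_norm[of n] have "sqrt (LINT x|M. (u n x)\<^sup>2) \<le> B" by linarith
    then show ?thesis by (rule sqrt_le_D)
  qed
  have v_sq: "square_integrable M v"
  proof (rule square_integrableI)
    show "integrable M (\<lambda>x. (v x)\<^sup>2)"
    proof (rule integrableI_bounded)
      have "(\<integral>\<^sup>+x. ennreal (norm ((v x)\<^sup>2)) \<partial>M) = (\<integral>\<^sup>+x. liminf (\<lambda>n. ennreal ((u n x)\<^sup>2)) \<partial>M)"
      proof (rule nn_integral_cong_AE)
        show "AE x in M. ennreal (norm ((v x)\<^sup>2)) = liminf (\<lambda>n. ennreal ((u n x)\<^sup>2))"
          using v(2)
        proof eventually_elim
          case (elim x)
          then have "(\<lambda>n. ennreal ((u n x)\<^sup>2)) \<longlonglongrightarrow> ennreal ((v x)\<^sup>2)"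
            by (intro tendsto_ennrealI tendsto_power)
          from lim_imp_Liminf[OF sequentially_bot this] show ?case by simp
        qed
      qed
      also have "\<dots> \<le> liminf (\<lambda>n. \<integral>\<^sup>+x. ennreal ((u n x)\<^sup>2) \<partial>M)"
        by (rule nn_integral_liminf) measurable
      also have "\<dots> \<le> liminf (\<lambda>n. ennreal (B\<^sup>2))"
      proof (rule Liminf_mono, rule always_eventually, rule allI)
        fix n
        have "(\<integral>\<^sup>+x. ennreal ((u n x)\<^sup>2) \<partial>M) = ennreal (LINT x|M. (u n x)\<^sup>2)"
          by (rule nn_integral_eq_integral) (use u_sq in \<open>auto simp: square_integrable_def\<close>)
        also have "\<dots> \<le> ennreal (B\<^sup>2)" using u_bound by (rule ennreal_leI)
        finally show "(\<integral>\<^sup>+x. ennreal ((u n x)\<^sup>2) \<partial>M) \<le> ennreal (B\<^sup>2)" .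
      qed
      also have "\<dots> = ennreal (B\<^sup>2)" by (simp add: Liminf_const)
      also have "\<dots> < \<infinity>" by simp
      finally show "(\<integral>\<^sup>+x. ennreal (norm ((v x)\<^sup>2)) \<partial>M) < \<infinity>" .
    qed measurable
  qed measurable
  have g_int: "square_integrable M (\<lambda>x. f x - g (w x))" if "square_integrable M w" for w
    by (intro square_integrable_diff f g_sq that)
  define R where "R = (\<lambda>w x. T (\<lambda>y. f y - g (w y)) x)"
  have R_sq: "square_integrable M (R w)" if "square_integrable M w" for w
    unfolding R_def by (intro T_square_integrable g_int that)
  have u_Suc: "AE x in M. u (Suc n) x = (1 - t) * u n x + t * R (u n) x" for n
  proof -
    have "AE x in M. T (rho (Suc n)) x
        = T (\<lambda>y. (1 - t) * rho n y) x + T (\<lambda>y. t * (f y - g (T (rho n) y))) x"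
      unfolding rho_Suc
      by (intro T_add weighted_integrable_square_integrable square_integrable_cmult rho_sq g_int
          T_square_integrable)
    then show ?thesis unfolding T_cmult by (simp add: u_def R_def)
  qed
  have R_lip: "(LINT x|M. \<bar>R (u n) x - R v x\<bar>) \<le> C * l * (LINT x|M. \<bar>u n x - v x\<bar>)" for n
  proof -
    define h where "h y = g (v y) - g (u n y)" for y
    have h_sq: "square_integrable M h"
      unfolding h_def by (intro square_integrable_diff g_sq v_sq u_sq)
    note [measurable] = square_integrable_measurable[OF h_sq]
      square_integrable_measurable[OF R_sq[OF v_sq]] square_integrable_measurable[OF R_sq[OF u_sq]]
    have h_eq: "(\<lambda>y. (f y - g (u n y)) - (f y - g (v y))) = h" by (simp add: h_def fun_eq_iff)
    have "AE x in M. T h x = R (u n) x - R v x"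
      using T_diff[OF weighted_integrable_square_integrable[OF g_int[OF u_sq[of n]]]
        weighted_integrable_square_integrable[OF g_int[OF v_sq]]]
      unfolding h_eq R_def .
    then have "AE x in M. \<bar>R (u n) x - R v x\<bar> = \<bar>T h x\<bar> * 1" by eventually_elim simp
    then have "(LINT x|M. \<bar>R (u n) x - R v x\<bar>) = (LINT x|M. \<bar>T h x\<bar> * 1)"
      by (rule integral_cong_AE[rotated 2]) measurable
    also have "\<dots> \<le> C * (LINT x|M. \<bar>h x\<bar> * 1)"
      by (rule integral_abs_T_le(2)[OF schur_weight_one])
        (use square_integrable_integrable[OF h_sq] in auto)
    also have "(LINT x|M. \<bar>h x\<bar> * 1) \<le> (LINT x|M. l * \<bar>u n x - v x\<bar>)"
    proof (rule integral_mono)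
      show "integrable M (\<lambda>x. \<bar>h x\<bar> * 1)" using square_integrable_integrable[OF h_sq] by simp
      show "integrable M (\<lambda>x. l * \<bar>u n x - v x\<bar>)"
        using square_integrable_integrable[OF square_integrable_diff[OF u_sq[of n] v_sq]] by simp
      show "\<bar>h x\<bar> * 1 \<le> l * \<bar>u n x - v x\<bar>" for x
        using lip[of "v x" "u n x"] by (simp add: h_def abs_minus_commute)
    qed
    finally show ?thesis using C_nonneg by (simp add: mult.assoc mult_left_mono)
  qed
  \<comment> \<open>The integrand is \<open>t * (v x - R v x)\<close> in absolute value, so
    \<open>Z = 0\<close> is the fixed point equation. It is written as the defect of the damped step
    in order to compare it with the iteration.\<close>
  define Z where "Z = (LINT x|M. \<bar>v x - ((1 - t) * v x + t * R v x)\<bar>)"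
  have int_uv: "integrable M (\<lambda>x. \<bar>u n x - v x\<bar>)" for n
    using square_integrable_integrable[OF square_integrable_diff[OF u_sq[of n] v_sq]] by simp
  have int_R: "integrable M (\<lambda>x. \<bar>R (u n) x - R v x\<bar>)" for n
    using square_integrable_integrable[OF square_integrable_diff[OF R_sq[OF u_sq[of n]] R_sq[OF v_sq]]]
    by simp
  have int_Z: "integrable M (\<lambda>x. v x - ((1 - t) * v x + t * R v x))"
    by (intro Bochner_Integration.integrable_diff Bochner_Integration.integrable_add
        integrable_mult_right square_integrable_integrable R_sq v_sq)
  have Z_le: "Z \<le> (LINT x|M. \<bar>u (Suc n) x - v x\<bar>) + (1 + C * l) * (LINT x|M. \<bar>u n x - v x\<bar>)" for n
  proof -
    have "Z \<le> (LINT x|M. \<bar>u (Suc n) x - v x\<bar> + \<bar>u n x - v x\<bar> + \<bar>R (u n) x - R v x\<bar>)"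
      unfolding Z_def
    proof (rule integral_mono_AE)
      show "integrable M (\<lambda>x. \<bar>u (Suc n) x - v x\<bar> + \<bar>u n x - v x\<bar> + \<bar>R (u n) x - R v x\<bar>)"
        by (intro Bochner_Integration.integrable_add int_uv int_R)
      show "AE x in M. \<bar>v x - ((1 - t) * v x + t * R v x)\<bar>
          \<le> \<bar>u (Suc n) x - v x\<bar> + \<bar>u n x - v x\<bar> + \<bar>R (u n) x - R v x\<bar>"
        using u_Suc[of n]
      proof eventually_elim
        case (elim x)
        have "v x - ((1 - t) * v x + t * R v x)
            = (v x - u (Suc n) x) + (1 - t) * (u n x - v x) + t * (R (u n) x - R v x)"
          unfolding elim by (simp add: algebra_simps)
        then have "\<bar>v x - ((1 - t) * v x + t * R v x)\<bar>
            \<le> \<bar>v x - u (Suc n) x\<bar> + \<bar>(1 - t) * (u n x - v x)\<bar> + \<bar>t * (R (u n) x - R v x)\<bar>"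
          by linarith
        also have "\<dots> \<le> \<bar>u (Suc n) x - v x\<bar> + \<bar>u n x - v x\<bar> + \<bar>R (u n) x - R v x\<bar>"
          using t by (intro add_mono) (auto simp: abs_mult mult_left_le_one_le)
        finally show ?case .
      qed
    qed (use int_Z in simp)
    also have "\<dots> = (LINT x|M. \<bar>u (Suc n) x - v x\<bar>) + (LINT x|M. \<bar>u n x - v x\<bar>)
        + (LINT x|M. \<bar>R (u n) x - R v x\<bar>)"
      using int_uv int_R by simp
    finally show ?thesis using R_lip[of n] by (simp add: algebra_simps)
  qed
  have "(\<lambda>n. (LINT x|M. \<bar>u (Suc n) x - v x\<bar>) + (1 + C * l) * (LINT x|M. \<bar>u n x - v x\<bar>))
      \<longlonglongrightarrow> 0 + (1 + C * l) * 0"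
    by (intro tendsto_add tendsto_mult tendsto_const v(3) LIMSEQ_Suc[OF v(3)])
  then have "Z \<le> 0 + (1 + C * l) * 0"
    by (rule LIMSEQ_le_const) (use Z_le in blast)
  moreover have "Z \<ge> 0" unfolding Z_def by simp
  ultimately have "Z = 0" by simp
  then have "AE x in M. \<bar>v x - ((1 - t) * v x + t * R v x)\<bar> = 0"
    unfolding Z_def by (subst (asm) integral_nonneg_eq_0_iff_AE) (use int_Z in auto)
  then have "AE x in M. v x = R v x"
  proof eventually_elim
    case (elim x)
    then have "t * (v x - R v x) = 0" by (simp add: algebra_simps)
    then show ?case using t by simp
  qed
  then show ?thesis using v_sq unfolding R_def by blast
qed

end

section \<open>Resolvents and Kato's inequality\<close>

context maximum_principle_kernel
begin

text \<open>\<open>v = m (L + m)\<^sup>-\<^sup>1 w\<close>, where \<open>T\<close> is the inverse of \<open>L\<close>.\<close>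

definition is_resolvent :: "real \<Rightarrow> ('a \<Rightarrow> real) \<Rightarrow> ('a \<Rightarrow> real) \<Rightarrow> bool" where
  "is_resolvent m w v \<longleftrightarrow> square_integrable M v \<and> (AE x in M. v x = T (\<lambda>y. m * (w y - v y)) x)"

text \<open>The resolvent equation is the semilinear equation with datum \<open>m * w\<close> and
  the Lipschitz nonlinearity \<open>m * t\<close>.\<close>

lemma resolvent_exists:
  assumes w: "square_integrable M w" and m: "m > 0"
  shows "\<exists>v. is_resolvent m w v"
proof -
  have "\<exists>v. square_integrable M v \<and> (AE x in M. v x = T (\<lambda>y. m * w y - m * v y) x)"
  proof (rule lipschitz_existence)
    show "square_integrable M (\<lambda>x. m * w x)" by (rule square_integrable_cmult[OF w])
    show "mono (\<lambda>t. m * t)" using m by (intro monoI) (simp add: mult_left_mono)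
    show "\<bar>m * a - m * b\<bar> \<le> m * \<bar>a - b\<bar>" for a b
      using m by (simp add: right_diff_distrib[symmetric] abs_mult)
  qed simp
  then show ?thesis by (simp add: is_resolvent_def right_diff_distrib)
qed

lemma resolvent_diff:
  assumes a: "square_integrable M a" "is_resolvent m a v"
    and b: "square_integrable M b" "is_resolvent m b w"
  shows "is_resolvent m (\<lambda>x. a x - b x) (\<lambda>x. v x - w x)"
proof -
  have v: "square_integrable M v" "square_integrable M w"
    and ae: "AE x in M. v x = T (\<lambda>y. m * (a y - v y)) x" "AE x in M. w x = T (\<lambda>y. m * (b y - w y)) x"
    using a b by (auto simp: is_resolvent_def)
  have "AE x in M. T (\<lambda>y. m * (a y - v y) - m * (b y - w y)) x
      = T (\<lambda>y. m * (a y - v y)) x - T (\<lambda>y. m * (b y - w y)) x"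
    by (intro T_diff weighted_integrable_square_integrable square_integrable_cmult
        square_integrable_diff a b v)
  moreover have "(\<lambda>y. m * (a y - v y) - m * (b y - w y)) = (\<lambda>y. m * ((a y - b y) - (v y - w y)))"
    by (auto simp: algebra_simps)
  ultimately have "AE x in M. T (\<lambda>y. m * ((a y - b y) - (v y - w y))) x
      = T (\<lambda>y. m * (a y - v y)) x - T (\<lambda>y. m * (b y - w y)) x"
    by simp
  with ae have "AE x in M. v x - w x = T (\<lambda>y. m * ((a y - b y) - (v y - w y))) x"
    by eventually_elim simp
  with v show ?thesis by (simp add: is_resolvent_def square_integrable_diff)
qed

text \<open>With \<open>k = m * (w - v)\<close> and \<open>T k = v\<close>, the weak maximum
  principle has the integrand \<open>m * (w - v) * min v 0\<close>, which is at most
  \<open>- m * (min v 0)\<^sup>2\<close> where \<open>w \<ge> 0\<close>. So the negative part of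
  \<open>v\<close> vanishes.\<close>

lemma resolvent_nonneg:
  assumes w: "square_integrable M w" "AE x in M. 0 \<le> w x" and v: "is_resolvent m w v" and m: "m > 0"
  shows "AE x in M. 0 \<le> v x"
proof -
  have v_sq: "square_integrable M v" and v_eq: "AE x in M. v x = T (\<lambda>y. m * (w y - v y)) x"
    using v by (auto simp: is_resolvent_def)
  note [measurable] = square_integrable_measurable[OF w(1)] square_integrable_measurable[OF v_sq]
  define k where "k y = m * (w y - v y)" for y
  have k_sq: "square_integrable M k"
    unfolding k_def by (intro square_integrable_cmult square_integrable_diff w v_sq)
  note [measurable] = square_integrable_measurable[OF k_sq]
  have v_eq: "AE x in M. v x = T k x" using v_eq by (simp add: k_def[abs_def])
  have min_sq: "square_integrable M (\<lambda>x. min (v x) 0)"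
    by (rule square_integrable_bound[OF v_sq]) auto
  have "0 \<le> (LINT x|M. k x * min (T k x) 0)" by (rule weak_maximum_principle[OF k_sq])
  also have "\<dots> \<le> (LINT x|M. - m * (min (v x) 0)\<^sup>2)"
  proof (rule integral_mono_AE)
    show "integrable M (\<lambda>x. k x * min (T k x) 0)"
      by (intro square_integrable_mult[OF k_sq]
          square_integrable_bound[OF T_square_integrable(1)[OF k_sq]]) auto
    show "integrable M (\<lambda>x. - m * (min (v x) 0)\<^sup>2)"
      by (intro integrable_mult_right square_integrableD min_sq)
    show "AE x in M. k x * min (T k x) 0 \<le> - m * (min (v x) 0)\<^sup>2"
      using v_eq w(2)
    proof eventually_elim
      case (elim x)
      have "m * w x * min (v x) 0 \<le> 0" using m elim by (simp add: mult_nonneg_nonpos)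
      moreover have "v x * min (v x) 0 = (min (v x) 0)\<^sup>2" by (auto simp: min_def power2_eq_square)
      ultimately show ?case unfolding elim(1)[symmetric] k_def by (simp add: algebra_simps)
    qed
  qed
  finally have "m * (LINT x|M. (min (v x) 0)\<^sup>2) \<le> 0" by simp
  with m have "(LINT x|M. (min (v x) 0)\<^sup>2) \<le> 0" by (simp add: mult_le_0_iff)
  then have "(LINT x|M. (min (v x) 0)\<^sup>2) = 0" by (simp add: order_antisym)
  then have "AE x in M. (min (v x) 0)\<^sup>2 = 0"
    by (subst (asm) integral_nonneg_eq_0_iff_AE) (use square_integrableD[OF min_sq] in auto)
  then show ?thesis by eventually_elim (auto simp: min_def split: if_splits)
qed

text \<open>Writing \<open>a = a' + v\<close> and \<open>b = b' + w\<close>, both sides contain the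
  integral of \<open>v * w\<close>; the rest is the symmetry of \<open>T\<close>, since
  \<open>v = m * T a'\<close> and \<open>w = m * T b'\<close>.\<close>

lemma resolvent_swap:
  assumes a: "square_integrable M a" "is_resolvent m a v"
    and b: "square_integrable M b" "is_resolvent m b w"
  shows "(LINT x|M. v x * b x) = (LINT x|M. a x * w x)"
proof -
  have v: "square_integrable M v" "square_integrable M w"
    using a b by (auto simp: is_resolvent_def)
  define a' where "a' y = a y - v y" for y
  define b' where "b' y = b y - w y" for y
  have sq: "square_integrable M a'" "square_integrable M b'"
    unfolding a'_def b'_def by (intro square_integrable_diff a b v)+
  note [measurable] = sq[THEN square_integrable_measurable] v[THEN square_integrable_measurable]
    a(1)[THEN square_integrable_measurable] b(1)[THEN square_integrable_measurable]
  have ae: "AE x in M. v x = m * T a' x" "AE x in M. w x = m * T b' x"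
    using a(2) b(2) by (simp_all add: is_resolvent_def a'_def[abs_def] b'_def[abs_def] T_cmult)
  have eq: "(LINT x|M. v x * b' x) = (LINT x|M. a' x * w x)"
  proof -
    have "(LINT x|M. v x * b' x) = (LINT x|M. m * (b' x * T a' x))"
      by (rule integral_cong_AE) (use ae(1) in \<open>auto elim!: eventually_mono\<close>)
    also have "\<dots> = m * (LINT x|M. a' x * T b' x)"
      using T_swap_L2[OF sq] by simp
    also have "\<dots> = (LINT x|M. m * (a' x * T b' x))" by simp
    also have "\<dots> = (LINT x|M. a' x * w x)"
      by (rule integral_cong_AE) (use ae(2) in \<open>auto elim!: eventually_mono\<close>)
    finally show ?thesis .
  qed
  have "(LINT x|M. v x * b x) = (LINT x|M. v x * b' x + v x * w x)"
    by (rule Bochner_Integration.integral_cong) (auto simp: b'_def algebra_simps)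
  also have "\<dots> = (LINT x|M. a' x * w x) + (LINT x|M. v x * w x)"
    using eq square_integrable_mult[OF v(1) sq(2)] square_integrable_mult[OF v] by simp
  also have "\<dots> = (LINT x|M. a' x * w x + v x * w x)"
    using square_integrable_mult[OF sq(1) v(2)] square_integrable_mult[OF v] by simp
  also have "\<dots> = (LINT x|M. a x * w x)"
    by (rule Bochner_Integration.integral_cong) (auto simp: a'_def algebra_simps)
  finally show ?thesis .
qed

text \<open>\<open>k\<close> is the Yosida approximation \<open>m (w - v) = L v\<close> of \<open>h = L w\<close>.\<close>

lemma yosida_bounds:
  fixes h v m
  defines "k \<equiv> \<lambda>x. m * (T h x - v x)"
  assumes h: "square_integrable M h" and v: "is_resolvent m (T h) v" and m: "m > 0"
  shows "square_integrable M k"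
    and "(LINT x|M. (h x - k x)\<^sup>2) \<le> (LINT x|M. (h x)\<^sup>2)"
    and "energy (\<lambda>x. h x - k x) \<le> (LINT x|M. (h x)\<^sup>2) / m"
proof -
  have v_sq: "square_integrable M v" and v_eq: "AE x in M. v x = T k x"
    using v by (auto simp: is_resolvent_def k_def)
  show k_sq: "square_integrable M k"
    unfolding k_def
    by (intro square_integrable_cmult square_integrable_diff T_square_integrable h v_sq)
  note [measurable] = square_integrable_measurable[OF h] square_integrable_measurable[OF k_sq]
  note hk = square_integrable_diff[OF h k_sq]
  have "AE x in M. T (\<lambda>y. h y - k y) x = T h x - T k x"
    by (intro T_diff weighted_integrable_square_integrable h k_sq)
  \<comment> \<open>\<open>T (h - k)\<close> is \<open>T h - v\<close>, and \<open>k\<close> is by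
    definition \<open>m\<close> times this difference.\<close>
  with v_eq have Thk: "AE x in M. T (\<lambda>y. h y - k y) x = k x / m"
    by eventually_elim (use m in \<open>simp add: k_def\<close>)
  have "energy (\<lambda>x. h x - k x) = (LINT x|M. (h x * k x - (k x)\<^sup>2) / m)"
    unfolding energy_def
    by (rule integral_cong_AE)
       (use Thk in \<open>auto elim!: eventually_mono simp: left_diff_distrib diff_divide_distrib power2_eq_square\<close>)
  also have "\<dots> = ((LINT x|M. h x * k x) - (LINT x|M. (k x)\<^sup>2)) / m"
    using square_integrable_mult[OF h k_sq] square_integrableD[OF k_sq] by simp
  finally have E: "energy (\<lambda>x. h x - k x) = ((LINT x|M. h x * k x) - (LINT x|M. (k x)\<^sup>2)) / m" .
  \<comment> \<open>Nonnegative energy of \<open>h - k\<close> gives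
    \<open>\<integral> k\<^sup>2 \<le> \<integral> h k\<close>; both bounds then follow by expanding
    the square of \<open>h - k\<close>.\<close>
  with energy_nonneg[OF hk] m have 1: "(LINT x|M. (k x)\<^sup>2) \<le> (LINT x|M. h x * k x)"
    by (simp add: zero_le_divide_iff)
  have D: "(LINT x|M. (h x - k x)\<^sup>2) = (LINT x|M. (h x)\<^sup>2) - 2 * (LINT x|M. h x * k x) + (LINT x|M. (k x)\<^sup>2)"
  proof -
    have "(LINT x|M. (h x - k x)\<^sup>2) = (LINT x|M. (h x)\<^sup>2 - 2 * (h x * k x) + (k x)\<^sup>2)"
      by (rule Bochner_Integration.integral_cong) (auto simp: power2_eq_square algebra_simps)
    also have "\<dots> = (LINT x|M. (h x)\<^sup>2) - 2 * (LINT x|M. h x * k x) + (LINT x|M. (k x)\<^sup>2)"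
      using square_integrable_mult[OF h k_sq] square_integrableD[OF k_sq] square_integrableD[OF h]
      by simp
    finally show ?thesis .
  qed
  have k0: "0 \<le> (LINT x|M. (k x)\<^sup>2)" by simp
  have D0: "0 \<le> (LINT x|M. (h x - k x)\<^sup>2)" by simp
  show "(LINT x|M. (h x - k x)\<^sup>2) \<le> (LINT x|M. (h x)\<^sup>2)"
    using 1 k0 unfolding D by linarith
  have "(LINT x|M. h x * k x) - (LINT x|M. (k x)\<^sup>2) \<le> (LINT x|M. (h x)\<^sup>2)"
    using 1 k0 D0 unfolding D by linarith
  then show "energy (\<lambda>x. h x - k x) \<le> (LINT x|M. (h x)\<^sup>2) / m"
    unfolding E using m by (simp add: divide_right_mono)
qed

text \<open>The L^2 closure of the functions of finite energy. \<open>K\<close> may depend on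
  \<open>\<psi>\<close>, hence on \<open>\<epsilon>\<close>, so \<open>\<tau>\<close> itself may
  have infinite energy.\<close>

definition energy_approximable :: "('a \<Rightarrow> real) \<Rightarrow> bool" where
  "energy_approximable \<tau> \<longleftrightarrow> square_integrable M \<tau> \<and>
     (\<forall>\<epsilon>>0. \<exists>\<psi> K. square_integrable M \<psi> \<and> (LINT x|M. (\<tau> x - \<psi> x)\<^sup>2) \<le> \<epsilon> \<and>
        (\<forall>k. square_integrable M k \<longrightarrow> (LINT x|M. k x * \<psi> x)\<^sup>2 \<le> K * energy k))"

text \<open>The error \<open>D\<close> of the Yosida approximation is bounded in L^2 uniformly in
  \<open>m\<close>, and its energy is at most a constant over \<open>m\<close>. The L^2 bound
  handles \<open>\<tau> - \<psi>\<close>, the energy handles \<open>\<psi>\<close>. The threshold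
  \<open>m0\<close> does not depend on the choice of the resolvent \<open>v\<close>.\<close>

lemma yosida_limit:
  assumes h: "square_integrable M h" and \<tau>: "energy_approximable \<tau>" and \<epsilon>: "\<epsilon> > 0"
  shows "\<exists>m0>0. \<forall>m v. m \<ge> m0 \<and> is_resolvent m (T h) v \<longrightarrow>
    \<bar>(LINT x|M. h x * \<tau> x) - (LINT x|M. m * (T h x - v x) * \<tau> x)\<bar> \<le> \<epsilon>"
proof -
  define H where "H = (LINT x|M. (h x)\<^sup>2)"
  have H0: "H \<ge> 0" by (simp add: H_def)
  define \<epsilon>2 where "\<epsilon>2 = (\<epsilon> / 2)\<^sup>2"
  have \<epsilon>2: "\<epsilon>2 > 0" using \<epsilon> by (simp add: \<epsilon>2_def)
  have \<tau>_sq: "square_integrable M \<tau>" using \<tau> by (simp add: energy_approximable_def)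
  have "\<epsilon>2 / (H + 1) > 0" using \<epsilon>2 H0 by simp
  with \<tau> obtain \<psi> K where \<psi>: "square_integrable M \<psi>" "(LINT x|M. (\<tau> x - \<psi> x)\<^sup>2) \<le> \<epsilon>2 / (H + 1)"
    and K: "\<And>k. square_integrable M k \<Longrightarrow> (LINT x|M. k x * \<psi> x)\<^sup>2 \<le> K * energy k"
    unfolding energy_approximable_def by blast
  \<comment> \<open>Chosen after \<open>\<psi>\<close> and \<open>K\<close> are fixed, so that
    \<open>\<bar>K\<bar> * (H / m) \<le> \<epsilon>2\<close> from \<open>m0\<close> on; the summand
    1 keeps it positive when \<open>H = 0\<close>.\<close>
  define m0 where "m0 = \<bar>K\<bar> * H / \<epsilon>2 + 1"
  have m0: "m0 > 0" using H0 \<epsilon>2 by (simp add: m0_def add_nonneg_pos)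
  have "\<bar>(LINT x|M. h x * \<tau> x) - (LINT x|M. m * (T h x - v x) * \<tau> x)\<bar> \<le> \<epsilon>"
    if m: "m \<ge> m0" and v: "is_resolvent m (T h) v" for m v
  proof -
    have m_pos: "m > 0" using m m0 by simp
    define k where "k x = m * (T h x - v x)" for x
    note yo = yosida_bounds[OF h v m_pos, folded k_def[abs_def] H_def]
    define D where "D x = h x - k x" for x
    have D_sq: "square_integrable M D"
      using square_integrable_diff[OF h yo(1)] by (simp add: D_def[abs_def] k_def[abs_def])
    have D_le: "(LINT x|M. (D x)\<^sup>2) \<le> H" and D_en: "energy D \<le> H / m"
      using yo(2,3) by (simp_all add: D_def[abs_def] k_def[abs_def])
    have "(LINT x|M. D x * (\<tau> x - \<psi> x))\<^sup>2 \<le> (LINT x|M. (D x)\<^sup>2) * (LINT x|M. (\<tau> x - \<psi> x)\<^sup>2)"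
      by (intro Cauchy_Schwarz_integral D_sq square_integrable_diff \<tau>_sq \<psi>)
    also have "\<dots> \<le> H * (\<epsilon>2 / (H + 1))"
      by (intro mult_mono D_le \<psi>) (use H0 in auto)
    also have "\<dots> \<le> \<epsilon>2" using H0 \<epsilon>2 by (simp add: field_simps)
    finally have 1: "\<bar>LINT x|M. D x * (\<tau> x - \<psi> x)\<bar> \<le> \<epsilon> / 2"
      unfolding \<epsilon>2_def using \<epsilon> by (simp add: abs_le_square_iff[symmetric])
    have "(LINT x|M. D x * \<psi> x)\<^sup>2 \<le> K * energy D" by (rule K[OF D_sq])
    also have "\<dots> \<le> \<bar>K\<bar> * energy D" by (rule mult_right_mono) (auto intro: energy_nonneg D_sq)
    also have "\<dots> \<le> \<bar>K\<bar> * (H / m)" by (rule mult_left_mono[OF D_en]) simp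
    also have "\<dots> \<le> \<epsilon>2"
    proof -
      have "\<bar>K\<bar> * H / \<epsilon>2 \<le> m" using m by (simp add: m0_def)
      then show ?thesis using \<epsilon>2 m_pos by (simp add: field_simps)
    qed
    finally have 2: "\<bar>LINT x|M. D x * \<psi> x\<bar> \<le> \<epsilon> / 2"
      unfolding \<epsilon>2_def using \<epsilon> by (simp add: abs_le_square_iff[symmetric])
    have k_sq: "square_integrable M k" using yo(1) by (simp add: k_def[abs_def])
    have "(LINT x|M. h x * \<tau> x) - (LINT x|M. k x * \<tau> x) = (LINT x|M. h x * \<tau> x - k x * \<tau> x)"
      using square_integrable_mult[OF h \<tau>_sq] square_integrable_mult[OF k_sq \<tau>_sq] by simp
    also have "\<dots> = (LINT x|M. D x * (\<tau> x - \<psi> x) + D x * \<psi> x)"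
      by (rule Bochner_Integration.integral_cong) (auto simp: D_def algebra_simps)
    also have "\<dots> = (LINT x|M. D x * (\<tau> x - \<psi> x)) + (LINT x|M. D x * \<psi> x)"
      using square_integrable_mult[OF D_sq square_integrable_diff[OF \<tau>_sq \<psi>(1)]]
        square_integrable_mult[OF D_sq \<psi>(1)] by simp
    finally show ?thesis using 1 2 unfolding k_def by linarith
  qed
  with m0 show ?thesis by blast
qed

lemma energy_approximable_positive_part:
  assumes h: "h \<in> borel_measurable M" "\<And>x. x \<in> space M \<Longrightarrow> \<bar>h x\<bar> \<le> K1"
    and \<xi>: "\<xi> \<in> borel_measurable M" "\<And>x. x \<in> space M \<Longrightarrow> \<bar>\<xi> x\<bar> \<le> K2"
  shows "energy_approximable (\<lambda>x. if 0 < T h x then T \<xi> x else 0)"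
  unfolding energy_approximable_def
proof (intro conjI allI impI)
  note [measurable] = h(1) \<xi>(1)
  show "square_integrable M (\<lambda>x. if 0 < T h x then T \<xi> x else 0)"
  proof (rule square_integrable_bound)
    show "square_integrable M (T \<xi>)"
      by (intro T_square_integrable square_integrable_const_bound) (rule \<xi>)+
  qed auto
next
  fix \<epsilon> :: real assume "\<epsilon> > 0"
  from energy_approximation[OF h(1) \<xi>(1) h(2) \<xi>(2) this]
  show "\<exists>\<psi> K. square_integrable M \<psi> \<and>
      (LINT x|M. ((if 0 < T h x then T \<xi> x else 0) - \<psi> x)\<^sup>2) \<le> \<epsilon> \<and>
      (\<forall>k. square_integrable M k \<longrightarrow> (LINT x|M. k x * \<psi> x)\<^sup>2 \<le> K * energy k)"
    by (simp add: energy_def)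
qed

text \<open>Testing the Yosida approximation of \<open>h\<close> with \<open>T \<xi>\<close> on \<open>{T h > 0}\<close> only uses that resolvents
  preserve positivity.\<close>

lemma kato_bounded:
  assumes h: "h \<in> borel_measurable M" "\<And>x. x \<in> space M \<Longrightarrow> \<bar>h x\<bar> \<le> K1"
    and \<xi>: "\<xi> \<in> borel_measurable M" "\<And>x. x \<in> space M \<Longrightarrow> 0 \<le> \<xi> x" "\<And>x. x \<in> space M \<Longrightarrow> \<xi> x \<le> K2"
  shows "(LINT x|M. max (T h x) 0 * \<xi> x) \<le> (LINT x|M. h x * (if 0 < T h x then T \<xi> x else 0))"
proof (rule field_le_epsilon)
  fix \<epsilon> :: real assume "\<epsilon> > 0"
  then have \<epsilon>: "\<epsilon> / 2 > 0" by simp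
  have \<xi>': "\<bar>\<xi> x\<bar> \<le> K2" if "x \<in> space M" for x using \<xi>(2,3)[OF that] by simp
  note [measurable] = h(1) \<xi>(1)
  have h_sq: "square_integrable M h" by (rule square_integrable_const_bound[OF h])
  have \<xi>_sq: "square_integrable M \<xi>" by (rule square_integrable_const_bound[OF \<xi>(1) \<xi>'])
  define w where "w = T h"
  define \<eta> where "\<eta> = T \<xi>"
  define wp where "wp x = max (w x) 0" for x
  define \<tau> where "\<tau> x = (if 0 < w x then \<eta> x else 0)" for x
  have w_sq: "square_integrable M w" and \<eta>_sq: "square_integrable M \<eta>"
    unfolding w_def \<eta>_def by (intro T_square_integrable h_sq \<xi>_sq)+
  note [measurable] = square_integrable_measurable[OF w_sq] square_integrable_measurable[OF \<eta>_sq]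
  have wp_sq: "square_integrable M wp"
    unfolding wp_def by (rule square_integrable_bound[OF w_sq]) auto
  have \<eta>0: "0 \<le> \<eta> x" for x unfolding \<eta>_def by (rule T_nonneg) (rule \<xi>(2))
  have \<tau>_ap: "energy_approximable \<tau>"
    unfolding \<tau>_def[abs_def] w_def \<eta>_def by (rule energy_approximable_positive_part[OF h \<xi>(1) \<xi>'])
  have \<tau>_sq: "square_integrable M \<tau>" using \<tau>_ap by (simp add: energy_approximable_def)
  \<comment> \<open>The positive part of \<open>w\<close> is the cut-off with \<open>h\<close> in
    the place of \<open>\<xi>\<close>, so it is approximable too.\<close>
  have "wp = (\<lambda>x. if 0 < T h x then T h x else 0)"
    by (auto simp: wp_def w_def fun_eq_iff)
  then have wp_ap: "energy_approximable wp"
    using energy_approximable_positive_part[OF h h] by simp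
  obtain m1 where m1: "m1 > 0" "\<And>m v. m \<ge> m1 \<Longrightarrow> is_resolvent m w v \<Longrightarrow>
      \<bar>(LINT x|M. h x * \<tau> x) - (LINT x|M. m * (w x - v x) * \<tau> x)\<bar> \<le> \<epsilon> / 2"
    using yosida_limit[OF h_sq \<tau>_ap \<epsilon>] unfolding w_def by blast
  obtain m2 where m2: "m2 > 0" "\<And>m v. m \<ge> m2 \<Longrightarrow> is_resolvent m \<eta> v \<Longrightarrow>
      \<bar>(LINT x|M. \<xi> x * wp x) - (LINT x|M. m * (\<eta> x - v x) * wp x)\<bar> \<le> \<epsilon> / 2"
    using yosida_limit[OF \<xi>_sq wp_ap \<epsilon>] unfolding \<eta>_def by blast
  define m where "m = max m1 m2"
  have m: "m > 0" "m \<ge> m1" "m \<ge> m2" using m1(1) by (auto simp: m_def)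
  obtain v where v: "is_resolvent m w v" using resolvent_exists[OF w_sq m(1)] by blast
  obtain vp where vp: "is_resolvent m wp vp" using resolvent_exists[OF wp_sq m(1)] by blast
  obtain e where e: "is_resolvent m \<eta> e" using resolvent_exists[OF \<eta>_sq m(1)] by blast
  have sq: "square_integrable M v" "square_integrable M vp" "square_integrable M e"
    using v vp e by (auto simp: is_resolvent_def)
  have vp0: "AE x in M. 0 \<le> vp x"
    by (rule resolvent_nonneg[OF wp_sq _ vp m(1)]) (simp add: wp_def)
  have "AE x in M. 0 \<le> vp x - v x"
    by (rule resolvent_nonneg[OF square_integrable_diff[OF wp_sq w_sq] _ resolvent_diff[OF wp_sq vp w_sq v] m(1)])
       (simp add: wp_def)
  \<comment> \<open>Where \<open>w > 0\<close>, \<open>wp = w\<close> and \<open>vp \<ge> v\<close>.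
    Elsewhere \<open>wp = 0 \<le> vp\<close>, so the left side is at most 0, while
    \<open>\<tau>\<close> vanishes.\<close>
  with vp0 have le: "AE x in M. m * (wp x - vp x) * \<eta> x \<le> m * (w x - v x) * \<tau> x"
  proof eventually_elim
    case (elim x)
    show ?case
    proof (cases "0 < w x")
      case True
      then show ?thesis
        using elim m(1) \<eta>0[of x] by (auto simp: wp_def \<tau>_def intro!: mult_right_mono mult_left_mono)
    next
      case False
      then have "m * (wp x - vp x) * \<eta> x \<le> 0"
        using elim m(1) \<eta>0[of x]
        by (intro mult_nonpos_nonneg mult_nonneg_nonpos) (auto simp: wp_def)
      with False show ?thesis by (simp add: \<tau>_def)
    qed
  qed
  have i: "integrable M (\<lambda>x. wp x * \<eta> x)" "integrable M (\<lambda>x. vp x * \<eta> x)"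
    "integrable M (\<lambda>x. wp x * e x)"
    by (intro square_integrable_mult wp_sq \<eta>_sq sq)+
  \<comment> \<open>\<open>wp\<close> need not be of the form \<open>T k\<close>, so its Yosida
    approximation has no known limit. Symmetry of the resolvent transfers the approximation to
    \<open>\<eta> = T \<xi>\<close>, where the limit is \<open>\<xi>\<close>.\<close>
  have "(LINT x|M. m * (\<eta> x - e x) * wp x) = (LINT x|M. m * (wp x * \<eta> x - wp x * e x))"
    by (rule Bochner_Integration.integral_cong) (auto simp: algebra_simps)
  also have "\<dots> = m * ((LINT x|M. wp x * \<eta> x) - (LINT x|M. wp x * e x))"
    using i by simp
  also have "(LINT x|M. wp x * e x) = (LINT x|M. vp x * \<eta> x)"
    by (rule resolvent_swap[OF wp_sq vp \<eta>_sq e, symmetric])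
  also have "m * ((LINT x|M. wp x * \<eta> x) - (LINT x|M. vp x * \<eta> x))
      = (LINT x|M. m * (wp x * \<eta> x - vp x * \<eta> x))"
    using i by simp
  also have "\<dots> = (LINT x|M. m * (wp x - vp x) * \<eta> x)"
    by (rule Bochner_Integration.integral_cong) (auto simp: algebra_simps)
  also have "\<dots> \<le> (LINT x|M. m * (w x - v x) * \<tau> x)"
    by (rule integral_mono_AE[OF _ _ le];
        intro square_integrable_mult square_integrable_cmult square_integrable_diff wp_sq sq \<eta>_sq w_sq \<tau>_sq)
  finally have "(LINT x|M. m * (\<eta> x - e x) * wp x) \<le> (LINT x|M. m * (w x - v x) * \<tau> x)" .
  with m1(2)[OF m(2) v] m2(2)[OF m(3) e]
  have "(LINT x|M. \<xi> x * wp x) \<le> (LINT x|M. h x * \<tau> x) + \<epsilon>" by linarith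
  moreover have "(LINT x|M. max (T h x) 0 * \<xi> x) = (LINT x|M. \<xi> x * wp x)"
    by (simp add: wp_def w_def mult.commute)
  ultimately show "(LINT x|M. max (T h x) 0 * \<xi> x)
      \<le> (LINT x|M. h x * (if 0 < T h x then T \<xi> x else 0)) + \<epsilon>"
    unfolding \<tau>_def w_def \<eta>_def by simp
qed

text \<open>Kato's inequality with \<open>\<xi>\<close> the indicator of the set where
  \<open>T h\<close> exceeds \<open>L = k * C\<close>. The right side is at most \<open>k\<close>
  times the integral of \<open>T \<xi>\<close>, and by symmetry and \<open>T 1 \<le> C\<close> this
  is at most \<open>L\<close> times the integral of \<open>\<xi>\<close>. So the excess of
  \<open>T h\<close> over \<open>L\<close> has integral 0.\<close>

lemma maximum_principle_bound:
  assumes h: "h \<in> borel_measurable M" "\<And>x. x \<in> space M \<Longrightarrow> \<bar>h x\<bar> \<le> K1"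
    and le: "AE x in M. 0 < T h x \<longrightarrow> h x \<le> k" and k: "0 \<le> k"
  shows "AE x in M. T h x \<le> k * C"
proof -
  note [measurable] = h(1)
  define L where "L = k * C"
  have L0: "L \<ge> 0" using k C_nonneg by (simp add: L_def)
  define \<xi> where "\<xi> x = (if L < T h x then 1 else 0 :: real)" for x
  have \<xi>_meas [measurable]: "\<xi> \<in> borel_measurable M" unfolding \<xi>_def by measurable
  have \<xi>b: "0 \<le> \<xi> x" "\<xi> x \<le> 1" "\<bar>\<xi> x\<bar> \<le> 1" for x by (auto simp: \<xi>_def)
  have \<xi>_sq: "square_integrable M \<xi>" by (rule square_integrable_const_bound[OF \<xi>_meas \<xi>b(3)])
  have one_sq: "square_integrable M (\<lambda>_. 1)" by (rule square_integrable_const_bound[where K=1]) auto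
  have h_sq: "square_integrable M h" by (rule square_integrable_const_bound[OF h])
  have Th_sq: "square_integrable M (T h)" by (rule T_square_integrable[OF h_sq])
  have T\<xi>_sq: "square_integrable M (T \<xi>)" by (rule T_square_integrable[OF \<xi>_sq])
  have T\<xi>0: "0 \<le> T \<xi> x" for x by (rule T_nonneg) (rule \<xi>b)
  have if_sq: "square_integrable M (\<lambda>x. if 0 < T h x then T \<xi> x else 0)"
    by (rule square_integrable_bound[OF T\<xi>_sq]) auto
  have max_sq: "square_integrable M (\<lambda>x. max (T h x) 0)"
    by (rule square_integrable_bound[OF Th_sq]) auto
  have "(LINT x|M. max (T h x) 0 * \<xi> x) \<le> (LINT x|M. h x * (if 0 < T h x then T \<xi> x else 0))"
    by (rule kato_bounded[OF h \<xi>_meas \<xi>b(1,2)])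
  also have "\<dots> \<le> (LINT x|M. k * (1 * T \<xi> x))"
  proof (rule integral_mono_AE)
    show "AE x in M. h x * (if 0 < T h x then T \<xi> x else 0) \<le> k * (1 * T \<xi> x)"
      using le
    proof eventually_elim
      case (elim x)
      show ?case
      proof (cases "0 < T h x")
        case True
        with elim show ?thesis by (auto intro: mult_right_mono T\<xi>0)
      qed (use k T\<xi>0[of x] in simp)
    qed
    show "integrable M (\<lambda>x. k * (1 * T \<xi> x))"
      by (intro integrable_mult_right square_integrable_mult one_sq T\<xi>_sq)
  qed (intro square_integrable_mult h_sq if_sq)
  also have "\<dots> = k * (LINT x|M. \<xi> x * T (\<lambda>_. 1) x)"
    by (subst integral_mult_right_zero) (simp only: T_swap_L2[OF one_sq \<xi>_sq])
  also have "\<dots> \<le> k * (LINT x|M. C * \<xi> x)"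
  proof (intro mult_left_mono integral_mono k)
    show "integrable M (\<lambda>x. \<xi> x * T (\<lambda>_. 1) x)"
      by (intro square_integrable_mult \<xi>_sq T_square_integrable one_sq)
    show "integrable M (\<lambda>x. C * \<xi> x)" by (intro integrable_mult_right square_integrable_integrable \<xi>_sq)
    show "\<xi> x * T (\<lambda>_. 1) x \<le> C * \<xi> x" if "x \<in> space M" for x
    proof -
      have "\<bar>T (\<lambda>_. 1) x\<bar> \<le> 1 * (C * 1)" by (rule abs_T_bounded[OF schur_weight_one]) (use that in auto)
      then show ?thesis using mult_left_mono[OF _ \<xi>b(1)[of x], of "T (\<lambda>_. 1) x" C] by (simp add: mult.commute)
    qed
  qed
  also have "\<dots> = (LINT x|M. L * \<xi> x)" by (simp add: L_def mult.assoc)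
  finally have "(LINT x|M. max (T h x) 0 * \<xi> x) - (LINT x|M. L * \<xi> x) \<le> 0" by simp
  moreover have int: "integrable M (\<lambda>x. max (T h x) 0 * \<xi> x)" "integrable M (\<lambda>x. L * \<xi> x)"
    by (intro integrable_mult_right square_integrable_integrable square_integrable_mult \<xi>_sq max_sq)+
  moreover have eq: "(\<lambda>x. max (T h x) 0 * \<xi> x - L * \<xi> x) = (\<lambda>x. max (T h x - L) 0)"
    using L0 by (auto simp: fun_eq_iff \<xi>_def max_def)
  ultimately have "(LINT x|M. max (T h x - L) 0) \<le> 0"
    using Bochner_Integration.integral_diff[OF int] by simp
  moreover have "0 \<le> (LINT x|M. max (T h x - L) 0)" by simp
  ultimately have 0: "(LINT x|M. max (T h x - L) 0) = 0" by simp
  have "integrable M (\<lambda>x. max (T h x) 0 * \<xi> x - L * \<xi> x)"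
    using int by (rule Bochner_Integration.integrable_diff)
  note this[unfolded eq]
  then have "AE x in M. max (T h x - L) 0 = 0"
    using 0 by (subst (asm) integral_nonneg_eq_0_iff_AE) auto
  then show ?thesis unfolding L_def by eventually_elim simp
qed

end

section \<open>Weighted data\<close>


lemma squeeze_zero:
  fixes a b :: "nat \<Rightarrow> real"
  assumes "\<And>n. 0 \<le> a n" "\<And>n. a n \<le> b n" "b \<longlonglongrightarrow> 0"
  shows "a \<longlonglongrightarrow> 0"
  by (rule tendsto_sandwich[OF _ _ tendsto_const assms(3)]) (use assms(1,2) in auto)

context maximum_principle_kernel
begin

lemma weighted_tendsto_integral:
  assumes h: "\<And>n. weighted_integrable (h n)" "weighted_integrable k"
    and lim: "(\<lambda>n. LINT x|M. \<bar>h n x - k x\<bar> * d x) \<longlonglongrightarrow> 0"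
    and a: "a \<in> borel_measurable M" "\<And>x. x \<in> space M \<Longrightarrow> \<bar>a x\<bar> \<le> K * d x"
  shows "(\<lambda>n. LINT x|M. h n x * a x) \<longlonglongrightarrow> (LINT x|M. k x * a x)"
proof (rule LIM_zero_cancel, rule tendsto_rabs_zero_cancel, rule squeeze_zero)
  show "(\<lambda>n. K * (LINT x|M. \<bar>h n x - k x\<bar> * d x)) \<longlonglongrightarrow> 0"
    using tendsto_mult[OF tendsto_const lim] by simp
  show "0 \<le> \<bar>(LINT x|M. h n x * a x) - (LINT x|M. k x * a x)\<bar>" for n by simp
  show "\<bar>(LINT x|M. h n x * a x) - (LINT x|M. k x * a x)\<bar>
      \<le> K * (LINT x|M. \<bar>h n x - k x\<bar> * d x)" for n
  proof -
    note hk = weighted_integrable_diff[OF h(1)[of n] h(2)]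
    have "(LINT x|M. h n x * a x) - (LINT x|M. k x * a x) = (LINT x|M. (h n x - k x) * a x)"
      using weighted_integrable_mult[OF h(1)[of n] a] weighted_integrable_mult[OF h(2) a]
      by (simp add: left_diff_distrib)
    also have "\<bar>\<dots>\<bar> \<le> (LINT x|M. \<bar>(h n x - k x) * a x\<bar>)" by (rule integral_abs_bound)
    also have "\<dots> \<le> (LINT x|M. K * (\<bar>h n x - k x\<bar> * d x))"
    proof (rule integral_mono)
      show "integrable M (\<lambda>x. \<bar>(h n x - k x) * a x\<bar>)"
        by (intro integrable_abs weighted_integrable_mult[OF hk a])
      show "integrable M (\<lambda>x. K * (\<bar>h n x - k x\<bar> * d x))"
        by (intro integrable_mult_right weighted_integrableD[OF hk])
      show "\<bar>(h n x - k x) * a x\<bar> \<le> K * (\<bar>h n x - k x\<bar> * d x)" if "x \<in> space M" for x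
        using mult_left_mono[OF a(2)[OF that], of "\<bar>h n x - k x\<bar>"] by (simp add: abs_mult mult_ac)
    qed
    finally show "\<bar>(LINT x|M. h n x * a x) - (LINT x|M. k x * a x)\<bar>
        \<le> K * (LINT x|M. \<bar>h n x - k x\<bar> * d x)" by simp
  qed
qed

section \<open>Truncation, and the extension of Kato's inequality to weighted data\<close>

definition truncate :: "nat \<Rightarrow> ('a \<Rightarrow> real) \<Rightarrow> 'a \<Rightarrow> real" where
  "truncate n f x = max (- real n) (min (real n) (f x))"

lemma truncate_measurable [measurable (raw)]:
  "f \<in> borel_measurable M \<Longrightarrow> truncate n f \<in> borel_measurable M"
  unfolding truncate_def
  by (intro borel_measurable_max borel_measurable_min borel_measurable_const)

lemma abs_truncate_le: "\<bar>truncate n f x\<bar> \<le> real n" "\<bar>truncate n f x\<bar> \<le> \<bar>f x\<bar>"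
  by (auto simp: truncate_def)

lemma weighted_integrable_truncate: "weighted_integrable f \<Longrightarrow> weighted_integrable (truncate n f)"
  by (rule weighted_integrable_bound[of f])
     (auto simp: abs_truncate_le weighted_integrable_def)

lemma truncate_tendsto:
  assumes f: "weighted_integrable f"
  shows "(\<lambda>n. LINT x|M. \<bar>truncate n f x - f x\<bar> * d x) \<longlonglongrightarrow> 0"
proof -
  note [measurable] = weighted_integrable_measurable[OF f]
  have "(\<lambda>n. LINT x|M. \<bar>truncate n f x - f x\<bar> * d x) \<longlonglongrightarrow> (LINT x|M. 0)"
  proof (rule integral_dominated_convergence[where w="\<lambda>x. 2 * (\<bar>f x\<bar> * d x)"])
    show "integrable M (\<lambda>x. 2 * (\<bar>f x\<bar> * d x))"
      by (intro integrable_mult_right weighted_integrableD f)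
    show "AE x in M. (\<lambda>n. \<bar>truncate n f x - f x\<bar> * d x) \<longlonglongrightarrow> 0"
    proof (rule AE_I2)
      fix x
      obtain N where N: "\<bar>f x\<bar> \<le> real N" using real_arch_simple by blast
      have "\<forall>\<^sub>F n in sequentially. \<bar>truncate n f x - f x\<bar> * d x = 0"
        using eventually_ge_at_top[of N]
      proof eventually_elim
        case (elim n)
        then have "real N \<le> real n" by simp
        with N have "truncate n f x = f x" by (auto simp: truncate_def)
        then show ?case by simp
      qed
      then show "(\<lambda>n. \<bar>truncate n f x - f x\<bar> * d x) \<longlonglongrightarrow> 0" by (rule tendsto_eventually)
    qed
    show "AE x in M. norm (\<bar>truncate n f x - f x\<bar> * d x) \<le> 2 * (\<bar>f x\<bar> * d x)" for n
    proof (rule AE_I2)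
      fix x assume x: "x \<in> space M"
      have "\<bar>truncate n f x - f x\<bar> \<le> 2 * \<bar>f x\<bar>" using abs_truncate_le(2)[of n f x] by linarith
      from mult_right_mono[OF this, of "d x"] weight_pos[OF x]
      show "norm (\<bar>truncate n f x - f x\<bar> * d x) \<le> 2 * (\<bar>f x\<bar> * d x)" by (simp add: abs_mult)
    qed
  qed measurable
  then show ?thesis by simp
qed

lemma weight_multiple_bounded:
  assumes "\<And>x. x \<in> space M \<Longrightarrow> \<bar>a x\<bar> \<le> K * d x"
  obtains K' where "\<And>x. x \<in> space M \<Longrightarrow> \<bar>a x\<bar> \<le> K'"
proof -
  obtain D where D: "\<And>x. x \<in> space M \<Longrightarrow> d x \<le> D" using weight_bounded by blast
  have "\<bar>a x\<bar> \<le> \<bar>K\<bar> * \<bar>D\<bar>" if x: "x \<in> space M" for x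
  proof -
    have "\<bar>a x\<bar> \<le> K * d x" by (rule assms[OF x])
    also have "\<dots> \<le> \<bar>K\<bar> * \<bar>D\<bar>"
      using D[OF x] weight_pos[OF x] by (intro mult_mono) auto
    finally show ?thesis .
  qed
  then show ?thesis by (rule that)
qed

text \<open>On \<open>{T h = 0}\<close> the truncations of \<open>h\<close> may produce either sign, which is why the positive part
  of \<open>h\<close> enters there.\<close>

lemma kato_weighted:
  assumes h: "weighted_integrable h"
    and \<xi>: "\<xi> \<in> borel_measurable M" "\<And>x. x \<in> space M \<Longrightarrow> 0 \<le> \<xi> x" "\<And>x. x \<in> space M \<Longrightarrow> \<xi> x \<le> K * d x"
  shows "(LINT x|M. max (T h x) 0 * \<xi> x)
    \<le> (LINT x|M. (if T h x = 0 then max (h x) 0 else if 0 < T h x then h x else 0) * T \<xi> x)"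
proof -
  define h' where "h' n = truncate n h" for n
  have h'_w: "weighted_integrable (h' n)" for n
    unfolding h'_def by (rule weighted_integrable_truncate[OF h])
  note Th_w = weighted_integrable_T[OF h] and Th'_w = weighted_integrable_T[OF h'_w]
  note [measurable] = weighted_integrable_measurable[OF h] weighted_integrable_measurable[OF h'_w]
    weighted_integrable_measurable[OF Th_w] weighted_integrable_measurable[OF Th'_w] \<xi>(1)
  have \<xi>': "\<bar>\<xi> x\<bar> \<le> K * d x" if "x \<in> space M" for x using \<xi>(2,3)[OF that] by simp
  obtain K' where K': "\<And>x. x \<in> space M \<Longrightarrow> \<bar>\<xi> x\<bar> \<le> K'"
    using weight_multiple_bounded[OF \<xi>'] by blast
  define \<eta> where "\<eta> = T \<xi>"
  have [measurable]: "\<eta> \<in> borel_measurable M" unfolding \<eta>_def by measurable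
  have \<eta>0: "0 \<le> \<eta> x" for x unfolding \<eta>_def by (rule T_nonneg) (rule \<xi>(2))
  have \<eta>_le: "\<bar>\<eta> x\<bar> \<le> (K * C) * d x" if "x \<in> space M" for x
    using abs_T_bounded[OF schur_weight_weight \<xi>(1) \<xi>' that] by (simp add: \<eta>_def mult.assoc)
  have lim_h: "(\<lambda>n. LINT x|M. \<bar>h' n x - h x\<bar> * d x) \<longlonglongrightarrow> 0"
    unfolding h'_def by (rule truncate_tendsto[OF h])
  have lim_T: "(\<lambda>n. LINT x|M. \<bar>T (h' n) x - T h x\<bar> * d x) \<longlonglongrightarrow> 0"
  proof (rule squeeze_zero)
    show "(\<lambda>n. C * (LINT x|M. \<bar>h' n x - h x\<bar> * d x)) \<longlonglongrightarrow> 0"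
      using tendsto_mult[OF tendsto_const lim_h] by simp
    show "0 \<le> (LINT x|M. \<bar>T (h' n) x - T h x\<bar> * d x)" for n
      by (intro integral_nonneg_AE AE_I2)
         (simp add: weight_pos less_imp_le)
    show "(LINT x|M. \<bar>T (h' n) x - T h x\<bar> * d x) \<le> C * (LINT x|M. \<bar>h' n x - h x\<bar> * d x)" for n
    proof -
      note hh = weighted_integrable_diff[OF h'_w[of n] h]
      have "(LINT x|M. \<bar>T (h' n) x - T h x\<bar> * d x) = (LINT x|M. \<bar>T (\<lambda>y. h' n y - h y) x\<bar> * d x)"
      proof (rule integral_cong_AE)
        show "AE x in M. \<bar>T (h' n) x - T h x\<bar> * d x = \<bar>T (\<lambda>y. h' n y - h y) x\<bar> * d x"
          using T_diff[OF h'_w[of n] h] by eventually_elim simp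
      qed measurable
      also have "\<dots> \<le> C * (LINT x|M. \<bar>h' n x - h x\<bar> * d x)"
        using integral_abs_T_le(2)[OF schur_weight_weight _ weighted_integrableD[OF hh]] by simp
      finally show "(LINT x|M. \<bar>T (h' n) x - T h x\<bar> * d x)
          \<le> C * (LINT x|M. \<bar>h' n x - h x\<bar> * d x)" .
    qed
  qed
  have int_d: "integrable M (\<lambda>x. (T (h' n) x - T h x) * d x)" for n
    by (rule weighted_integrable_mult[OF weighted_integrable_diff[OF Th'_w Th_w], where K=1])
       (auto simp: weight_pos less_imp_le)
  have "(\<lambda>n. LINT x|M. norm ((T (h' n) x - T h x) * d x)) \<longlonglongrightarrow> 0"
  proof -
    have "(LINT x|M. norm ((T (h' n) x - T h x) * d x)) = (LINT x|M. \<bar>T (h' n) x - T h x\<bar> * d x)" for n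
      by (rule Bochner_Integration.integral_cong) (auto simp: abs_mult weight_pos less_imp_le)
    with lim_T show ?thesis by simp
  qed
  \<comment> \<open>The signs of \<open>T (h' n)\<close> must converge pointwise, which L^1
    convergence provides only along a subsequence.\<close>
  from tendsto_L1_AE_subseq[OF int_d this] obtain r where r: "strict_mono r"
    "AE x in M. (\<lambda>n. (T (h' (r n)) x - T h x) * d x) \<longlonglongrightarrow> 0" by blast
  have ae: "AE x in M. (\<lambda>n. T (h' (r n)) x) \<longlonglongrightarrow> T h x"
    using r(2) AE_space
  proof eventually_elim
    case (elim x)
    have "(\<lambda>n. (T (h' (r n)) x - T h x) * d x * inverse (d x)) \<longlonglongrightarrow> 0 * inverse (d x)"
      by (intro tendsto_mult tendsto_const elim)
    then have "(\<lambda>n. T (h' (r n)) x - T h x) \<longlonglongrightarrow> 0"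
      using weight_pos[OF elim(2)] by (simp add: mult.assoc)
    then show ?case by (rule LIM_zero_cancel)
  qed
  \<comment> \<open>An upper bound, up to the error \<open>e\<close>, for the right side of Kato's
    inequality for \<open>h' (r n)\<close>. Off \<open>{T h = 0}\<close> the sign of
    \<open>T (h' (r n))\<close> is eventually that of \<open>T h\<close>; on it \<open>y n\<close>
    does not depend on \<open>n\<close>. Hence \<open>y n\<close> converges almost
    everywhere.\<close>
  define y where "y n x = (if T h x = 0 then max (h x) 0 else if 0 < T (h' (r n)) x then h x else 0) * \<eta> x" for n x
  define Y where "Y x = (if T h x = 0 then max (h x) 0 else if 0 < T h x then h x else 0) * \<eta> x" for x
  have [measurable]: "y n \<in> borel_measurable M" for n unfolding y_def by measurable
  have [measurable]: "Y \<in> borel_measurable M" unfolding Y_def by measurable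
  have i_dom: "integrable M (\<lambda>x. \<bar>h x * \<eta> x\<bar>)"
    by (intro integrable_abs weighted_integrable_mult[OF h _ \<eta>_le]) measurable
  have y_dom: "\<bar>y n x\<bar> \<le> \<bar>h x * \<eta> x\<bar>" for n x
    unfolding y_def abs_mult by (rule mult_right_mono) auto
  have y_lim: "(\<lambda>n. LINT x|M. y n x) \<longlonglongrightarrow> (LINT x|M. Y x)"
  proof (rule integral_dominated_convergence[OF _ _ i_dom])
    show "AE x in M. (\<lambda>n. y n x) \<longlonglongrightarrow> Y x"
      using ae
    proof eventually_elim
      case (elim x)
      consider "T h x = 0" | "0 < T h x" | "T h x < 0" by linarith
      then show ?case
      proof cases
        case 1
        then show ?thesis by (simp add: y_def Y_def)
      next
        case 2
        from order_tendstoD(1)[OF elim 2] have "\<forall>\<^sub>F n in sequentially. y n x = Y x"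
          by eventually_elim (use 2 in \<open>simp add: y_def Y_def\<close>)
        then show ?thesis by (rule tendsto_eventually)
      next
        case 3
        from order_tendstoD(2)[OF elim 3] have "\<forall>\<^sub>F n in sequentially. y n x = Y x"
          by eventually_elim (use 3 in \<open>simp add: y_def Y_def\<close>)
        then show ?thesis by (rule tendsto_eventually)
      qed
    qed
    show "AE x in M. norm (y n x) \<le> \<bar>h x * \<eta> x\<bar>" for n using y_dom by simp
  qed measurable
  have i_y: "integrable M (y n)" for n
    by (rule Bochner_Integration.integrable_bound[OF i_dom]) (use y_dom in auto)
  have i_hh: "integrable M (\<lambda>x. \<bar>h' n x - h x\<bar> * \<eta> x)" for n
  proof -
    have "integrable M (\<lambda>x. \<bar>(h' n x - h x) * \<eta> x\<bar>)"
      by (intro integrable_abs weighted_integrable_mult[OF weighted_integrable_diff[OF h'_w h] _ \<eta>_le])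
         measurable
    then show ?thesis by (simp add: abs_mult \<eta>0)
  qed
  define e where "e n = (LINT x|M. \<bar>h' n x - h x\<bar> * \<eta> x)" for n
  have e_lim: "e \<longlonglongrightarrow> 0"
  proof (rule squeeze_zero)
    show "(\<lambda>n. (K * C) * (LINT x|M. \<bar>h' n x - h x\<bar> * d x)) \<longlonglongrightarrow> 0"
      using tendsto_mult[OF tendsto_const lim_h] by simp
    show "0 \<le> e n" for n
      unfolding e_def by (intro integral_nonneg_AE AE_I2) (simp add: \<eta>0)
    show "e n \<le> (K * C) * (LINT x|M. \<bar>h' n x - h x\<bar> * d x)" for n
    proof -
      have "e n \<le> (LINT x|M. (K * C) * (\<bar>h' n x - h x\<bar> * d x))"
        unfolding e_def
      proof (rule integral_mono[OF i_hh])
        show "integrable M (\<lambda>x. K * C * (\<bar>h' n x - h x\<bar> * d x))"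
          by (intro integrable_mult_right weighted_integrableD weighted_integrable_diff h'_w h)
        show "\<bar>h' n x - h x\<bar> * \<eta> x \<le> K * C * (\<bar>h' n x - h x\<bar> * d x)" if "x \<in> space M" for x
          using mult_left_mono[OF \<eta>_le[OF that], of "\<bar>h' n x - h x\<bar>"] \<eta>0[of x] by (simp add: mult_ac)
      qed
      then show "e n \<le> (K * C) * (LINT x|M. \<bar>h' n x - h x\<bar> * d x)" by simp
    qed
  qed
  have main: "(LINT x|M. max (T (h' (r n)) x) 0 * \<xi> x) \<le> (LINT x|M. y n x) + e (r n)" for n
  proof -
    have "(LINT x|M. max (T (h' (r n)) x) 0 * \<xi> x)
        \<le> (LINT x|M. h' (r n) x * (if 0 < T (h' (r n)) x then T \<xi> x else 0))"
      by (rule kato_bounded[OF _ _ \<xi>(1,2), where ?K1.0="real (r n)"])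
         (auto simp: h'_def abs_truncate_le intro: order_trans[OF abs_ge_self K'])
    also have "\<dots> \<le> (LINT x|M. y n x + \<bar>h' (r n) x - h x\<bar> * \<eta> x)"
    proof (rule integral_mono)
      show "integrable M (\<lambda>x. h' (r n) x * (if 0 < T (h' (r n)) x then T \<xi> x else 0))"
      proof (rule weighted_integrable_mult[OF h'_w, where K="K * C"])
        show "\<bar>if 0 < T (h' (r n)) x then T \<xi> x else 0\<bar> \<le> K * C * d x" if "x \<in> space M" for x
          using \<eta>_le[OF that] by (auto simp: \<eta>_def)
      qed measurable
      show "integrable M (\<lambda>x. y n x + \<bar>h' (r n) x - h x\<bar> * \<eta> x)"
        by (intro Bochner_Integration.integrable_add i_y i_hh)
      fix x
      have 1: "h' (r n) x * \<eta> x \<le> h x * \<eta> x + \<bar>h' (r n) x - h x\<bar> * \<eta> x"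
        unfolding distrib_right[symmetric] by (rule mult_right_mono[OF _ \<eta>0]) simp
      have 2: "h x * \<eta> x \<le> max (h x) 0 * \<eta> x" "0 \<le> max (h x) 0 * \<eta> x"
        by (auto intro!: mult_right_mono mult_nonneg_nonneg \<eta>0)
      have 3: "0 \<le> \<bar>h' (r n) x - h x\<bar> * \<eta> x" by (intro mult_nonneg_nonneg \<eta>0) simp
      show "h' (r n) x * (if 0 < T (h' (r n)) x then T \<xi> x else 0) \<le> y n x + \<bar>h' (r n) x - h x\<bar> * \<eta> x"
        using 1 2 3 unfolding y_def \<eta>_def[symmetric] by auto
    qed
    also have "\<dots> = (LINT x|M. y n x) + e (r n)"
      using i_y i_hh by (simp add: e_def)
    finally show ?thesis .
  qed
  have lhs_lim: "(\<lambda>n. LINT x|M. max (T (h' (r n)) x) 0 * \<xi> x) \<longlonglongrightarrow> (LINT x|M. max (T h x) 0 * \<xi> x)"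
  proof (rule weighted_tendsto_integral[OF _ _ _ \<xi>(1) \<xi>'])
    show "weighted_integrable (\<lambda>x. max (T (h' (r n)) x) 0)" for n
      by (rule weighted_integrable_bound[OF Th'_w[of "r n"]]) auto
    show "weighted_integrable (\<lambda>x. max (T h x) 0)"
      by (rule weighted_integrable_bound[OF Th_w]) auto
    show "(\<lambda>n. LINT x|M. \<bar>max (T (h' (r n)) x) 0 - max (T h x) 0\<bar> * d x) \<longlonglongrightarrow> 0"
    proof (rule squeeze_zero)
      show "(\<lambda>n. LINT x|M. \<bar>T (h' (r n)) x - T h x\<bar> * d x) \<longlonglongrightarrow> 0"
        using LIMSEQ_subseq_LIMSEQ[OF lim_T r(1)] by (simp add: o_def)
      show "0 \<le> (LINT x|M. \<bar>max (T (h' (r n)) x) 0 - max (T h x) 0\<bar> * d x)" for n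
        by (intro integral_nonneg_AE AE_I2) (simp add: weight_pos less_imp_le)
      show "(LINT x|M. \<bar>max (T (h' (r n)) x) 0 - max (T h x) 0\<bar> * d x)
          \<le> (LINT x|M. \<bar>T (h' (r n)) x - T h x\<bar> * d x)" for n
      proof (rule integral_mono)
        show "integrable M (\<lambda>x. \<bar>T (h' (r n)) x - T h x\<bar> * d x)"
          by (intro weighted_integrableD weighted_integrable_diff Th'_w Th_w)
        have "weighted_integrable (\<lambda>x. max (T (h' (r n)) x) 0 - max (T h x) 0)"
          by (rule weighted_integrable_bound[OF weighted_integrable_diff[OF Th'_w[of "r n"] Th_w]]) auto
        then show "integrable M (\<lambda>x. \<bar>max (T (h' (r n)) x) 0 - max (T h x) 0\<bar> * d x)"
          by (rule weighted_integrableD)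
        show "\<bar>max (T (h' (r n)) x) 0 - max (T h x) 0\<bar> * d x \<le> \<bar>T (h' (r n)) x - T h x\<bar> * d x"
          if "x \<in> space M" for x
          by (rule mult_right_mono) (use weight_pos[OF that] in auto)
      qed
    qed
  qed
  have "(\<lambda>n. (LINT x|M. y n x) + e (r n)) \<longlonglongrightarrow> (LINT x|M. Y x) + 0"
    using LIMSEQ_subseq_LIMSEQ[OF e_lim r(1)] by (intro tendsto_add y_lim) (simp add: o_def)
  then have "(LINT x|M. max (T h x) 0 * \<xi> x) \<le> (LINT x|M. Y x) + 0"
    by (rule LIMSEQ_le[OF lhs_lim]) (use main in blast)
  then show ?thesis by (simp add: Y_def \<eta>_def)
qed

text \<open>Kato's inequality with \<open>\<xi> = d\<close> for the difference \<open>h\<close> of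
  the two right-hand sides. Where \<open>u1 > u2\<close>, monotonicity makes
  \<open>g (u1) - g (u2)\<close> nonnegative, so it can be moved to the left. Where
  \<open>u1 = u2\<close>, the nonlinear terms cancel and the positive part of \<open>h\<close> is
  that of \<open>f1 - f2\<close>. Where \<open>u1 < u2\<close>, the positive part of
  \<open>g (u1) - g (u2)\<close> is 0.\<close>

lemma comparison:
  fixes g :: "real \<Rightarrow> real"
  assumes f: "weighted_integrable f1" "weighted_integrable f2"
    and u: "weighted_integrable u1" "weighted_integrable u2"
    and gu: "weighted_integrable (\<lambda>x. g (u1 x))" "weighted_integrable (\<lambda>x. g (u2 x))"
    and eq: "AE x in M. u1 x = T (\<lambda>y. f1 y - g (u1 y)) x" "AE x in M. u2 x = T (\<lambda>y. f2 y - g (u2 y)) x"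
    and g: "mono g"
  shows "(LINT x|M. max (u1 x - u2 x) 0 * d x) + (LINT x|M. max (g (u1 x) - g (u2 x)) 0 * T d x)
    \<le> (LINT x|M. max (f1 x - f2 x) 0 * T d x)"
proof -
  define h where "h x = (f1 x - g (u1 x)) - (f2 x - g (u2 x))" for x
  have h_w: "weighted_integrable h"
    unfolding h_def by (intro weighted_integrable_diff f gu)
  note [measurable] = f[THEN weighted_integrable_measurable] u[THEN weighted_integrable_measurable]
    gu[THEN weighted_integrable_measurable] weighted_integrable_measurable[OF h_w]
  have "AE x in M. T h x = T (\<lambda>y. f1 y - g (u1 y)) x - T (\<lambda>y. f2 y - g (u2 y)) x"
    unfolding h_def by (intro T_diff weighted_integrable_diff f gu)
  with eq have Th: "AE x in M. T h x = u1 x - u2 x" by eventually_elim simp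
  have Td0: "0 \<le> T d x" for x by (rule T_nonneg) (simp add: weight_pos less_imp_le)
  have d1: "\<bar>d x\<bar> \<le> 1 * d x" if "x \<in> space M" for x using weight_pos[OF that] by simp
  have Td_le: "\<bar>T d x\<bar> \<le> C * d x" if "x \<in> space M" for x
    using abs_T_bounded[OF schur_weight_weight weight_measurable d1 that] by simp
  have pos_w: "weighted_integrable (\<lambda>x. max (a x) 0)" if "weighted_integrable a" for a
    by (rule weighted_integrable_bound[OF that]) (use that in \<open>auto simp: weighted_integrable_def\<close>)
  have Td_meas: "T d \<in> borel_measurable M" by measurable
  have i1: "integrable M (\<lambda>x. max (f1 x - f2 x) 0 * T d x)"
    by (rule weighted_integrable_mult[OF pos_w Td_meas Td_le]) (intro weighted_integrable_diff f)
  have i2: "integrable M (\<lambda>x. max (g (u1 x) - g (u2 x)) 0 * T d x)"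
    by (rule weighted_integrable_mult[OF pos_w Td_meas Td_le]) (intro weighted_integrable_diff gu)
  have "(LINT x|M. max (u1 x - u2 x) 0 * d x) = (LINT x|M. max (T h x) 0 * d x)"
    by (rule integral_cong_AE) (use Th in \<open>auto elim!: eventually_mono\<close>)
  also have "\<dots> \<le> (LINT x|M. (if T h x = 0 then max (h x) 0 else if 0 < T h x then h x else 0) * T d x)"
    by (rule kato_weighted[OF h_w, where K=1]) (auto simp: weight_pos less_imp_le)
  also have "\<dots> \<le> (LINT x|M. max (f1 x - f2 x) 0 * T d x - max (g (u1 x) - g (u2 x)) 0 * T d x)"
  proof (rule integral_mono_AE)
    show "integrable M (\<lambda>x. (if T h x = 0 then max (h x) 0 else if 0 < T h x then h x else 0) * T d x)"
    proof (rule weighted_integrable_mult[OF _ Td_meas Td_le])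
      show "weighted_integrable (\<lambda>x. if T h x = 0 then max (h x) 0 else if 0 < T h x then h x else 0)"
        by (rule weighted_integrable_bound[OF h_w]) auto
    qed
    show "integrable M (\<lambda>x. max (f1 x - f2 x) 0 * T d x - max (g (u1 x) - g (u2 x)) 0 * T d x)"
      by (rule Bochner_Integration.integrable_diff[OF i1 i2])
    show "AE x in M. (if T h x = 0 then max (h x) 0 else if 0 < T h x then h x else 0) * T d x
        \<le> max (f1 x - f2 x) 0 * T d x - max (g (u1 x) - g (u2 x)) 0 * T d x"
      using Th
    proof eventually_elim
      case (elim x)
      have "(if T h x = 0 then max (h x) 0 else if 0 < T h x then h x else 0)
          \<le> max (f1 x - f2 x) 0 - max (g (u1 x) - g (u2 x)) 0"
      proof -
        consider "u1 x = u2 x" | "u2 x < u1 x" | "u1 x < u2 x" by linarith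
        then show ?thesis
        proof cases
          case 1
          then show ?thesis using elim by (simp add: h_def)
        next
          case 2
          with monoD[OF g, of "u2 x" "u1 x"] show ?thesis using elim by (auto simp: h_def)
        next
          case 3
          with monoD[OF g, of "u1 x" "u2 x"] show ?thesis using elim by auto
        qed
      qed
      from mult_right_mono[OF this Td0[of x]] show ?case by (simp only: left_diff_distrib)
    qed
  qed
  also have "\<dots> = (LINT x|M. max (f1 x - f2 x) 0 * T d x) - (LINT x|M. max (g (u1 x) - g (u2 x)) 0 * T d x)"
    by (rule Bochner_Integration.integral_diff[OF i1 i2])
  finally show ?thesis by simp
qed

text \<open>The right side of \<open>comparison\<close> vanishes for ordered data, and
  \<open>d > 0\<close> turns the vanishing weighted integral into an inequality almost
  everywhere.\<close>

lemma comparison_AE: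
  fixes g :: "real \<Rightarrow> real"
  assumes f: "weighted_integrable f1" "weighted_integrable f2" "AE x in M. f1 x \<le> f2 x"
    and u: "weighted_integrable u1" "weighted_integrable u2"
    and gu: "weighted_integrable (\<lambda>x. g (u1 x))" "weighted_integrable (\<lambda>x. g (u2 x))"
    and eq: "AE x in M. u1 x = T (\<lambda>y. f1 y - g (u1 y)) x" "AE x in M. u2 x = T (\<lambda>y. f2 y - g (u2 y)) x"
    and g: "mono g"
  shows "AE x in M. u1 x \<le> u2 x"
proof -
  note [measurable] = f(1,2)[THEN weighted_integrable_measurable] u[THEN weighted_integrable_measurable]
  have "0 \<le> (LINT x|M. max (g (u1 x) - g (u2 x)) 0 * T d x)"
    by (intro integral_nonneg_AE AE_I2 mult_nonneg_nonneg T_nonneg) (auto simp: weight_pos less_imp_le)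
  moreover have "(LINT x|M. max (f1 x - f2 x) 0 * T d x) = (LINT x|M. 0)"
    by (rule integral_cong_AE) (use f(3) in \<open>auto elim!: eventually_mono\<close>)
  ultimately have "(LINT x|M. max (u1 x - u2 x) 0 * d x) \<le> 0"
    using comparison[OF f(1,2) u gu eq g] by simp
  moreover have "0 \<le> (LINT x|M. max (u1 x - u2 x) 0 * d x)"
    by (intro integral_nonneg_AE AE_I2 mult_nonneg_nonneg) (auto simp: weight_pos less_imp_le)
  ultimately have 0: "(LINT x|M. max (u1 x - u2 x) 0 * d x) = 0" by simp
  have "weighted_integrable (\<lambda>x. max (u1 x - u2 x) 0)"
    by (rule weighted_integrable_bound[OF weighted_integrable_diff[OF u]]) auto
  from weighted_integrableD[OF this] have "integrable M (\<lambda>x. max (u1 x - u2 x) 0 * d x)"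
    by simp
  then have "AE x in M. max (u1 x - u2 x) 0 * d x = 0"
    using 0 by (subst (asm) integral_nonneg_eq_0_iff_AE)
      (auto simp: weight_pos less_imp_le)
  with AE_space show ?thesis
  proof eventually_elim
    case (elim x)
    then show ?case using weight_pos[of x] by simp
  qed
qed

text \<open>The sum of \<open>comparison\<close> in both orders, with \<open>T d\<close> replaced by
  \<open>c * d\<close> from below on the left and by \<open>C * d\<close> from above on the right.
  The term with \<open>g\<close> is the reason for keeping track of the lower bound on
  \<open>T d\<close>.\<close>

lemma stability:
  fixes g :: "real \<Rightarrow> real"
  assumes f: "weighted_integrable f1" "weighted_integrable f2"
    and u: "weighted_integrable u1" "weighted_integrable u2"
    and gu: "weighted_integrable (\<lambda>x. g (u1 x))" "weighted_integrable (\<lambda>x. g (u2 x))"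
    and eq: "AE x in M. u1 x = T (\<lambda>y. f1 y - g (u1 y)) x" "AE x in M. u2 x = T (\<lambda>y. f2 y - g (u2 y)) x"
    and g: "mono g"
  shows "(LINT x|M. \<bar>u1 x - u2 x\<bar> * d x) + c * (LINT x|M. \<bar>g (u1 x) - g (u2 x)\<bar> * d x)
    \<le> C * (LINT x|M. \<bar>f1 x - f2 x\<bar> * d x)"
proof -
  have d1: "\<bar>d x\<bar> \<le> 1 * d x" if "x \<in> space M" for x using weight_pos[OF that] by simp
  have Td_le: "\<bar>T d x\<bar> \<le> C * d x" if "x \<in> space M" for x
    using abs_T_bounded[OF schur_weight_weight weight_measurable d1 that] by simp
  have Td_meas: "T d \<in> borel_measurable M" by measurable
  have pos_w: "weighted_integrable (\<lambda>x. max (a x) 0)" if "weighted_integrable a" for a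
    by (rule weighted_integrable_bound[OF that]) (use that in \<open>auto simp: weighted_integrable_def\<close>)
  have split: "(LINT x|M. max (a x - b x) 0 * e x) + (LINT x|M. max (b x - a x) 0 * e x)
      = (LINT x|M. \<bar>a x - b x\<bar> * e x)"
    if "weighted_integrable a" "weighted_integrable b" "e \<in> borel_measurable M"
      "\<And>x. x \<in> space M \<Longrightarrow> \<bar>e x\<bar> \<le> K * d x" for a b e K
  proof -
    have "integrable M (\<lambda>x. max (a x - b x) 0 * e x)"
      by (intro weighted_integrable_mult[OF pos_w that(3,4)] weighted_integrable_diff that)
    moreover have "integrable M (\<lambda>x. max (b x - a x) 0 * e x)"
      by (intro weighted_integrable_mult[OF pos_w that(3,4)] weighted_integrable_diff that)
    ultimately have "(LINT x|M. max (a x - b x) 0 * e x) + (LINT x|M. max (b x - a x) 0 * e x)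
        = (LINT x|M. max (a x - b x) 0 * e x + max (b x - a x) 0 * e x)"
      by simp
    also have "\<dots> = (LINT x|M. \<bar>a x - b x\<bar> * e x)"
      by (rule Bochner_Integration.integral_cong) (auto simp: max_def)
    finally show ?thesis .
  qed
  have gg: "weighted_integrable (\<lambda>x. g (u1 x) - g (u2 x))" "weighted_integrable (\<lambda>x. f1 x - f2 x)"
    by (intro weighted_integrable_diff gu f)+
  have abs_w: "weighted_integrable (\<lambda>x. \<bar>a x\<bar>)" if "weighted_integrable a" for a
    using that by (auto simp: weighted_integrable_def intro: borel_measurable_abs)
  have "c * (LINT x|M. \<bar>g (u1 x) - g (u2 x)\<bar> * d x) = (LINT x|M. c * (\<bar>g (u1 x) - g (u2 x)\<bar> * d x))"
    by simp
  also have "\<dots> \<le> (LINT x|M. \<bar>g (u1 x) - g (u2 x)\<bar> * T d x)"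
  proof (rule integral_mono)
    show "integrable M (\<lambda>x. c * (\<bar>g (u1 x) - g (u2 x)\<bar> * d x))"
      by (rule integrable_mult_right[OF weighted_integrableD[OF gg(1)]])
    show "integrable M (\<lambda>x. \<bar>g (u1 x) - g (u2 x)\<bar> * T d x)"
      by (rule weighted_integrable_mult[OF abs_w[OF gg(1)] Td_meas Td_le])
    show "c * (\<bar>g (u1 x) - g (u2 x)\<bar> * d x) \<le> \<bar>g (u1 x) - g (u2 x)\<bar> * T d x" if "x \<in> space M" for x
      using mult_left_mono[OF weight_lower[OF that], of "\<bar>g (u1 x) - g (u2 x)\<bar>"] by (simp add: mult_ac)
  qed
  finally have 1: "c * (LINT x|M. \<bar>g (u1 x) - g (u2 x)\<bar> * d x) \<le> (LINT x|M. \<bar>g (u1 x) - g (u2 x)\<bar> * T d x)" .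
  have "(LINT x|M. \<bar>f1 x - f2 x\<bar> * T d x) \<le> (LINT x|M. C * (\<bar>f1 x - f2 x\<bar> * d x))"
  proof (rule integral_mono)
    show "integrable M (\<lambda>x. C * (\<bar>f1 x - f2 x\<bar> * d x))"
      by (rule integrable_mult_right[OF weighted_integrableD[OF gg(2)]])
    show "integrable M (\<lambda>x. \<bar>f1 x - f2 x\<bar> * T d x)"
      by (rule weighted_integrable_mult[OF abs_w[OF gg(2)] Td_meas Td_le])
    show "\<bar>f1 x - f2 x\<bar> * T d x \<le> C * (\<bar>f1 x - f2 x\<bar> * d x)" if "x \<in> space M" for x
      using mult_left_mono[OF order_trans[OF abs_ge_self Td_le[OF that]], of "\<bar>f1 x - f2 x\<bar>"]
      by (simp add: mult_ac)
  qed
  then have 2: "(LINT x|M. \<bar>f1 x - f2 x\<bar> * T d x) \<le> C * (LINT x|M. \<bar>f1 x - f2 x\<bar> * d x)" by simp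
  show ?thesis
    using comparison[OF f u gu eq g] comparison[OF f(2,1) u(2,1) gu(2,1) eq(2,1) g]
      split[OF u weight_measurable d1] split[OF gu Td_meas Td_le] split[OF f Td_meas Td_le] 1 2
    by linarith
qed

end

section \<open>Existence for weighted data\<close>

text \<open>Freezing \<open>g\<close> outside \<open>[- L, L]\<close> makes it bounded and uniformly
  continuous. Its infimal convolution with \<open>l * \<bar>t\<bar>\<close> is then Lipschitz, still
  monotone, and uniformly close for large \<open>l\<close>.\<close>

lemma lipschitz_monotone_approximation:
  fixes g :: "real \<Rightarrow> real"
  assumes g: "mono g" "continuous_on UNIV g" "g 0 = 0" and L: "0 \<le> L" and e: "0 < e"
  shows "\<exists>q l B. mono q \<and> (\<forall>a b. \<bar>q a - q b\<bar> \<le> l * \<bar>a - b\<bar>) \<and> q 0 = 0 \<and> (\<forall>t. \<bar>q t\<bar> \<le> B) \<and>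
    (\<forall>t. \<bar>t\<bar> \<le> L \<longrightarrow> \<bar>q t - g t\<bar> \<le> e)"
proof -
  define clamp where "clamp t = max (- L) (min L t)" for t
  define G where "G t = g (clamp t)" for t
  define b where "b = max \<bar>g L\<bar> \<bar>g (- L)\<bar>"
  have clamp: "- L \<le> clamp t" "clamp t \<le> L" for t using L by (auto simp: clamp_def)
  have b0: "b \<ge> 0" by (simp add: b_def)
  have G_b: "\<bar>G t\<bar> \<le> b" for t
    using monoD[OF g(1) clamp(1)[of t]] monoD[OF g(1) clamp(2)[of t]]
    unfolding G_def b_def by linarith
  have G_mono: "G s \<le> G t" if "s \<le> t" for s t
    unfolding G_def using that by (intro monoD[OF g(1)]) (auto simp: clamp_def)
  have "uniformly_continuous_on {- L..L} g"
    using g(2) by (intro compact_uniformly_continuous) (auto intro: continuous_on_subset)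
  then obtain \<eta> where \<eta>: "\<eta> > 0"
    "\<And>s t. s \<in> {- L..L} \<Longrightarrow> t \<in> {- L..L} \<Longrightarrow> dist s t < \<eta> \<Longrightarrow> dist (g s) (g t) < e / 2"
    unfolding uniformly_continuous_on_def using e by (metis half_gt_zero)
  have G_uc: "\<bar>G s - G t\<bar> < e / 2" if "\<bar>s - t\<bar> < \<eta>" for s t
  proof -
    have "\<bar>clamp s - clamp t\<bar> \<le> \<bar>s - t\<bar>" by (auto simp: clamp_def)
    with that clamp show ?thesis
      unfolding G_def using \<eta>(2)[of "clamp s" "clamp t"] by (simp add: dist_real_def)
  qed
  \<comment> \<open>With this slope a competitor \<open>s\<close> at distance at least
    \<open>\<eta>\<close> from \<open>t\<close> pays a penalty of at least \<open>2 * b\<close>,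
    which is as much as two values of \<open>G\<close> can differ.\<close>
  define l where "l = 2 * b / \<eta>"
  have l0: "l \<ge> 0" using b0 \<eta>(1) by (simp add: l_def)
  define p where "p t = (INF s. G s + l * \<bar>t - s\<bar>)" for t
  have bdd: "bdd_below (range (\<lambda>s. G s + l * \<bar>t - s\<bar>))" for t
  proof (rule bdd_belowI2)
    fix s show "- b \<le> G s + l * \<bar>t - s\<bar>"
      using G_b[of s] mult_nonneg_nonneg[OF l0 abs_ge_zero[of "t - s"]] by linarith
  qed
  have p_le: "p t \<le> G s + l * \<bar>t - s\<bar>" for t s
    unfolding p_def by (rule cINF_lower[OF bdd]) simp
  have p_ge: "m \<le> p t" if "\<And>s. m \<le> G s + l * \<bar>t - s\<bar>" for m t
    unfolding p_def by (rule cINF_greatest) (use that in auto)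
  have p_upper: "p t \<le> G t" for t using p_le[of t t] by simp
  have p_lower: "G t - e / 2 \<le> p t" for t
  proof (rule p_ge)
    fix s
    show "G t - e / 2 \<le> G s + l * \<bar>t - s\<bar>"
    proof (cases "\<bar>t - s\<bar> < \<eta>")
      case True
      then show ?thesis
        using G_uc[OF True] mult_nonneg_nonneg[OF l0 abs_ge_zero[of "t - s"]] by linarith
    next
      case False
      then have "l * \<eta> \<le> l * \<bar>t - s\<bar>" by (intro mult_left_mono l0) simp
      then have "2 * b \<le> l * \<bar>t - s\<bar>" using \<eta>(1) by (simp add: l_def)
      with G_b[of t] G_b[of s] e show ?thesis by linarith
    qed
  qed
  have p_lip: "p t \<le> p t' + l * \<bar>t - t'\<bar>" for t t'
  proof -
    have "p t - l * \<bar>t - t'\<bar> \<le> p t'"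
    proof (rule p_ge)
      fix s
      have "l * \<bar>t - s\<bar> \<le> l * (\<bar>t' - s\<bar> + \<bar>t - t'\<bar>)" by (intro mult_left_mono l0) simp
      with p_le[of t s] show "p t - l * \<bar>t - t'\<bar> \<le> G s + l * \<bar>t' - s\<bar>"
        by (simp add: distrib_left)
    qed
    then show ?thesis by simp
  qed
  have p_mono: "p t \<le> p t'" if "t \<le> t'" for t t'
  proof (rule p_ge)
    fix s
    \<comment> \<open>Shifting the competitor by \<open>t' - t\<close> preserves the penalty and, by
      monotonicity, does not increase \<open>G\<close>.\<close>
    have "p t \<le> G (s - (t' - t)) + l * \<bar>t - (s - (t' - t))\<bar>" by (rule p_le)
    also have "\<dots> \<le> G s + l * \<bar>t' - s\<bar>" using that by (intro add_mono G_mono) auto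
    finally show "p t \<le> G s + l * \<bar>t' - s\<bar>" .
  qed
  \<comment> \<open>\<open>p 0\<close> lies between \<open>- e / 2\<close> and 0, so restoring the
    value 0 at 0 costs another \<open>e / 2\<close>.\<close>
  define q where "q t = p t - p 0" for t
  have "clamp 0 = 0" using L by (simp add: clamp_def)
  then have G0: "G 0 = 0" by (simp add: G_def g(3))
  have "\<bar>q s - q t\<bar> \<le> l * \<bar>s - t\<bar>" for s t
    using p_lip[of s t] p_lip[of t s] by (simp add: q_def abs_minus_commute abs_le_iff)
  moreover have "mono q" by (rule monoI) (simp add: q_def p_mono)
  moreover have "\<bar>q t\<bar> \<le> b + e" for t
    using p_upper[of t] p_lower[of t] p_upper[of 0] p_lower[of 0] G_b[of t] G0 e
    unfolding q_def by linarith
  moreover have "\<bar>q t - g t\<bar> \<le> e" if "\<bar>t\<bar> \<le> L" for t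
  proof -
    have "clamp t = t" using that by (auto simp: clamp_def)
    then have "G t = g t" by (simp add: G_def)
    then show ?thesis
      using p_upper[of t] p_lower[of t] p_upper[of 0] p_lower[of 0] G0 unfolding q_def by linarith
  qed
  moreover have "q 0 = 0" by (simp add: q_def)
  ultimately show ?thesis by blast
qed

context maximum_principle_kernel
begin

section \<open>Exact solutions for perturbed bounded data\<close>

lemma weighted_integrable_AE_bounded:
  assumes "f \<in> borel_measurable M" "AE x in M. \<bar>f x\<bar> \<le> K"
  shows "weighted_integrable f"
proof (rule weighted_integrable_bound)
  show "weighted_integrable (\<lambda>_. K)" by (rule weighted_integrable_integrable) simp
  show "AE x in M. \<bar>f x\<bar> \<le> \<bar>K\<bar>" using assms(2) by eventually_elim simp
qed fact

text \<open>The equation is solved with a Lipschitz \<open>q\<close> close to \<open>g\<close> on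
  \<open>[- L, L]\<close>. The maximum principle keeps the solution in that interval, so the
  discrepancy between \<open>q\<close> and \<open>g\<close> along it is at most \<open>e\<close> and
  can be absorbed into the datum \<open>f'\<close>. The nonlinearity in the conclusion is
  \<open>g\<close> itself, so \<open>stability\<close> applies to two such solutions.\<close>

lemma bounded_existence:
  fixes g :: "real \<Rightarrow> real"
  assumes f: "f \<in> borel_measurable M" "\<And>x. x \<in> space M \<Longrightarrow> \<bar>f x\<bar> \<le> k" and k: "0 \<le> k"
    and g: "mono g" "continuous_on UNIV g" "g 0 = 0" and e: "0 < e"
  shows "\<exists>u f'. weighted_integrable u \<and> weighted_integrable (\<lambda>x. g (u x)) \<and> f' \<in> borel_measurable M \<and>
    (AE x in M. \<bar>f' x - f x\<bar> \<le> e) \<and> (AE x in M. u x = T (\<lambda>y. f' y - g (u y)) x)"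
proof -
  \<comment> \<open>The a priori bound depends on \<open>f\<close> alone, so it is available before
    \<open>q\<close> is chosen.\<close>
  define L where "L = k * C"
  have L0: "0 \<le> L" using k C_nonneg by (simp add: L_def)
  obtain q l B where q: "mono q" "\<And>a b. \<bar>q a - q b\<bar> \<le> l * \<bar>a - b\<bar>" "q 0 = 0" "\<And>t. \<bar>q t\<bar> \<le> B"
    "\<And>t. \<bar>t\<bar> \<le> L \<Longrightarrow> \<bar>q t - g t\<bar> \<le> e"
    using lipschitz_monotone_approximation[OF g L0 e] by blast
  have [measurable]: "g \<in> borel_measurable borel" by (rule borel_measurable_continuous_onI[OF g(2)])
  have [measurable]: "q \<in> borel_measurable borel" by (rule lipschitz_imp_measurable[OF q(2)])
  note [measurable] = f(1)
  obtain u0 where u0: "square_integrable M u0" "AE x in M. u0 x = T (\<lambda>y. f y - q (u0 y)) x"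
    using lipschitz_existence[OF square_integrable_const_bound[OF f] q(1,2,3)] by blast
  note [measurable] = square_integrable_measurable[OF u0(1)]
  define h where "h x = f x - q (u0 x)" for x
  have h_meas [measurable]: "h \<in> borel_measurable M" unfolding h_def by measurable
  have h_b: "\<bar>h x\<bar> \<le> k + B" if "x \<in> space M" for x
    using f(2)[OF that] q(4)[of "u0 x"] unfolding h_def by linarith
  have u0_eq: "AE x in M. u0 x = T h x" using u0(2) by (simp add: h_def[abs_def])
  define u where "u = T h"
  have u_meas [measurable]: "u \<in> borel_measurable M" unfolding u_def by measurable
  have upper: "AE x in M. T h x \<le> L"
    unfolding L_def
  proof (rule maximum_principle_bound[OF h_meas h_b _ k])
    show "AE x in M. 0 < T h x \<longrightarrow> h x \<le> k"
      using u0_eq AE_space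
    proof eventually_elim
      case (elim x)
      show ?case using monoD[OF q(1), of 0 "u0 x"] q(3) f(2)[OF elim(2)] elim(1) by (auto simp: h_def)
    qed
  qed
  have lower: "AE x in M. T (\<lambda>x. - h x) x \<le> L"
    unfolding L_def
  proof (rule maximum_principle_bound[OF _ _ _ k])
    show "(\<lambda>x. - h x) \<in> borel_measurable M" by measurable
    show "\<bar>- h x\<bar> \<le> k + B" if "x \<in> space M" for x using h_b[OF that] by simp
    show "AE x in M. 0 < T (\<lambda>x. - h x) x \<longrightarrow> - h x \<le> k"
      using u0_eq AE_space
    proof eventually_elim
      case (elim x)
      have "- h x = q (u0 x) - f x" by (simp add: h_def)
      then show ?case unfolding T_uminus
        using monoD[OF q(1), of "u0 x" 0] q(3) f(2)[OF elim(2)] elim(1) by auto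
    qed
  qed
  have u_le: "AE x in M. \<bar>u x\<bar> \<le> L"
    using upper lower by eventually_elim (simp add: u_def T_uminus)
  \<comment> \<open>Chosen so that \<open>f' - g (u) = h\<close> at every point; the equation then
    holds by the definition \<open>u = T h\<close>.\<close>
  define f' where "f' x = f x + g (u x) - q (u0 x)" for x
  have "AE x in M. \<bar>q (u x) - g (u x)\<bar> \<le> e"
    using u_le by eventually_elim (rule q(5))
  then have close: "AE x in M. \<bar>f' x - f x\<bar> \<le> e"
    using u0_eq by eventually_elim (simp add: f'_def u_def abs_minus_commute)
  have gu: "AE x in M. \<bar>g (u x)\<bar> \<le> B + e"
    using u_le
  proof eventually_elim
    case (elim x)
    show ?case using q(5)[OF elim] q(4)[of "u x"] by linarith
  qed
  have "(\<lambda>y. f' y - g (u y)) = h" by (auto simp: f'_def h_def)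
  then have "AE x in M. u x = T (\<lambda>y. f' y - g (u y)) x" by (simp add: u_def)
  moreover have "weighted_integrable u" by (rule weighted_integrable_AE_bounded[OF u_meas u_le])
  moreover have "weighted_integrable (\<lambda>x. g (u x))" by (rule weighted_integrable_AE_bounded[OF _ gu]) measurable
  moreover have "f' \<in> borel_measurable M" unfolding f'_def by measurable
  ultimately show ?thesis using close by blast
qed

text \<open>Test functions are bounded by a multiple of \<open>d\<close> at every point rather than
  almost everywhere; \<open>weak_dual_solution_iff\<close> bridges this difference.\<close>

definition weak_solution :: "(real \<Rightarrow> real) \<Rightarrow> ('a \<Rightarrow> real) \<Rightarrow> ('a \<Rightarrow> real) \<Rightarrow> bool" where
  "weak_solution g f u \<longleftrightarrow> weighted_integrable u \<and> weighted_integrable (\<lambda>x. g (u x)) \<and>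
     (\<forall>\<xi> K. \<xi> \<in> borel_measurable M \<and> (\<forall>x\<in>space M. \<bar>\<xi> x\<bar> \<le> K * d x) \<longrightarrow>
        (LINT x|M. u x * \<xi> x) + (LINT x|M. g (u x) * T \<xi> x) = (LINT x|M. f x * T \<xi> x))"

lemma integral_T_diff_mult:
  assumes f: "weighted_integrable f" and v: "weighted_integrable v"
    and \<xi>: "\<xi> \<in> borel_measurable M" "\<And>x. x \<in> space M \<Longrightarrow> \<bar>\<xi> x\<bar> \<le> K * d x"
  shows "(LINT x|M. f x * T \<xi> x) - (LINT x|M. v x * T \<xi> x)
    = (LINT x|M. T (\<lambda>y. f y - v y) x * \<xi> x)"
proof -
  have T\<xi>: "\<bar>T \<xi> x\<bar> \<le> (K * C) * d x" if "x \<in> space M" for x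
    using abs_T_bounded[OF schur_weight_weight \<xi> that] by (simp add: mult.assoc)
  have T\<xi>_meas: "T \<xi> \<in> borel_measurable M" using \<xi>(1) by measurable
  have "(LINT x|M. T (\<lambda>y. f y - v y) x * \<xi> x) = (LINT x|M. (f x - v x) * T \<xi> x)"
    by (rule T_swap_weighted[OF weighted_integrable_diff[OF f v] \<xi>])
  also have "\<dots> = (LINT x|M. f x * T \<xi> x - v x * T \<xi> x)" by (simp add: left_diff_distrib)
  also have "\<dots> = (LINT x|M. f x * T \<xi> x) - (LINT x|M. v x * T \<xi> x)"
    by (rule Bochner_Integration.integral_diff[OF weighted_integrable_mult[OF f T\<xi>_meas T\<xi>]
          weighted_integrable_mult[OF v T\<xi>_meas T\<xi>]])
  finally show ?thesis by simp
qed

text \<open>With \<open>w = T (f - g (u))\<close>, symmetry of \<open>T\<close> turns the weak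
  formulation into equality of the pairings of \<open>u\<close> and \<open>w\<close> with every test
  function. The choice \<open>sgn (u - w) * d\<close> yields that the weighted norm of
  \<open>u - w\<close> is 0.\<close>

lemma weak_solution_imp_AE:
  assumes f: "weighted_integrable f" and u: "weak_solution g f u"
  shows "AE x in M. u x = T (\<lambda>y. f y - g (u y)) x"
proof -
  have uw: "weighted_integrable u" and gu: "weighted_integrable (\<lambda>x. g (u x))"
    and test: "\<And>\<xi> K. \<xi> \<in> borel_measurable M \<Longrightarrow> (\<And>x. x \<in> space M \<Longrightarrow> \<bar>\<xi> x\<bar> \<le> K * d x) \<Longrightarrow>
      (LINT x|M. u x * \<xi> x) + (LINT x|M. g (u x) * T \<xi> x) = (LINT x|M. f x * T \<xi> x)"
    using u by (auto simp: weak_solution_def)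
  define w where "w = T (\<lambda>y. f y - g (u y))"
  have ww: "weighted_integrable w"
    unfolding w_def by (intro weighted_integrable_T weighted_integrable_diff f gu)
  note uww = weighted_integrable_diff[OF uw ww]
  note [measurable] = weighted_integrable_measurable[OF uw] weighted_integrable_measurable[OF ww]
  define \<xi> where "\<xi> x = sgn (u x - w x) * d x" for x
  have \<xi>_meas: "\<xi> \<in> borel_measurable M" unfolding \<xi>_def by measurable
  have \<xi>_le: "\<bar>\<xi> x\<bar> \<le> 1 * d x" if "x \<in> space M" for x
    using weight_pos[OF that] by (simp add: \<xi>_def abs_mult sgn_if)
  have "(LINT x|M. u x * \<xi> x) = (LINT x|M. w x * \<xi> x)"
    using test[OF \<xi>_meas \<xi>_le] integral_T_diff_mult[OF f gu \<xi>_meas \<xi>_le] by (simp add: w_def)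
  then have "(LINT x|M. u x * \<xi> x - w x * \<xi> x) = 0"
    using weighted_integrable_mult[OF uw \<xi>_meas \<xi>_le] weighted_integrable_mult[OF ww \<xi>_meas \<xi>_le]
    by simp
  also have "(\<lambda>x. u x * \<xi> x - w x * \<xi> x) = (\<lambda>x. \<bar>u x - w x\<bar> * d x)"
    by (auto simp: fun_eq_iff \<xi>_def sgn_if algebra_simps)
  finally have "(LINT x|M. \<bar>u x - w x\<bar> * d x) = 0" .
  then have "AE x in M. \<bar>u x - w x\<bar> * d x = 0"
    using weighted_integrableD[OF uww] by (subst (asm) integral_nonneg_eq_0_iff_AE)
      (auto simp: weight_pos less_imp_le)
  with AE_space show ?thesis
    unfolding w_def[symmetric]
  proof eventually_elim
    case (elim x)
    then show ?case using weight_pos[of x] by simp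
  qed
qed

lemma weak_solution_mono:
  assumes "weighted_integrable f1" "weighted_integrable f2" "AE x in M. f1 x \<le> f2 x"
    and "weak_solution g f1 u1" "weak_solution g f2 u2" "mono g"
  shows "AE x in M. u1 x \<le> u2 x"
  using assms by (intro comparison_AE[of f1 f2 u1 u2 g] weak_solution_imp_AE)
    (auto simp: weak_solution_def)

lemma weighted_limit_of_summable:
  assumes w: "\<And>n. weighted_integrable (v n)"
    and sm: "summable (\<lambda>n. LINT x|M. \<bar>v (Suc n) x - v n x\<bar> * d x)"
  shows "\<exists>V. weighted_integrable V \<and> (AE x in M. (\<lambda>n. v n x) \<longlonglongrightarrow> V x) \<and>
    (\<lambda>n. LINT x|M. \<bar>v n x - V x\<bar> * d x) \<longlonglongrightarrow> 0"
proof -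
  have int: "integrable M (\<lambda>x. v n x * d x)" for n
    by (rule weighted_integrable_mult[OF w weight_measurable, where K=1]) (simp add: weight_pos less_imp_le)
  have "(LINT x|M. \<bar>v (Suc n) x * d x - v n x * d x\<bar>) = (LINT x|M. \<bar>v (Suc n) x - v n x\<bar> * d x)" for n
    by (rule Bochner_Integration.integral_cong)
      (auto simp: left_diff_distrib[symmetric] abs_mult weight_pos less_imp_le)
  with sm have "summable (\<lambda>n. LINT x|M. \<bar>v (Suc n) x * d x - v n x * d x\<bar>)" by simp
  from L1_limit_of_summable[of M "\<lambda>n x. v n x * d x", OF int this]
  obtain H where H: "integrable M H" "AE x in M. (\<lambda>n. v n x * d x) \<longlonglongrightarrow> H x"
    "(\<lambda>n. LINT x|M. \<bar>v n x * d x - H x\<bar>) \<longlonglongrightarrow> 0" by blast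
  note [measurable] = borel_measurable_integrable[OF H(1)]
  define V where "V x = H x / d x" for x
  have Vd: "V x * d x = H x" if "x \<in> space M" for x using weight_pos[OF that] by (simp add: V_def)
  have "integrable M (\<lambda>x. \<bar>V x\<bar> * d x) \<longleftrightarrow> integrable M (\<lambda>x. \<bar>H x\<bar>)"
    by (rule Bochner_Integration.integrable_cong)
      (auto simp: Vd[symmetric] abs_mult weight_pos less_imp_le)
  moreover have "V \<in> borel_measurable M" unfolding V_def by measurable
  ultimately have "weighted_integrable V" using H(1) by (simp add: weighted_integrable_def)
  moreover have "AE x in M. (\<lambda>n. v n x) \<longlonglongrightarrow> V x"
    using H(2) AE_space
  proof eventually_elim
    case (elim x)
    have "(\<lambda>n. v n x * d x / d x) \<longlonglongrightarrow> H x / d x"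
      using weight_pos[OF elim(2)] by (intro tendsto_divide elim tendsto_const) simp
    then show ?case using weight_pos[OF elim(2)] by (simp add: V_def)
  qed
  moreover have "(LINT x|M. \<bar>v n x * d x - H x\<bar>) = (LINT x|M. \<bar>v n x - V x\<bar> * d x)" for n
    by (rule Bochner_Integration.integral_cong)
      (auto simp: Vd[symmetric] left_diff_distrib[symmetric] abs_mult weight_pos less_imp_le)
  ultimately show ?thesis using H(3) by (intro exI[of _ V]) simp
qed

text \<open>Exact solutions for data within \<open>(1/2) ^ n\<close> of \<open>f\<close> have
  summable increments by \<open>stability\<close>, and so do their images under \<open>g\<close>.
  Both sequences converge almost everywhere and in the weighted norm, which suffices for the limit
  in the weak formulation.\<close>

lemma weak_solution_exists:
  fixes g :: "real \<Rightarrow> real"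
  assumes f: "weighted_integrable f" and g: "mono g" "continuous_on UNIV g" "g 0 = 0"
  shows "\<exists>u. weak_solution g f u"
proof -
  note [measurable] = weighted_integrable_measurable[OF f]
  define \<mu> where "\<mu> = (LINT x|M. \<bar>1\<bar> * d x)"
  have \<mu>0: "\<mu> \<ge> 0" unfolding \<mu>_def by (intro integral_nonneg_AE AE_I2) (simp add: weight_pos less_imp_le)
  have int_d: "integrable M d"
    using weighted_integrableD[OF weighted_integrable_integrable[of "\<lambda>_. 1"]] by simp
  define approx where "approx n u f' \<longleftrightarrow> weighted_integrable u \<and> weighted_integrable (\<lambda>x. g (u x)) \<and>
      weighted_integrable f' \<and> (LINT x|M. \<bar>f' x - f x\<bar> * d x) \<le> (1/2) ^ n \<and>
      (AE x in M. u x = T (\<lambda>y. f' y - g (u y)) x)" for n u f'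
  have "\<exists>u f'. approx n u f'" for n
  proof -
    have "(1/2) ^ n / 2 > (0::real)" by simp
    from order_tendstoD(2)[OF truncate_tendsto[OF f] this]
    obtain N where N: "(LINT x|M. \<bar>truncate N f x - f x\<bar> * d x) < (1/2) ^ n / 2"
      by (auto dest: eventually_happens)
    \<comment> \<open>Half of the error is spent on the truncation, the other half on this
      perturbation, whose weighted norm is at most \<open>e * \<mu>\<close>;
      \<open>\<mu> + 1\<close> avoids a division by 0.\<close>
    define e where "e = (1/2) ^ n / (2 * (\<mu> + 1))"
    have e: "e > 0" using \<mu>0 by (simp add: e_def)
    obtain u f' where u: "weighted_integrable u" "weighted_integrable (\<lambda>x. g (u x))"
      "f' \<in> borel_measurable M" "AE x in M. \<bar>f' x - truncate N f x\<bar> \<le> e"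
      "AE x in M. u x = T (\<lambda>y. f' y - g (u y)) x"
      using bounded_existence[of "truncate N f" "real N" g e] abs_truncate_le(1) g e by auto
    note [measurable] = u(3)
    have tw: "weighted_integrable (truncate N f)" by (rule weighted_integrable_truncate[OF f])
    have ft: "weighted_integrable (\<lambda>x. f' x - truncate N f x)"
      by (rule weighted_integrable_AE_bounded[OF _ u(4)]) measurable
    have f'_w: "weighted_integrable f'"
      using weighted_integrable_add[OF ft tw] by simp
    have "(LINT x|M. \<bar>f' x - f x\<bar> * d x) \<le> (LINT x|M. e * (\<bar>1\<bar> * d x) + \<bar>truncate N f x - f x\<bar> * d x)"
    proof (rule integral_mono_AE)
      show "integrable M (\<lambda>x. \<bar>f' x - f x\<bar> * d x)"
        by (intro weighted_integrableD weighted_integrable_diff f'_w f)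
      show "integrable M (\<lambda>x. e * (\<bar>1\<bar> * d x) + \<bar>truncate N f x - f x\<bar> * d x)"
        using int_d by (intro Bochner_Integration.integrable_add integrable_mult_right
          weighted_integrableD weighted_integrable_diff tw f) simp
      show "AE x in M. \<bar>f' x - f x\<bar> * d x \<le> e * (\<bar>1\<bar> * d x) + \<bar>truncate N f x - f x\<bar> * d x"
        using u(4) AE_space
      proof eventually_elim
        case (elim x)
        have "\<bar>f' x - f x\<bar> \<le> e + \<bar>truncate N f x - f x\<bar>" using elim by linarith
        from mult_right_mono[OF this, of "d x"] weight_pos[OF elim(2)]
        show ?case by (simp add: distrib_right)
      qed
    qed
    also have "\<dots> = e * \<mu> + (LINT x|M. \<bar>truncate N f x - f x\<bar> * d x)"
      unfolding \<mu>_def using int_d weighted_integrableD[OF weighted_integrable_diff[OF tw f]] by simp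
    also have "e * \<mu> \<le> (1/2) ^ n / 2"
    proof -
      have "\<mu> / (\<mu> + 1) \<le> 1" using \<mu>0 by simp
      then have "(1/2) ^ n / 2 * (\<mu> / (\<mu> + 1)) \<le> (1/2) ^ n / 2 * 1" by (intro mult_left_mono) auto
      moreover have "e * \<mu> = (1/2) ^ n / 2 * (\<mu> / (\<mu> + 1))" by (simp add: e_def)
      ultimately show ?thesis by simp
    qed
    finally have "(LINT x|M. \<bar>f' x - f x\<bar> * d x) \<le> (1/2) ^ n" using N by simp
    with u f'_w have "approx n u f'" unfolding approx_def by blast
    then show ?thesis by blast
  qed
  then obtain u f' where approx: "\<And>n. approx n (u n) (f' n)" by metis
  then have u: "\<And>n. weighted_integrable (u n)" "\<And>n. weighted_integrable (\<lambda>x. g (u n x))"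
    and f': "\<And>n. weighted_integrable (f' n)" "\<And>n. (LINT x|M. \<bar>f' n x - f x\<bar> * d x) \<le> (1/2) ^ n"
    and eq: "\<And>n. AE x in M. u n x = T (\<lambda>y. f' n y - g (u n y)) x"
    unfolding approx_def by blast+
  have abs0: "0 \<le> (LINT x|M. \<bar>a x\<bar> * d x)" for a :: "'a \<Rightarrow> real"
    by (intro integral_nonneg_AE AE_I2) (simp add: weight_pos less_imp_le)
  have f'_step: "(LINT x|M. \<bar>f' (Suc n) x - f' n x\<bar> * d x) \<le> 2 * (1/2) ^ n" for n
  proof -
    have "(LINT x|M. \<bar>f' (Suc n) x - f' n x\<bar> * d x)
        \<le> (LINT x|M. \<bar>f' (Suc n) x - f x\<bar> * d x + \<bar>f' n x - f x\<bar> * d x)"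
    proof (rule integral_mono)
      show "integrable M (\<lambda>x. \<bar>f' (Suc n) x - f' n x\<bar> * d x)"
        by (intro weighted_integrableD weighted_integrable_diff f')
      show "integrable M (\<lambda>x. \<bar>f' (Suc n) x - f x\<bar> * d x + \<bar>f' n x - f x\<bar> * d x)"
        by (intro Bochner_Integration.integrable_add weighted_integrableD weighted_integrable_diff f' f)
      show "\<bar>f' (Suc n) x - f' n x\<bar> * d x \<le> \<bar>f' (Suc n) x - f x\<bar> * d x + \<bar>f' n x - f x\<bar> * d x"
        if "x \<in> space M" for x
        unfolding distrib_right[symmetric] by (rule mult_right_mono) (use weight_pos[OF that] in auto)
    qed
    also have "\<dots> = (LINT x|M. \<bar>f' (Suc n) x - f x\<bar> * d x) + (LINT x|M. \<bar>f' n x - f x\<bar> * d x)"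
      by (intro Bochner_Integration.integral_add weighted_integrableD weighted_integrable_diff f' f)
    also have "\<dots> \<le> (1/2) ^ Suc n + (1/2) ^ n" by (intro add_mono f')
    also have "\<dots> \<le> 2 * (1/2) ^ n" by simp
    finally show ?thesis .
  qed
  have stab: "(LINT x|M. \<bar>u (Suc n) x - u n x\<bar> * d x) + c * (LINT x|M. \<bar>g (u (Suc n) x) - g (u n x)\<bar> * d x)
      \<le> C * 2 * (1/2) ^ n" for n
  proof -
    have "(LINT x|M. \<bar>u (Suc n) x - u n x\<bar> * d x) + c * (LINT x|M. \<bar>g (u (Suc n) x) - g (u n x)\<bar> * d x)
        \<le> C * (LINT x|M. \<bar>f' (Suc n) x - f' n x\<bar> * d x)"
      by (rule stability[of "f' (Suc n)" "f' n" "u (Suc n)" "u n" g,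
            OF f'(1) f'(1) u(1) u(1) u(2) u(2) eq eq g(1)])
    also have "\<dots> \<le> C * (2 * (1/2) ^ n)" by (rule mult_left_mono[OF f'_step C_nonneg])
    finally show ?thesis by (simp only: mult.assoc)
  qed
  have geo: "summable (\<lambda>n. K * (1/2) ^ n)" for K :: real
    by (intro summable_mult summable_geometric) simp
  have sm_u: "summable (\<lambda>n. LINT x|M. \<bar>u (Suc n) x - u n x\<bar> * d x)"
  proof (rule summable_comparison_test'[OF geo])
    fix n :: nat
    show "norm (LINT x|M. \<bar>u (Suc n) x - u n x\<bar> * d x) \<le> C * 2 * (1/2) ^ n"
      using stab[of n] abs0[of "\<lambda>x. u (Suc n) x - u n x"]
        mult_nonneg_nonneg[OF less_imp_le[OF c_pos] abs0[of "\<lambda>x. g (u (Suc n) x) - g (u n x)"]]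
      by simp
  qed
  have sm_g: "summable (\<lambda>n. LINT x|M. \<bar>g (u (Suc n) x) - g (u n x)\<bar> * d x)"
  proof (rule summable_comparison_test'[OF geo])
    fix n :: nat
    have "c * (LINT x|M. \<bar>g (u (Suc n) x) - g (u n x)\<bar> * d x) \<le> C * 2 * (1/2) ^ n"
      using stab[of n] abs0[of "\<lambda>x. u (Suc n) x - u n x"] by linarith
    then show "norm (LINT x|M. \<bar>g (u (Suc n) x) - g (u n x)\<bar> * d x) \<le> (C * 2 / c) * (1/2) ^ n"
      using c_pos abs0[of "\<lambda>x. g (u (Suc n) x) - g (u n x)"] by (simp add: field_simps)
  qed
  obtain U where U: "weighted_integrable U" "AE x in M. (\<lambda>n. u n x) \<longlonglongrightarrow> U x"
    "(\<lambda>n. LINT x|M. \<bar>u n x - U x\<bar> * d x) \<longlonglongrightarrow> 0"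
    using weighted_limit_of_summable[OF u(1) sm_u] by blast
  obtain W where W: "weighted_integrable W" "AE x in M. (\<lambda>n. g (u n x)) \<longlonglongrightarrow> W x"
    "(\<lambda>n. LINT x|M. \<bar>g (u n x) - W x\<bar> * d x) \<longlonglongrightarrow> 0"
    using weighted_limit_of_summable[OF u(2) sm_g] by blast
  \<comment> \<open>Almost everywhere convergence of both full sequences and continuity of
    \<open>g\<close> identify the second limit.\<close>
  have WU: "AE x in M. W x = g (U x)"
    using U(2) W(2)
  proof eventually_elim
    case (elim x)
    have "(\<lambda>n. g (u n x)) \<longlonglongrightarrow> g (U x)"
      by (rule continuous_on_tendsto_compose[OF g(2) elim(1)]) auto
    with elim(2) show ?case by (rule LIMSEQ_unique)
  qed
  have [measurable]: "g \<in> borel_measurable borel" by (rule borel_measurable_continuous_onI[OF g(2)])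
  note [measurable] = weighted_integrable_measurable[OF U(1)] weighted_integrable_measurable[OF W(1)]
  have gU: "weighted_integrable (\<lambda>x. g (U x))"
    by (rule weighted_integrable_bound[OF W(1)]) (use WU in \<open>auto elim!: eventually_mono\<close>)
  have f_lim: "(\<lambda>n. LINT x|M. \<bar>f' n x - f x\<bar> * d x) \<longlonglongrightarrow> 0"
    by (rule squeeze_zero[OF abs0 f'(2)]) (rule LIMSEQ_power_zero, simp)
  have "(LINT x|M. U x * \<xi> x) + (LINT x|M. g (U x) * T \<xi> x) = (LINT x|M. f x * T \<xi> x)"
    if \<xi>: "\<xi> \<in> borel_measurable M" "\<forall>x\<in>space M. \<bar>\<xi> x\<bar> \<le> K * d x" for \<xi> K
  proof -
    have \<xi>_le: "\<bar>\<xi> x\<bar> \<le> K * d x" if "x \<in> space M" for x using \<xi>(2) that by blast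
    have T\<xi>: "\<bar>T \<xi> x\<bar> \<le> (K * C) * d x" if "x \<in> space M" for x
      using abs_T_bounded[OF schur_weight_weight \<xi>(1) \<xi>_le that] by (simp add: mult.assoc)
    have T\<xi>_meas: "T \<xi> \<in> borel_measurable M" using \<xi>(1) by measurable
    note [measurable] = \<xi>(1) T\<xi>_meas
    have test: "(LINT x|M. u n x * \<xi> x) + (LINT x|M. g (u n x) * T \<xi> x) = (LINT x|M. f' n x * T \<xi> x)" for n
    proof -
      note [measurable] = weighted_integrable_measurable[OF u(1)] weighted_integrable_measurable[OF u(2)]
        weighted_integrable_measurable[OF f'(1)]
      have "(LINT x|M. u n x * \<xi> x) = (LINT x|M. T (\<lambda>y. f' n y - g (u n y)) x * \<xi> x)"
        by (rule integral_cong_AE) (use eq[of n] in \<open>auto elim!: eventually_mono\<close>)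
      then show ?thesis using integral_T_diff_mult[OF f'(1)[of n] u(2)[of n] \<xi>(1) \<xi>_le] by simp
    qed
    have "(\<lambda>n. (LINT x|M. u n x * \<xi> x) + (LINT x|M. g (u n x) * T \<xi> x))
        \<longlonglongrightarrow> (LINT x|M. U x * \<xi> x) + (LINT x|M. W x * T \<xi> x)"
      by (intro tendsto_add weighted_tendsto_integral[OF u(1) U(1) U(3) \<xi>(1) \<xi>_le]
          weighted_tendsto_integral[OF u(2) W(1) W(3) T\<xi>_meas T\<xi>])
    moreover have "(\<lambda>n. LINT x|M. f' n x * T \<xi> x) \<longlonglongrightarrow> (LINT x|M. f x * T \<xi> x)"
      by (rule weighted_tendsto_integral[OF f'(1) f f_lim T\<xi>_meas T\<xi>])
    ultimately have "(LINT x|M. U x * \<xi> x) + (LINT x|M. W x * T \<xi> x) = (LINT x|M. f x * T \<xi> x)"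
      unfolding test by (rule LIMSEQ_unique)
    moreover have "(LINT x|M. W x * T \<xi> x) = (LINT x|M. g (U x) * T \<xi> x)"
      by (rule integral_cong_AE) (use WU in \<open>auto elim!: eventually_mono\<close>)
    ultimately show ?thesis by simp
  qed
  then show ?thesis
    using U(1) gU unfolding weak_solution_def by blast
qed

end

section \<open>Test functions\<close>

lemma has_frechet_derivative:
  "f differentiable_on UNIV \<Longrightarrow> (f has_derivative frechet_derivative f (at x)) (at x)"
  by (simp add: differentiable_on_def frechet_derivative_works)

lemma Ck_SucI:
  assumes "\<And>x. (f has_derivative f' x) (at x)" "\<And>b. b \<in> Basis \<Longrightarrow> Ck k (\<lambda>x. f' x b)"
  shows "Ck (Suc k) f"
proof -
  have "frechet_derivative f (at x) = f' x" for x
    using frechet_derivative_at[OF assms(1)] by simp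
  moreover have "f differentiable_on UNIV"
    using assms(1) by (auto simp: differentiable_on_def differentiable_def)
  ultimately show ?thesis using assms(2) by simp
qed

lemma Ck_pred: "Ck (Suc k) f \<Longrightarrow> Ck k f"
proof (induction k arbitrary: f)
  case 0
  then show ?case by (simp add: differentiable_imp_continuous_on)
qed auto

lemma Ck_const: "Ck k (\<lambda>_. c)"
proof (induction k arbitrary: c)
  case (Suc k)
  show ?case by (rule Ck_SucI[where f'="\<lambda>_ _. 0"]) (auto intro: Suc)
qed simp

lemma Ck_add: "Ck k f \<Longrightarrow> Ck k g \<Longrightarrow> Ck k (\<lambda>x. f x + g x)"
proof (induction k arbitrary: f g)
  case (Suc k)
  show ?case
  proof (rule Ck_SucI)
    show "((\<lambda>x. f x + g x) has_derivative
        (\<lambda>h. frechet_derivative f (at x) h + frechet_derivative g (at x) h)) (at x)" for x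
      using Suc.prems by (intro has_derivative_add has_frechet_derivative) auto
  qed (use Suc in auto)
qed (simp add: continuous_on_add)

lemma Ck_mult: "Ck k f \<Longrightarrow> Ck k g \<Longrightarrow> Ck k (\<lambda>x. f x * g x)"
proof (induction k arbitrary: f g)
  case (Suc k)
  show ?case
  proof (rule Ck_SucI)
    show "((\<lambda>x. f x * g x) has_derivative
        (\<lambda>h. f x * frechet_derivative g (at x) h + frechet_derivative f (at x) h * g x)) (at x)" for x
      using Suc.prems by (intro has_derivative_mult has_frechet_derivative) auto
    show "Ck k (\<lambda>x. f x * frechet_derivative g (at x) b + frechet_derivative f (at x) b * g x)"
      if "b \<in> Basis" for b
      using Suc.prems that Ck_pred[OF Suc.prems(1)] Ck_pred[OF Suc.prems(2)]
      by (intro Ck_add Suc.IH) auto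
  qed
qed (simp add: continuous_on_mult)

text \<open>One induction for both functions: with \<open>r\<close> the square root, the derivatives
  of \<open>r\<close> and of \<open>inverse r\<close> are products of \<open>f\<close>, its
  derivative and \<open>inverse r\<close>, so smoothness of each needs the inverse at the previous
  order.\<close>

lemma Ck_sqrt:
  assumes "Ck k f" and c: "c > 0"
  shows "Ck k (\<lambda>x. sqrt ((f x)\<^sup>2 + c))" "Ck k (\<lambda>x. inverse (sqrt ((f x)\<^sup>2 + c)))"
proof -
  have pos: "(t::real)\<^sup>2 + c > 0" for t using c by (simp add: add_nonneg_pos)
  have "Ck k (\<lambda>x. sqrt ((f x)\<^sup>2 + c)) \<and> Ck k (\<lambda>x. inverse (sqrt ((f x)\<^sup>2 + c)))"
    using assms(1)
  proof (induction k)
    case 0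
    have "sqrt ((f x)\<^sup>2 + c) \<noteq> 0" for x using pos[of "f x"] by simp
    with 0 show ?case by (auto intro!: continuous_intros)
  next
    case (Suc k)
    define r where "r x = sqrt ((f x)\<^sup>2 + c)" for x
    have r0: "r x > 0" for x using pos by (simp add: r_def)
    define D where "D x = frechet_derivative f (at x)" for x
    have Df: "(f has_derivative D x) (at x)" for x
      unfolding D_def using Suc.prems by (intro has_frechet_derivative) simp
    have Dr: "(r has_derivative (\<lambda>h. f x * D x h * inverse (r x))) (at x)" for x
      unfolding r_def
      by (rule derivative_eq_intros Df | use pos[of "f x"] in \<open>simp add: power2_eq_square field_simps\<close>)+
    have Dri: "((\<lambda>x. inverse (r x)) has_derivative
        (\<lambda>h. (- 1) * (inverse (r x) * (f x * D x h * inverse (r x)) * inverse (r x)))) (at x)" for x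
      using Deriv.has_derivative_inverse[OF less_imp_neq[OF r0, symmetric] Dr] by simp
    have k: "Ck k f" "Ck k r" "Ck k (\<lambda>x. inverse (r x))" "\<And>b. b \<in> Basis \<Longrightarrow> Ck k (\<lambda>x. D x b)"
      using Suc Ck_pred[OF Suc.prems] by (auto simp: r_def[abs_def] D_def)
    have "Ck (Suc k) r"
      by (rule Ck_SucI[OF Dr]) (intro Ck_mult k)
    moreover have "Ck (Suc k) (\<lambda>x. inverse (r x))"
      by (rule Ck_SucI[OF Dri]) (intro Ck_mult Ck_const k)
    ultimately show ?case by (simp only: r_def[abs_def])
  qed
  then show "Ck k (\<lambda>x. sqrt ((f x)\<^sup>2 + c))" "Ck k (\<lambda>x. inverse (sqrt ((f x)\<^sup>2 + c)))" by auto
qed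

lemma Cc_inf_Ck: "\<phi> \<in> Cc_inf \<Omega> \<Longrightarrow> Ck k \<phi>"
  by (simp add: Cc_inf_def)

lemma Cc_infI:
  assumes \<phi>: "\<phi> \<in> Cc_inf \<Omega>" and u: "\<And>k. Ck k u" "\<And>x. \<phi> x = 0 \<Longrightarrow> u x = 0"
  shows "u \<in> Cc_inf \<Omega>"
proof -
  have "closure {x. u x \<noteq> 0} \<subseteq> closure {x. \<phi> x \<noteq> 0}" by (rule closure_mono) (use u(2) in auto)
  moreover have "compact (closure {x. \<phi> x \<noteq> 0})" "closure {x. \<phi> x \<noteq> 0} \<subseteq> \<Omega>"
    using \<phi> by (auto simp: Cc_inf_def)
  ultimately have "compact (closure {x. u x \<noteq> 0})" "closure {x. u x \<noteq> 0} \<subseteq> \<Omega>"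
    by (auto simp: compact_eq_bounded_closed intro: bounded_subset)
  with u(1) show ?thesis by (simp add: Cc_inf_def)
qed

lemma Cc_inf_measurable: "\<phi> \<in> Cc_inf \<Omega> \<Longrightarrow> \<phi> \<in> borel_measurable (lebesgue_on S)"
  using Cc_inf_Ck[of \<phi> \<Omega> 0]
  by (intro measurable_restrict_space1 measurable_completion) (auto intro: borel_measurable_continuous_onI)

lemma Cc_inf_bounded:
  assumes "\<phi> \<in> Cc_inf \<Omega>"
  obtains m where "\<And>x. \<bar>\<phi> x\<bar> \<le> m"
proof -
  let ?K = "closure {x. \<phi> x \<noteq> 0}"
  have "continuous_on ?K \<phi>" using Cc_inf_Ck[OF assms, of 0] by (auto intro: continuous_on_subset)
  moreover have "compact ?K" using assms by (simp add: Cc_inf_def)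
  ultimately have "bounded (\<phi> ` ?K)" by (intro compact_imp_bounded compact_continuous_image)
  then obtain m where m: "\<And>x. x \<in> ?K \<Longrightarrow> \<bar>\<phi> x\<bar> \<le> m" by (auto simp: bounded_iff)
  have "\<bar>\<phi> x\<bar> \<le> max m 0" for x
  proof (cases "\<phi> x = 0")
    case False
    then have "x \<in> ?K" using closure_subset[of "{x. \<phi> x \<noteq> 0}"] by blast
    with m show ?thesis by (simp add: max.coboundedI1)
  qed simp
  then show ?thesis by (rule that)
qed

text \<open>The derivative is continuous on the compact support and vanishes off it, so the mean
  value inequality applies with the sum of the bounds on the partial derivatives. This Lipschitz
  bound is what matches the integrability of
  \<open>\<bar>x - y\<bar>\<^sup>2 * J x y\<close>.\<close>

lemma Cc_inf_lipschitz:
  fixes \<phi> :: "'a::euclidean_space \<Rightarrow> real"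
  assumes "\<phi> \<in> Cc_inf \<Omega>"
  obtains L where "\<And>x y. \<bar>\<phi> x - \<phi> y\<bar> \<le> L * norm (x - y)"
proof -
  let ?K = "closure {x. \<phi> x \<noteq> 0}"
  define D where "D x = frechet_derivative \<phi> (at x)" for x
  have C1: "Ck (Suc 0) \<phi>" using assms by (rule Cc_inf_Ck)
  then have D: "(\<phi> has_derivative D x) (at x)" for x
    unfolding D_def by (intro has_frechet_derivative) simp
  have K: "compact ?K" using assms by (simp add: Cc_inf_def)
  have D0: "D x b = 0" if "x \<notin> ?K" for x b
  proof -
    have "(\<phi> has_derivative (\<lambda>_. 0)) (at x)"
    proof (rule has_derivative_transform_within_open)
      show "((\<lambda>_. 0) has_derivative (\<lambda>_. 0)) (at x)" by simp
      show "open (- ?K)" "x \<in> - ?K" using that by auto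
      show "0 = \<phi> y" if "y \<in> - ?K" for y using that closure_subset[of "{x. \<phi> x \<noteq> 0}"] by auto
    qed
    with D[of x] have "D x = (\<lambda>_. 0)" by (rule has_derivative_unique)
    then show ?thesis by simp
  qed
  have "\<exists>m. \<forall>x. \<bar>D x b\<bar> \<le> m" if b: "b \<in> Basis" for b
  proof -
    have "continuous_on ?K (\<lambda>x. D x b)"
      using C1 b by (auto simp: D_def intro: continuous_on_subset)
    then have "bounded ((\<lambda>x. D x b) ` ?K)"
      using K by (intro compact_imp_bounded compact_continuous_image)
    then obtain m where "\<And>x. x \<in> ?K \<Longrightarrow> \<bar>D x b\<bar> \<le> m" by (auto simp: bounded_iff)
    with D0[of _ b] have "\<bar>D x b\<bar> \<le> max m 0" for x by (cases "x \<in> ?K") (auto simp: max.coboundedI1)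
    then show ?thesis by blast
  qed
  then obtain m where m: "\<And>x b. b \<in> Basis \<Longrightarrow> \<bar>D x b\<bar> \<le> m b" by metis
  define L where "L = (\<Sum>b\<in>(Basis::'a set). m b)"
  have onD: "onorm (D x) \<le> L" for x
  proof (rule onorm_le)
    fix h :: 'a
    have lin: "linear (D x)" using D by (rule has_derivative_linear)
    have "D x h = D x (\<Sum>b\<in>Basis. (h \<bullet> b) *\<^sub>R b)" by (simp add: euclidean_representation)
    also have "\<dots> = (\<Sum>b\<in>Basis. (h \<bullet> b) * D x b)"
      using lin by (simp add: linear_sum linear_scale)
    also have "norm \<dots> \<le> (\<Sum>b\<in>Basis. norm ((h \<bullet> b) * D x b))" by (rule norm_sum)
    also have "\<dots> \<le> (\<Sum>b\<in>Basis. norm h * m b)"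
    proof (rule sum_mono)
      fix b :: 'a assume b: "b \<in> Basis"
      have "norm ((h \<bullet> b) * D x b) = \<bar>h \<bullet> b\<bar> * \<bar>D x b\<bar>" by (simp add: abs_mult)
      also have "\<dots> \<le> norm h * m b"
        by (rule mult_mono[OF Basis_le_norm[OF b] m[OF b]]) auto
      finally show "norm ((h \<bullet> b) * D x b) \<le> norm h * m b" .
    qed
    also have "\<dots> = L * norm h" by (simp add: L_def sum_distrib_left mult.commute)
    finally show "norm (D x h) \<le> L * norm h" .
  qed
  have "norm (\<phi> x - \<phi> y) \<le> L * norm (x - y)" for x y
    by (rule differentiable_bound[of UNIV \<phi> D]) (use D onD in auto)
  then show ?thesis by (intro that) simp
qed

section \<open>Smooth substitutes for the negative part and for the indicator of the positive
  half-line\<close>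

lemma sqrt_sum_lipschitz: "\<bar>sqrt (s\<^sup>2 + a\<^sup>2) - sqrt (t\<^sup>2 + a\<^sup>2)\<bar> \<le> \<bar>s - t\<bar>" for s t a :: real
  \<comment> \<open>The square roots are the moduli of two complex numbers with the same imaginary
    part \<open>a\<close>, so this is the reverse triangle inequality.\<close>
  using norm_triangle_ineq3[of "Complex s a" "Complex t a"] by (simp add: cmod_def)

text \<open>\<open>min t 0 = (t - \<bar>t\<bar>) / 2\<close> with the absolute value smoothed. The
  summand \<open>a\<close> makes the value at 0 vanish, so that composition preserves compact
  support.\<close>

definition smooth_neg :: "real \<Rightarrow> real \<Rightarrow> real" where
  "smooth_neg a t = (t - sqrt (t\<^sup>2 + a\<^sup>2) + a) / 2"

lemma smooth_neg_0: "a > 0 \<Longrightarrow> smooth_neg a 0 = 0"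
  by (simp add: smooth_neg_def)

lemma smooth_neg_mono: "s \<le> t \<Longrightarrow> smooth_neg a s \<le> smooth_neg a t"
  using sqrt_sum_lipschitz[of s a t] by (simp add: smooth_neg_def)

lemma smooth_neg_lipschitz: "\<bar>smooth_neg a s - smooth_neg a t\<bar> \<le> \<bar>s - t\<bar>"
proof -
  have "smooth_neg a s - smooth_neg a t = ((s - t) - (sqrt (s\<^sup>2 + a\<^sup>2) - sqrt (t\<^sup>2 + a\<^sup>2))) / 2"
    by (simp add: smooth_neg_def field_simps)
  moreover have "\<bar>(A - B) / 2\<bar> \<le> \<bar>A\<bar>" if "\<bar>B\<bar> \<le> \<bar>A\<bar>" for A B :: real
    using that by (auto simp: abs_if split: if_splits)
  ultimately show ?thesis using sqrt_sum_lipschitz[of s a t] by simp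
qed

lemma smooth_neg_approx:
  assumes "a > 0"
  shows "\<bar>smooth_neg a t - min t 0\<bar> \<le> a / 2"
proof -
  have "\<bar>t\<bar> \<le> sqrt (t\<^sup>2 + a\<^sup>2)" by (rule real_le_rsqrt) simp
  moreover have "sqrt (t\<^sup>2 + a\<^sup>2) \<le> \<bar>t\<bar> + a"
    using sqrt_sum_squares_le_sum_abs[of t a] assms by simp
  moreover have "smooth_neg a t - min t 0 = (\<bar>t\<bar> + a - sqrt (t\<^sup>2 + a\<^sup>2)) / 2"
    by (simp add: smooth_neg_def min_def field_simps)
  ultimately show ?thesis by simp
qed

lemma Cc_inf_smooth_neg:
  assumes "\<phi> \<in> Cc_inf \<Omega>" "a > 0"
  shows "(\<lambda>x. smooth_neg a (\<phi> x)) \<in> Cc_inf \<Omega>"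
proof (rule Cc_infI[OF assms(1)])
  have eq: "(\<lambda>x. smooth_neg a (\<phi> x)) = (\<lambda>x. (1/2) * (\<phi> x + ((- 1) * sqrt ((\<phi> x)\<^sup>2 + a\<^sup>2) + a)))"
    by (auto simp: smooth_neg_def fun_eq_iff field_simps)
  show "Ck k (\<lambda>x. smooth_neg a (\<phi> x))" for k
    unfolding eq using assms by (intro Ck_mult Ck_add Ck_const Ck_sqrt Cc_inf_Ck) auto
qed (simp add: smooth_neg_0 assms)

text \<open>Since \<open>q = t / sqrt (t\<^sup>2 + a\<^sup>2)\<close> tends to the sign of \<open>t\<close> as \<open>a \<rightarrow> 0\<close>, \<open>(q + q\<^sup>2) / 2\<close> tends to the
  indicator function of \<open>t > 0\<close>.\<close>

definition smooth_step :: "real \<Rightarrow> real \<Rightarrow> real" where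
  "smooth_step a t = (t * inverse (sqrt (t\<^sup>2 + a\<^sup>2)) + (t * inverse (sqrt (t\<^sup>2 + a\<^sup>2)))\<^sup>2) / 2"

lemma abs_smooth_sign_le: "\<bar>t * inverse (sqrt (t\<^sup>2 + a\<^sup>2))\<bar> \<le> 1"
proof -
  have "\<bar>t\<bar> \<le> sqrt (t\<^sup>2 + a\<^sup>2)" by (rule real_le_rsqrt) simp
  then have "\<bar>t\<bar> * inverse (sqrt (t\<^sup>2 + a\<^sup>2)) \<le> sqrt (t\<^sup>2 + a\<^sup>2) * inverse (sqrt (t\<^sup>2 + a\<^sup>2))"
    by (rule mult_right_mono) simp
  also have "\<dots> \<le> 1" by (cases "sqrt (t\<^sup>2 + a\<^sup>2) = 0") auto
  finally show ?thesis by (simp add: abs_mult)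
qed

lemma abs_smooth_step_le: "\<bar>smooth_step a t\<bar> \<le> 1"
proof -
  have "\<bar>(q + q\<^sup>2) / 2\<bar> \<le> 1" if "\<bar>q\<bar> \<le> 1" for q :: real
  proof -
    have "\<bar>(a + b) / 2\<bar> \<le> 1" if "\<bar>a\<bar> \<le> 1" "\<bar>b\<bar> \<le> 1" for a b :: real
      using that by (auto simp: abs_le_iff)
    then show ?thesis using that by (simp add: abs_square_le_1)
  qed
  from this[OF abs_smooth_sign_le] show ?thesis by (simp only: smooth_step_def)
qed

text \<open>The smoothed sign \<open>q\<close> is Lipschitz with constant \<open>2 / a\<close>, and
  \<open>q + q\<^sup>2\<close> has the difference quotient \<open>1 + q s + q t\<close>, at most 3
  in absolute value; half the product is \<open>3 / a\<close>.\<close>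

lemma smooth_step_lipschitz:
  assumes a: "a > 0"
  shows "\<bar>smooth_step a s - smooth_step a t\<bar> \<le> 3 / a * \<bar>s - t\<bar>"
proof -
  define R where "R t = sqrt (t\<^sup>2 + a\<^sup>2)" for t
  define q where "q t = t * inverse (R t)" for t
  have Ra: "a \<le> R t" for t unfolding R_def by (rule real_le_rsqrt) simp
  have R0: "R t > 0" for t using Ra[of t] a by simp
  have q1: "\<bar>q t\<bar> \<le> 1" for t using abs_smooth_sign_le by (simp add: q_def R_def)
  have lip: "\<bar>q s - q t\<bar> \<le> 2 / a * \<bar>s - t\<bar>"
  proof -
    have "q s - q t = (q s * (R t - R s) + (s - t)) / R t"
      using R0[of s] R0[of t] by (simp add: q_def field_simps)
    also have "\<bar>\<dots>\<bar> \<le> (2 * \<bar>s - t\<bar>) / R t"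
    proof -
      have "\<bar>q s * (R t - R s)\<bar> \<le> 1 * \<bar>s - t\<bar>"
        unfolding abs_mult using sqrt_sum_lipschitz[of t a s]
        by (intro mult_mono q1) (auto simp: R_def abs_minus_commute)
      then have "\<bar>q s * (R t - R s) + (s - t)\<bar> \<le> 1 * \<bar>s - t\<bar> + \<bar>s - t\<bar>"
        by (intro order_trans[OF abs_triangle_ineq] add_right_mono)
      then have "\<bar>q s * (R t - R s) + (s - t)\<bar> \<le> 2 * \<bar>s - t\<bar>" by (simp only: mult_2 mult_1)
      then show ?thesis using R0[of t] by (simp add: divide_right_mono)
    qed
    also have "\<dots> \<le> (2 * \<bar>s - t\<bar>) / a" using Ra[of t] a by (intro divide_left_mono) auto
    finally show ?thesis by simp
  qed
  have step: "smooth_step a t = (q t + (q t)\<^sup>2) / 2" for t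
    by (simp add: smooth_step_def q_def R_def)
  have "smooth_step a s - smooth_step a t = (q s - q t) * (1 + q s + q t) / 2"
    unfolding step by (simp add: power2_eq_square field_simps)
  also have "\<bar>\<dots>\<bar> = \<bar>q s - q t\<bar> * (\<bar>1 + q s + q t\<bar> / 2)" by (simp add: abs_mult)
  also have "\<dots> \<le> (2 / a * \<bar>s - t\<bar>) * (3 / 2)"
    using q1[of s] q1[of t] a by (intro mult_mono lip) auto
  finally show ?thesis by simp
qed

lemma smooth_step_tendsto:
  "(\<lambda>n. smooth_step (inverse (real (Suc n))) t) \<longlonglongrightarrow> (if 0 < t then 1 else 0)"
proof -
  have "(\<lambda>n. sqrt (t\<^sup>2 + (inverse (real (Suc n)))\<^sup>2)) \<longlonglongrightarrow> sqrt (t\<^sup>2 + 0\<^sup>2)"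
    by (intro tendsto_intros LIMSEQ_inverse_real_of_nat)
  then have R: "(\<lambda>n. sqrt (t\<^sup>2 + (inverse (real (Suc n)))\<^sup>2)) \<longlonglongrightarrow> \<bar>t\<bar>" by simp
  show ?thesis
  proof (cases "t = 0")
    case True
    then show ?thesis by (simp add: smooth_step_def)
  next
    case False
    then have "(\<lambda>n. smooth_step (inverse (real (Suc n))) t)
        \<longlonglongrightarrow> (t * inverse \<bar>t\<bar> + (t * inverse \<bar>t\<bar>)\<^sup>2) / 2"
      unfolding smooth_step_def by (intro tendsto_intros R) auto
    with False show ?thesis by (auto simp: abs_if split: if_splits)
  qed
qed

lemma Cc_inf_smooth_step_mult:
  assumes "\<phi> \<in> Cc_inf \<Omega>" "\<psi> \<in> Cc_inf \<Omega>" "a > 0"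
  shows "(\<lambda>x. smooth_step a (\<phi> x) * \<psi> x) \<in> Cc_inf \<Omega>"
proof (rule Cc_infI[OF assms(2)])
  have eq: "(\<lambda>x. smooth_step a (\<phi> x) * \<psi> x) = (\<lambda>x. ((1/2) * (\<phi> x * inverse (sqrt ((\<phi> x)\<^sup>2 + a\<^sup>2))
      + (\<phi> x * inverse (sqrt ((\<phi> x)\<^sup>2 + a\<^sup>2))) * (\<phi> x * inverse (sqrt ((\<phi> x)\<^sup>2 + a\<^sup>2))))) * \<psi> x)"
    by (simp add: smooth_step_def power2_eq_square)
  show "Ck k (\<lambda>x. smooth_step a (\<phi> x) * \<psi> x)" for k
    unfolding eq using assms by (intro Ck_mult Ck_add Ck_const Ck_sqrt Cc_inf_Ck) auto
qed simp

section \<open>The quadratic form\<close>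

text \<open>A Borel map pulls Lebesgue sets back to Lebesgue sets only if it pulls null sets back to
  null sets. This is needed to compose a merely Lebesgue measurable function with the two
  projections.\<close>

lemma measurable_lebesgue_lebesgueI:
  fixes f :: "'a::euclidean_space \<Rightarrow> 'b::euclidean_space"
  assumes f: "f \<in> borel_measurable borel"
    and null: "\<And>N. N \<in> sets borel \<Longrightarrow> emeasure lborel N = 0 \<Longrightarrow> emeasure lborel (f -` N) = 0"
  shows "f \<in> lebesgue \<rightarrow>\<^sub>M lebesgue"
proof (rule complete_measure.measurable_completion2[OF completion.complete_measure_axioms])
  show f_meas: "f \<in> lebesgue \<rightarrow>\<^sub>M lborel"
    using f by (intro measurable_completion) simp
  show "null_sets lborel \<subseteq> null_sets (distr lebesgue lborel f)"
  proof
    fix N :: "'b set" assume "N \<in> null_sets lborel"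
    then have N: "N \<in> sets borel" "emeasure lborel N = 0" by (auto simp: null_sets_def)
    have "f -` N \<in> sets borel" using measurable_sets[OF f N(1)] by simp
    then have "emeasure (distr lebesgue lborel f) N = emeasure lborel (f -` N)"
      using N(1) f_meas by (subst emeasure_distr) (auto simp: emeasure_completion)
    with null[OF N] N(1) show "N \<in> null_sets (distr lebesgue lborel f)"
      by (simp add: null_sets_def)
  qed
qed

lemma emeasure_lborel_Times:
  fixes A :: "'a::euclidean_space set" and B :: "'b::euclidean_space set"
  assumes "A \<in> sets borel" "B \<in> sets borel"
  shows "emeasure lborel (A \<times> B) = emeasure lborel A * emeasure lborel B"
  unfolding lborel_prod[symmetric] using assms by (intro lborel.emeasure_pair_measure_Times) auto

lemma fst_measurable_lebesgue:
  "fst \<in> (lebesgue :: ('a::euclidean_space \<times> 'b::euclidean_space) measure) \<rightarrow>\<^sub>M lebesgue"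
proof (rule measurable_lebesgue_lebesgueI)
  fix N :: "'a set" assume "N \<in> sets borel" "emeasure lborel N = 0"
  moreover have "fst -` N = N \<times> (UNIV :: 'b set)" by auto
  ultimately show "emeasure lborel (fst -` N :: ('a \<times> 'b) set) = 0" by (simp add: emeasure_lborel_Times)
qed (intro borel_measurable_continuous_onI continuous_intros)

lemma snd_measurable_lebesgue:
  "snd \<in> (lebesgue :: ('a::euclidean_space \<times> 'b::euclidean_space) measure) \<rightarrow>\<^sub>M lebesgue"
proof (rule measurable_lebesgue_lebesgueI)
  fix N :: "'b set" assume "N \<in> sets borel" "emeasure lborel N = 0"
  moreover have "snd -` N = (UNIV :: 'a set) \<times> N" by auto
  ultimately show "emeasure lborel (snd -` N :: ('a \<times> 'b) set) = 0" by (simp add: emeasure_lborel_Times)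
qed (intro borel_measurable_continuous_onI continuous_intros)

lemma L2_iff_square_integrable: "u \<in> L2 \<Omega> \<longleftrightarrow> square_integrable (lebesgue_on \<Omega>) u"
  by (simp add: L2_def square_integrable_def)

locale jump_form =
  fixes \<Omega> :: "'a::euclidean_space set" and J :: "'a \<Rightarrow> 'a \<Rightarrow> real" and B :: "'a \<Rightarrow> real"
  assumes open_domain: "open \<Omega>" and bounded_domain: "bounded \<Omega>"
    and cond_L1: "cond_L1 \<Omega> J B"
begin

abbreviation M :: "'a measure" where "M \<equiv> lebesgue_on \<Omega>"
abbreviation P :: "('a \<times> 'a) measure" where "P \<equiv> lebesgue_on (\<Omega> \<times> \<Omega>)"

lemma domain_sets: "\<Omega> \<in> sets lebesgue" "\<Omega> \<times> \<Omega> \<in> sets lebesgue"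
  using open_domain by (auto intro!: borel_open open_Times)

sublocale finite_measure M
  by (intro finite_measure_lebesgue_on bounded_set_imp_lmeasurable bounded_domain domain_sets)

lemma space_M: "space M = \<Omega>" and space_P: "space P = \<Omega> \<times> \<Omega>"
  by (simp_all add: space_restrict_space)

lemma fst_measurable_P [measurable]: "fst \<in> P \<rightarrow>\<^sub>M M"
  by (intro measurable_restrict_space3 fst_measurable_lebesgue) auto

lemma snd_measurable_P [measurable]: "snd \<in> P \<rightarrow>\<^sub>M M"
  by (intro measurable_restrict_space3 snd_measurable_lebesgue) auto

lemma J_measurable [measurable]: "(\<lambda>z. J (fst z) (snd z)) \<in> borel_measurable P"
  using cond_L1 by (simp add: cond_L1_def split_beta')

lemma B_measurable [measurable]: "B \<in> borel_measurable M"
  using cond_L1 by (simp add: cond_L1_def)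

lemma J_nonneg: "x \<in> \<Omega> \<Longrightarrow> y \<in> \<Omega> \<Longrightarrow> x \<noteq> y \<Longrightarrow> 0 \<le> J x y"
  using cond_L1 by (auto simp: cond_L1_def offdiag_def)

lemma B_nonneg: "x \<in> \<Omega> \<Longrightarrow> 0 \<le> B x"
  using cond_L1 by (simp add: cond_L1_def)

text \<open>Square roots of the two parts of the integrand, so that \<open>form\<close> is a sum of two \<open>L\<^sup>2\<close> inner
  products. Negative values of \<open>J\<close> on the diagonal do not matter, since there the difference
  vanishes.\<close>

definition jump :: "('a \<Rightarrow> real) \<Rightarrow> 'a \<times> 'a \<Rightarrow> real" where
  "jump u z = sqrt \<bar>J (fst z) (snd z)\<bar> * (u (fst z) - u (snd z))"

definition kill :: "('a \<Rightarrow> real) \<Rightarrow> 'a \<Rightarrow> real" where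
  "kill u x = sqrt \<bar>B x\<bar> * u x"

lemma jump_measurable [measurable (raw)]:
  assumes [measurable]: "u \<in> borel_measurable M"
  shows "jump u \<in> borel_measurable P"
proof -
  have [measurable]: "(\<lambda>z. u (fst z)) \<in> borel_measurable P" "(\<lambda>z. u (snd z)) \<in> borel_measurable P"
    by (rule measurable_compose[OF fst_measurable_P assms] measurable_compose[OF snd_measurable_P assms])+
  show ?thesis unfolding jump_def by measurable
qed

lemma kill_measurable [measurable (raw)]: "u \<in> borel_measurable M \<Longrightarrow> kill u \<in> borel_measurable M"
  unfolding kill_def by measurable

lemma jump_mult:
  assumes "z \<in> space P"
  shows "jump u z * jump v z = J (fst z) (snd z) * (u (fst z) - u (snd z)) * (v (fst z) - v (snd z))"
proof (cases "fst z = snd z")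
  case False
  with assms have "0 \<le> J (fst z) (snd z)" by (intro J_nonneg) (auto simp: space_P)
  then have "sqrt \<bar>J (fst z) (snd z)\<bar> * sqrt \<bar>J (fst z) (snd z)\<bar> = J (fst z) (snd z)" by simp
  moreover have "jump u z * jump v z = (sqrt \<bar>J (fst z) (snd z)\<bar> * sqrt \<bar>J (fst z) (snd z)\<bar>)
      * (u (fst z) - u (snd z)) * (v (fst z) - v (snd z))"
    by (simp only: jump_def mult_ac)
  ultimately show ?thesis by simp
qed (simp add: jump_def)

lemma kill_mult:
  assumes "x \<in> space M"
  shows "kill u x * kill v x = B x * u x * v x"
proof -
  have "0 \<le> B x" using assms by (intro B_nonneg) (simp add: space_M)
  then have "sqrt \<bar>B x\<bar> * sqrt \<bar>B x\<bar> = B x" by simp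
  moreover have "kill u x * kill v x = (sqrt \<bar>B x\<bar> * sqrt \<bar>B x\<bar>) * u x * v x"
    by (simp only: kill_def mult_ac)
  ultimately show ?thesis by simp
qed

lemma form_eq: "form \<Omega> J B u v = 1/2 * (LINT z|P. jump u z * jump v z) + (LINT x|M. kill u x * kill v x)"
proof -
  have "(LINT z|P. (case z of (x, y) \<Rightarrow> J x y * (u x - u y) * (v x - v y))) = (LINT z|P. jump u z * jump v z)"
    by (rule Bochner_Integration.integral_cong) (auto simp: jump_mult split_beta')
  moreover have "(LINT x|M. B x * u x * v x) = (LINT x|M. kill u x * kill v x)"
    by (rule Bochner_Integration.integral_cong) (auto simp: kill_mult)
  ultimately show ?thesis by (simp add: form_def)
qed

lemma form_dom_iff:
  "u \<in> form_dom \<Omega> J B \<longleftrightarrow> square_integrable M u \<and> square_integrable P (jump u) \<and> square_integrable M (kill u)"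
proof -
  have "integrable P (\<lambda>(x, y). J x y * (u x - u y)\<^sup>2) \<longleftrightarrow> integrable P (\<lambda>z. (jump u z)\<^sup>2)"
    by (rule Bochner_Integration.integrable_cong)
       (auto simp: power2_eq_square jump_mult split_beta' mult.assoc)
  moreover have "integrable M (\<lambda>x. B x * (u x)\<^sup>2) \<longleftrightarrow> integrable M (\<lambda>x. (kill u x)\<^sup>2)"
    by (rule Bochner_Integration.integrable_cong) (auto simp: power2_eq_square kill_mult mult.assoc)
  ultimately show ?thesis
    by (auto simp: form_dom_def L2_iff_square_integrable square_integrable_def)
qed

lemma jump_diff: "jump (\<lambda>x. u x - v x) = (\<lambda>z. jump u z - jump v z)"
  by (simp add: jump_def fun_eq_iff algebra_simps)

lemma kill_diff: "kill (\<lambda>x. u x - v x) = (\<lambda>x. kill u x - kill v x)"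
  by (simp add: kill_def fun_eq_iff algebra_simps)

lemma form_dom_diff:
  "u \<in> form_dom \<Omega> J B \<Longrightarrow> v \<in> form_dom \<Omega> J B \<Longrightarrow> (\<lambda>x. u x - v x) \<in> form_dom \<Omega> J B"
  by (simp add: form_dom_iff jump_diff kill_diff square_integrable_diff)

lemma form_diff_left:
  assumes "u \<in> form_dom \<Omega> J B" "v \<in> form_dom \<Omega> J B" "w \<in> form_dom \<Omega> J B"
  shows "form \<Omega> J B (\<lambda>x. u x - v x) w = form \<Omega> J B u w - form \<Omega> J B v w"
  using assms by (simp add: form_eq form_dom_iff jump_diff kill_diff left_diff_distrib square_integrable_mult)

lemma form_nonneg: "0 \<le> form \<Omega> J B u u"
  by (simp add: form_eq)

lemma form_Cauchy_Schwarz: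
  assumes u: "u \<in> form_dom \<Omega> J B" and v: "v \<in> form_dom \<Omega> J B"
  shows "(form \<Omega> J B u v)\<^sup>2 \<le> form \<Omega> J B u u * form \<Omega> J B v v"
proof (rule discriminant_nonpos)
  fix t
  have *: "(LINT z|N. (a z + t * b z)\<^sup>2)
      = (LINT z|N. a z * a z) + 2 * t * (LINT z|N. a z * b z) + t\<^sup>2 * (LINT z|N. b z * b z)"
    if "square_integrable N a" "square_integrable N b" for N :: "'c measure" and a b
  proof -
    have "(LINT z|N. (a z + t * b z)\<^sup>2)
        = (LINT z|N. a z * a z + 2 * t * (a z * b z) + t\<^sup>2 * (b z * b z))"
      by (rule Bochner_Integration.integral_cong) (auto simp: power2_eq_square algebra_simps)
    also have "\<dots> = (LINT z|N. a z * a z) + 2 * t * (LINT z|N. a z * b z) + t\<^sup>2 * (LINT z|N. b z * b z)"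
      using that by (simp add: square_integrable_mult)
    finally show ?thesis .
  qed
  have "0 \<le> 1/2 * (LINT z|P. (jump u z + t * jump v z)\<^sup>2) + (LINT x|M. (kill u x + t * kill v x)\<^sup>2)"
    by simp
  also have "\<dots> = form \<Omega> J B u u + 2 * t * form \<Omega> J B u v + t\<^sup>2 * form \<Omega> J B v v"
    using u v by (simp add: * form_dom_iff form_eq algebra_simps)
  finally show "0 \<le> form \<Omega> J B u u + 2 * t * form \<Omega> J B u v + t\<^sup>2 * form \<Omega> J B v v" .
qed

section \<open>Test functions in the form domain and its closure\<close>

lemma Cc_inf_square_integrable:
  assumes "\<phi> \<in> Cc_inf \<Omega>"
  shows "square_integrable M \<phi>"
proof -
  obtain m where "\<And>x. \<bar>\<phi> x\<bar> \<le> m" using Cc_inf_bounded[OF assms] by blast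
  then show ?thesis by (intro square_integrable_const_bound Cc_inf_measurable[OF assms])
qed

text \<open>The Lipschitz bound pairs with the second moment condition on \<open>J\<close> for the
  jump part; for the potential, \<open>B\<close> is bounded on the compact support.\<close>

lemma Cc_inf_form_dom:
  assumes \<phi>: "\<phi> \<in> Cc_inf \<Omega>"
  shows "\<phi> \<in> form_dom \<Omega> J B"
  unfolding form_dom_iff
proof (intro conjI)
  note [measurable] = Cc_inf_measurable[OF \<phi>, of \<Omega>]
  show "square_integrable M \<phi>" by (rule Cc_inf_square_integrable[OF \<phi>])
  obtain L where L: "\<And>x y. \<bar>\<phi> x - \<phi> y\<bar> \<le> L * norm (x - y)" using Cc_inf_lipschitz[OF \<phi>] by blast
  show "square_integrable P (jump \<phi>)"
  proof (rule square_integrableI)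
    show "integrable P (\<lambda>z. (jump \<phi> z)\<^sup>2)"
    proof (rule Bochner_Integration.integrable_bound)
      have "integrable P (\<lambda>(x, y). (norm (x - y))\<^sup>2 * J x y)" using cond_L1 by (simp add: cond_L1_def)
      then show "integrable P (\<lambda>z. L\<^sup>2 * (case z of (x, y) \<Rightarrow> (norm (x - y))\<^sup>2 * J x y))"
        by (rule integrable_mult_right)
      show "AE z in P. norm ((jump \<phi> z)\<^sup>2) \<le> norm (L\<^sup>2 * (case z of (x, y) \<Rightarrow> (norm (x - y))\<^sup>2 * J x y))"
      proof (rule AE_I2)
        fix z
        have "(\<phi> (fst z) - \<phi> (snd z))\<^sup>2 \<le> (L * norm (fst z - snd z))\<^sup>2"
          using L[of "fst z" "snd z"] by (metis abs_ge_zero power2_abs power_mono)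
        then have "\<bar>J (fst z) (snd z)\<bar> * (\<phi> (fst z) - \<phi> (snd z))\<^sup>2
            \<le> \<bar>J (fst z) (snd z)\<bar> * (L * norm (fst z - snd z))\<^sup>2"
          by (rule mult_left_mono) simp
        then show "norm ((jump \<phi> z)\<^sup>2) \<le> norm (L\<^sup>2 * (case z of (x, y) \<Rightarrow> (norm (x - y))\<^sup>2 * J x y))"
          by (simp add: jump_def power_mult_distrib abs_mult split_beta' mult_ac)
      qed
    qed measurable
  qed measurable
  let ?K = "closure {x. \<phi> x \<noteq> 0}"
  obtain m where m: "\<And>x. \<bar>\<phi> x\<bar> \<le> m" using Cc_inf_bounded[OF \<phi>] by blast
  have "compact ?K" "?K \<subseteq> \<Omega>" using \<phi> by (auto simp: Cc_inf_def)
  then have "bounded (B ` ?K)" using cond_L1 by (simp add: cond_L1_def)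
  then obtain b where b: "\<And>x. x \<in> ?K \<Longrightarrow> \<bar>B x\<bar> \<le> b" by (auto simp: bounded_iff)
  show "square_integrable M (kill \<phi>)"
  proof (rule square_integrable_const_bound)
    fix x
    show "\<bar>kill \<phi> x\<bar> \<le> sqrt \<bar>b\<bar> * m"
    proof (cases "\<phi> x = 0")
      case True
      then show ?thesis using m[of x] by (simp add: kill_def)
    next
      case False
      then have "x \<in> ?K" using closure_subset[of "{x. \<phi> x \<noteq> 0}"] by blast
      from b[OF this] have "sqrt \<bar>B x\<bar> \<le> sqrt \<bar>b\<bar>" by simp
      then show ?thesis unfolding kill_def abs_mult by (intro mult_mono m) auto
    qed
  qed measurable
qed

lemma Cc_inf_HH: "\<phi> \<in> Cc_inf \<Omega> \<Longrightarrow> \<phi> \<in> HH \<Omega> J B"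
  unfolding HH_def
  by (auto intro!: Cc_inf_form_dom bexI[of _ \<phi>] simp: form_eq jump_def kill_def)

lemma HH_form_dom: "u \<in> HH \<Omega> J B \<Longrightarrow> u \<in> form_dom \<Omega> J B"
  by (simp add: HH_def)

lemma HH_square_integrable: "u \<in> HH \<Omega> J B \<Longrightarrow> square_integrable M u"
  by (simp add: HH_def form_dom_iff)

lemma HH_approx:
  assumes "u \<in> HH \<Omega> J B" "\<epsilon> > 0"
  obtains \<phi> where "\<phi> \<in> Cc_inf \<Omega>" "(LINT x|M. (u x - \<phi> x)\<^sup>2) \<le> \<epsilon>\<^sup>2"
    "form \<Omega> J B (\<lambda>x. u x - \<phi> x) (\<lambda>x. u x - \<phi> x) \<le> \<epsilon>\<^sup>2"
proof -
  obtain \<phi> where \<phi>: "\<phi> \<in> Cc_inf \<Omega>"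
    "(LINT x|M. (u x - \<phi> x)\<^sup>2) + form \<Omega> J B (\<lambda>x. u x - \<phi> x) (\<lambda>x. u x - \<phi> x) < \<epsilon>\<^sup>2"
    using assms unfolding HH_def by blast
  moreover have "0 \<le> (LINT x|M. (u x - \<phi> x)\<^sup>2)" by simp
  ultimately show ?thesis using form_nonneg[of "\<lambda>x. u x - \<phi> x"] by (intro that[of \<phi>]) linarith+
qed

text \<open>The Markov property holds integrand by integrand: monotonicity of \<open>p\<close> gives
  \<open>(s - t) * (p s - p t) \<ge> 0\<close>, and the Lipschitz bound with constant 1 makes the
  increments of \<open>p (\<phi>)\<close> no larger than those of \<open>\<phi>\<close>.\<close>

lemma form_normal_contraction:
  assumes \<phi>: "\<phi> \<in> form_dom \<Omega> J B" and p\<phi>: "(\<lambda>x. p (\<phi> x)) \<in> form_dom \<Omega> J B"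
    and p: "\<And>s t. s \<le> t \<Longrightarrow> p s \<le> p t" "\<And>s t. \<bar>p s - p t\<bar> \<le> \<bar>s - t\<bar>" "p 0 = 0"
  shows "0 \<le> form \<Omega> J B \<phi> (\<lambda>x. p (\<phi> x))"
    and "form \<Omega> J B (\<lambda>x. p (\<phi> x)) (\<lambda>x. p (\<phi> x)) \<le> form \<Omega> J B \<phi> \<phi>"
proof -
  have mono: "0 \<le> (s - t) * (p s - p t)" for s t
    using p(1)[of s t] p(1)[of t s] by (cases "s \<le> t") (auto intro: mult_nonneg_nonneg mult_nonpos_nonpos)
  have "0 \<le> jump \<phi> z * jump (\<lambda>x. p (\<phi> x)) z" for z
  proof -
    have "jump \<phi> z * jump (\<lambda>x. p (\<phi> x)) z = (sqrt \<bar>J (fst z) (snd z)\<bar>)\<^sup>2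
        * ((\<phi> (fst z) - \<phi> (snd z)) * (p (\<phi> (fst z)) - p (\<phi> (snd z))))"
      by (simp only: jump_def power2_eq_square mult_ac)
    then show ?thesis using mono by simp
  qed
  moreover have "0 \<le> kill \<phi> x * kill (\<lambda>x. p (\<phi> x)) x" for x
  proof -
    have "kill \<phi> x * kill (\<lambda>x. p (\<phi> x)) x = (sqrt \<bar>B x\<bar>)\<^sup>2 * (\<phi> x * p (\<phi> x))"
      by (simp only: kill_def power2_eq_square mult_ac)
    then show ?thesis using mono[of "\<phi> x" 0] p(3) by simp
  qed
  ultimately show "0 \<le> form \<Omega> J B \<phi> (\<lambda>x. p (\<phi> x))"
    unfolding form_eq by (intro add_nonneg_nonneg mult_nonneg_nonneg integral_nonneg_AE) auto
  have sq: "(jump (\<lambda>x. p (\<phi> x)) z)\<^sup>2 \<le> (jump \<phi> z)\<^sup>2" for z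
    unfolding abs_le_square_iff[symmetric] jump_def abs_mult
    by (rule mult_left_mono[OF p(2)]) simp
  have sq': "(kill (\<lambda>x. p (\<phi> x)) x)\<^sup>2 \<le> (kill \<phi> x)\<^sup>2" for x
    unfolding abs_le_square_iff[symmetric] kill_def abs_mult
    by (rule mult_left_mono) (use p(2)[of "\<phi> x" 0] p(3) in auto)
  show "form \<Omega> J B (\<lambda>x. p (\<phi> x)) (\<lambda>x. p (\<phi> x)) \<le> form \<Omega> J B \<phi> \<phi>"
    unfolding form_eq power2_eq_square[symmetric]
    by (intro add_mono mult_left_mono integral_mono sq sq')
       (use \<phi> p\<phi> in \<open>auto simp: form_dom_iff square_integrable_def\<close>)
qed

text \<open>Since \<open>E(\<phi>, p \<circ> \<phi>) \<ge> 0\<close> for test functions \<open>\<phi>\<close> close to \<open>v\<close> and \<open>p\<close> close to the negative part,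
  no truncation of \<open>v\<close> itself is needed.\<close>

lemma green_image_weak_maximum_principle:
  assumes k: "square_integrable M k" and v: "is_green_image \<Omega> J B k v"
  shows "0 \<le> (LINT x|M. k x * min (v x) 0)"
proof -
  have vH: "v \<in> HH \<Omega> J B" and test: "\<And>w. w \<in> HH \<Omega> J B \<Longrightarrow> form \<Omega> J B v w = (LINT x|M. k x * w x)"
    using v by (auto simp: is_green_image_def)
  note v_dom = HH_form_dom[OF vH] and v_sq = HH_square_integrable[OF vH]
  note [measurable] = square_integrable_measurable[OF v_sq] square_integrable_measurable[OF k]
  define E where "E u = form \<Omega> J B u u" for u
  \<comment> \<open>Collects the errors per unit of \<open>\<epsilon>\<close>: the L^2 distance of
    \<open>\<phi>\<close> to \<open>v\<close> tested with \<open>k\<close>, the smoothing error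
    \<open>\<epsilon> / 2\<close> against \<open>\<bar>k\<bar>\<close>, and the bound for
    \<open>form \<Omega> J B D \<psi>\<close>.\<close>
  define S where "S = sqrt (LINT x|M. (k x)\<^sup>2) + (LINT x|M. \<bar>k x\<bar>) / 2 + 2 * sqrt (E v) + 2"
  have "- (S * \<epsilon>) \<le> (LINT x|M. k x * min (v x) 0)" if \<epsilon>: "0 < \<epsilon>" "\<epsilon> \<le> 1" for \<epsilon>
  proof -
    obtain \<phi> where \<phi>: "\<phi> \<in> Cc_inf \<Omega>" "(LINT x|M. (v x - \<phi> x)\<^sup>2) \<le> \<epsilon>\<^sup>2"
      "form \<Omega> J B (\<lambda>x. v x - \<phi> x) (\<lambda>x. v x - \<phi> x) \<le> \<epsilon>\<^sup>2"
      using HH_approx[OF vH \<epsilon>(1)] by blast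
    define p where "p = smooth_neg \<epsilon>"
    define \<psi> where "\<psi> x = p (\<phi> x)" for x
    have \<psi>: "\<psi> \<in> Cc_inf \<Omega>" unfolding \<psi>_def p_def by (rule Cc_inf_smooth_neg[OF \<phi>(1) \<epsilon>(1)])
    note dom = Cc_inf_form_dom[OF \<phi>(1)] Cc_inf_form_dom[OF \<psi>]
    note [measurable] = Cc_inf_measurable[OF \<phi>(1), of \<Omega>] Cc_inf_measurable[OF \<psi>, of \<Omega>]
    have p: "\<And>s t. s \<le> t \<Longrightarrow> p s \<le> p t" "\<And>s t. \<bar>p s - p t\<bar> \<le> \<bar>s - t\<bar>" "p 0 = 0"
      unfolding p_def using \<epsilon>(1) by (auto simp: smooth_neg_mono smooth_neg_lipschitz smooth_neg_0)
    have \<psi>_dom': "(\<lambda>x. p (\<phi> x)) \<in> form_dom \<Omega> J B" using dom(2) by (simp add: \<psi>_def[abs_def])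
    have c1: "0 \<le> form \<Omega> J B \<phi> \<psi>"
      using form_normal_contraction(1)[OF dom(1) \<psi>_dom' p] by (simp add: \<psi>_def[abs_def])
    have c2: "E \<psi> \<le> E \<phi>"
      using form_normal_contraction(2)[OF dom(1) \<psi>_dom' p] by (simp add: \<psi>_def[abs_def] E_def)
    define D where "D x = v x - \<phi> x" for x
    have D_dom: "D \<in> form_dom \<Omega> J B" unfolding D_def by (rule form_dom_diff[OF v_dom dom(1)])
    have ED: "E D \<le> \<epsilon>\<^sup>2" using \<phi>(3) by (simp add: E_def D_def[abs_def])
    have D_sq: "square_integrable M D" using D_dom by (simp add: form_dom_iff)
    have E\<phi>: "E \<phi> \<le> 2 * E v + 2 * E D"
    proof -
      have *: "(LINT z|N. b z * b z) \<le> 2 * (LINT z|N. a z * a z) + 2 * (LINT z|N. (a z - b z) * (a z - b z))"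
        if "square_integrable N a" "square_integrable N b" for N :: "'c measure" and a b
      proof -
        have "(LINT z|N. b z * b z) = (LINT z|N. (a z + - (a z - b z))\<^sup>2)"
          by (simp add: power2_eq_square)
        also have "\<dots> \<le> 2 * (LINT z|N. (a z)\<^sup>2) + 2 * (LINT z|N. (- (a z - b z))\<^sup>2)"
          by (intro integral_square_add_le square_integrable_uminus square_integrable_diff that)
        finally show ?thesis unfolding power2_eq_square minus_mult_minus .
      qed
      have v': "square_integrable P (jump v)" "square_integrable M (kill v)"
        and \<phi>': "square_integrable P (jump \<phi>)" "square_integrable M (kill \<phi>)"
        using v_dom dom(1) by (auto simp: form_dom_iff)
      show ?thesis
        unfolding E_def form_eq D_def jump_diff kill_diff
        using *[OF v'(1) \<phi>'(1)] *[OF v'(2) \<phi>'(2)] by simp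
    qed
    \<comment> \<open>Smallness comes from \<open>D\<close> alone; the energy of
      \<open>\<psi>\<close> stays bounded because \<open>p\<close> is a contraction and
      \<open>\<phi>\<close> is close to \<open>v\<close> in energy.\<close>
    have "\<bar>form \<Omega> J B D \<psi>\<bar> \<le> \<epsilon> * (2 * sqrt (E v) + 2)"
    proof -
      have "(form \<Omega> J B D \<psi>)\<^sup>2 \<le> E D * E \<psi>"
        unfolding E_def by (rule form_Cauchy_Schwarz[OF D_dom dom(2)])
      also have "\<dots> \<le> \<epsilon>\<^sup>2 * (2 * E v + 2 * \<epsilon>\<^sup>2)"
        using ED c2 E\<phi> form_nonneg[of \<psi>] by (intro mult_mono) (auto simp: E_def)
      also have "\<dots> \<le> \<epsilon>\<^sup>2 * (2 * sqrt (E v) + 2)\<^sup>2"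
      proof (rule mult_left_mono)
        have Ev: "E v \<ge> 0" by (simp add: E_def form_nonneg)
        then have "(2 * sqrt (E v) + 2)\<^sup>2 = 4 * E v + 8 * sqrt (E v) + 4"
          by (simp add: power2_sum power_mult_distrib)
        moreover have "\<epsilon>\<^sup>2 \<le> 1" using \<epsilon> by (simp add: power_le_one)
        moreover have "0 \<le> sqrt (E v)" using Ev by simp
        ultimately show "2 * E v + 2 * \<epsilon>\<^sup>2 \<le> (2 * sqrt (E v) + 2)\<^sup>2" using Ev by linarith
      qed simp
      finally have "(form \<Omega> J B D \<psi>)\<^sup>2 \<le> (\<epsilon> * (2 * sqrt (E v) + 2))\<^sup>2"
        by (simp only: power_mult_distrib)
      moreover have "0 \<le> \<epsilon> * (2 * sqrt (E v) + 2)" using \<epsilon> form_nonneg[of v] by (simp add: E_def)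
      ultimately show ?thesis by (simp add: abs_le_square_iff[symmetric])
    qed
    moreover have "form \<Omega> J B D \<psi> = form \<Omega> J B v \<psi> - form \<Omega> J B \<phi> \<psi>"
      unfolding D_def by (rule form_diff_left[OF v_dom dom])
    moreover have "form \<Omega> J B v \<psi> = (LINT x|M. k x * \<psi> x)" by (rule test[OF Cc_inf_HH[OF \<psi>]])
    ultimately have low: "- (\<epsilon> * (2 * sqrt (E v) + 2)) \<le> (LINT x|M. k x * \<psi> x)"
      using c1 by linarith
    have k1: "integrable M (\<lambda>x. \<bar>k x\<bar>)" using square_integrable_integrable[OF k] by simp
    have kD: "integrable M (\<lambda>x. \<bar>k x\<bar> * \<bar>D x\<bar>)"
      using integrable_abs[OF square_integrable_mult[OF k D_sq]] by (simp add: abs_mult)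
    have i1: "integrable M (\<lambda>x. k x * \<psi> x)"
      by (intro square_integrable_mult k Cc_inf_square_integrable \<psi>)
    have i2: "integrable M (\<lambda>x. k x * min (v x) 0)"
      by (rule square_integrable_mult[OF k square_integrable_bound[OF v_sq]]) auto
    have "(LINT x|M. k x * \<psi> x) \<le> (LINT x|M. k x * min (v x) 0 + (\<bar>k x\<bar> * \<bar>D x\<bar> + \<epsilon> / 2 * \<bar>k x\<bar>))"
    proof (rule integral_mono[OF i1])
      show "integrable M (\<lambda>x. k x * min (v x) 0 + (\<bar>k x\<bar> * \<bar>D x\<bar> + \<epsilon> / 2 * \<bar>k x\<bar>))"
        by (intro Bochner_Integration.integrable_add i2 kD integrable_mult_right k1)
      fix x
      have "\<bar>\<psi> x - min (v x) 0\<bar> \<le> \<bar>D x\<bar> + \<epsilon> / 2"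
      proof -
        have "\<bar>p (\<phi> x) - p (v x)\<bar> \<le> \<bar>D x\<bar>" using p(2)[of "\<phi> x" "v x"] by (simp add: D_def abs_minus_commute)
        moreover have "\<bar>p (v x) - min (v x) 0\<bar> \<le> \<epsilon> / 2" unfolding p_def by (rule smooth_neg_approx[OF \<epsilon>(1)])
        ultimately show ?thesis unfolding \<psi>_def by linarith
      qed
      then have "\<bar>k x\<bar> * \<bar>\<psi> x - min (v x) 0\<bar> \<le> \<bar>k x\<bar> * (\<bar>D x\<bar> + \<epsilon> / 2)" by (rule mult_left_mono) simp
      moreover have "k x * \<psi> x - k x * min (v x) 0 \<le> \<bar>k x\<bar> * \<bar>\<psi> x - min (v x) 0\<bar>"
        unfolding right_diff_distrib[symmetric] abs_mult[symmetric] by (rule abs_ge_self)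
      ultimately show "k x * \<psi> x \<le> k x * min (v x) 0 + (\<bar>k x\<bar> * \<bar>D x\<bar> + \<epsilon> / 2 * \<bar>k x\<bar>)"
        by (simp add: distrib_left mult.commute)
    qed
    also have "\<dots> = (LINT x|M. k x * min (v x) 0) + ((LINT x|M. \<bar>k x\<bar> * \<bar>D x\<bar>) + \<epsilon> / 2 * (LINT x|M. \<bar>k x\<bar>))"
      using i2 kD k1 by simp
    also have "(LINT x|M. \<bar>k x\<bar> * \<bar>D x\<bar>) \<le> sqrt (LINT x|M. (k x)\<^sup>2) * \<epsilon>"
    proof -
      have sq: "square_integrable M (\<lambda>x. \<bar>k x\<bar>)" "square_integrable M (\<lambda>x. \<bar>D x\<bar>)"
        using k D_sq by (auto intro: square_integrable_bound)
      have "(LINT x|M. \<bar>k x\<bar> * \<bar>D x\<bar>) \<le> sqrt (LINT x|M. (k x)\<^sup>2) * sqrt (LINT x|M. (D x)\<^sup>2)"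
        using order_trans[OF abs_ge_self abs_integral_mult_le[OF sq]] by simp
      also have "\<dots> \<le> sqrt (LINT x|M. (k x)\<^sup>2) * \<epsilon>"
        using \<phi>(2) \<epsilon> by (intro mult_left_mono real_le_lsqrt) (auto simp: D_def)
      finally show ?thesis .
    qed
    finally show ?thesis using low unfolding S_def by (simp add: algebra_simps)
  qed
  note bound = this
  show ?thesis
  proof (rule ccontr)
    assume "\<not> 0 \<le> (LINT x|M. k x * min (v x) 0)"
    then have neg: "(LINT x|M. k x * min (v x) 0) < 0" (is "?I < 0") by simp
    have "0 \<le> sqrt (LINT x|M. (k x)\<^sup>2)" "0 \<le> (LINT x|M. \<bar>k x\<bar>)" "0 \<le> sqrt (E v)"
      by (simp_all add: E_def form_nonneg)
    then have S: "S > 0" unfolding S_def by linarith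
    \<comment> \<open>Makes \<open>S * \<epsilon>\<close> at most half of \<open>- ?I\<close>,
      contradicting the lower bound for \<open>?I\<close>.\<close>
    define \<epsilon> where "\<epsilon> = min 1 (- ?I / (2 * S))"
    have "\<epsilon> > 0" "\<epsilon> \<le> 1" using neg S by (auto simp: \<epsilon>_def divide_neg_pos)
    from bound[OF this] have "- (S * \<epsilon>) \<le> ?I" .
    moreover have "S * \<epsilon> \<le> S * (- ?I / (2 * S))" using S by (intro mult_left_mono) (auto simp: \<epsilon>_def)
    moreover have "S * (- ?I / (2 * S)) = - ?I / 2" using S by simp
    ultimately show False using neg by linarith
  qed
qed

text \<open>Cauchy-Schwarz for the form, since \<open>\<integral> k \<psi>\<close> is the form at
  \<open>v\<close> and \<open>\<psi>\<close>, and \<open>\<integral> k v\<close> is the form at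
  \<open>v\<close> and \<open>v\<close>. It identifies the energy of \<open>\<psi>\<close> as the
  constant in the approximation property.\<close>

lemma green_image_pairing:
  assumes k: "is_green_image \<Omega> J B k v" and \<psi>: "\<psi> \<in> Cc_inf \<Omega>"
  shows "(LINT x|M. k x * \<psi> x)\<^sup>2 \<le> form \<Omega> J B \<psi> \<psi> * (LINT x|M. k x * v x)"
proof -
  have v: "v \<in> HH \<Omega> J B" and test: "\<And>w. w \<in> HH \<Omega> J B \<Longrightarrow> form \<Omega> J B v w = (LINT x|M. k x * w x)"
    using k by (auto simp: is_green_image_def)
  show ?thesis
    using form_Cauchy_Schwarz[OF HH_form_dom[OF v] Cc_inf_form_dom[OF \<psi>]]
    unfolding test[OF v] test[OF Cc_inf_HH[OF \<psi>]] by (simp add: mult.commute)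
qed

text \<open>Two approximations in a fixed order. The indicator is smoothed to a step of width
  \<open>a\<close>, with dominated convergence as \<open>a\<close> tends to 0; then, for fixed
  \<open>a\<close> and hence fixed Lipschitz constant \<open>3 / a\<close>, \<open>w\<close> and
  \<open>\<eta>\<close> are replaced by test functions. Boundedness of \<open>\<eta>\<close>
  controls the product of \<open>\<eta>\<close> with the error in the step.\<close>

lemma HH_positive_part_approx:
  assumes w: "w \<in> HH \<Omega> J B" and \<eta>: "\<eta> \<in> HH \<Omega> J B" "\<And>x. x \<in> \<Omega> \<Longrightarrow> \<bar>\<eta> x\<bar> \<le> K" and \<epsilon>: "\<epsilon> > 0"
  shows "\<exists>\<psi>\<in>Cc_inf \<Omega>. (LINT x|M. ((if 0 < w x then \<eta> x else 0) - \<psi> x)\<^sup>2) \<le> \<epsilon>"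
proof -
  note w_sq = HH_square_integrable[OF w] and \<eta>_sq = HH_square_integrable[OF \<eta>(1)]
  note [measurable] = square_integrable_measurable[OF w_sq] square_integrable_measurable[OF \<eta>_sq]
  have step_meas [measurable]: "smooth_step a \<in> borel_measurable borel" for a
    unfolding smooth_step_def by measurable
  define f where "f x = (if 0 < w x then \<eta> x else 0)" for x
  have f_sq: "square_integrable M f"
    unfolding f_def by (rule square_integrable_bound[OF \<eta>_sq]) auto
  note [measurable] = square_integrable_measurable[OF f_sq]
  define F where "F n x = smooth_step (inverse (real (Suc n))) (w x) * \<eta> x" for n x
  have F_le: "\<bar>F n x\<bar> \<le> \<bar>\<eta> x\<bar>" for n x
    unfolding F_def abs_mult by (rule mult_left_le_one_le) (auto simp: abs_smooth_step_le)
  have F_sq: "square_integrable M (F n)" for n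
    by (rule square_integrable_bound[OF \<eta>_sq _ F_le]) (unfold F_def, measurable)
  have "(\<lambda>n. LINT x|M. (f x - F n x)\<^sup>2) \<longlonglongrightarrow> (LINT x|M. 0)"
  proof (rule integral_dominated_convergence[where w="\<lambda>x. 4 * (\<eta> x)\<^sup>2"])
    show "integrable M (\<lambda>x. 4 * (\<eta> x)\<^sup>2)" by (intro integrable_mult_right square_integrableD \<eta>_sq)
    show "AE x in M. (\<lambda>n. (f x - F n x)\<^sup>2) \<longlonglongrightarrow> 0"
    proof (rule AE_I2)
      fix x
      have "(\<lambda>n. F n x) \<longlonglongrightarrow> (if 0 < w x then 1 else 0) * \<eta> x"
        unfolding F_def by (intro tendsto_mult smooth_step_tendsto tendsto_const)
      then have "(\<lambda>n. F n x) \<longlonglongrightarrow> f x" by (simp add: f_def split: if_splits)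
      then have "(\<lambda>n. (f x - F n x)\<^sup>2) \<longlonglongrightarrow> (f x - f x)\<^sup>2"
        by (intro tendsto_power tendsto_diff tendsto_const)
      then show "(\<lambda>n. (f x - F n x)\<^sup>2) \<longlonglongrightarrow> 0" by simp
    qed
    show "AE x in M. norm ((f x - F n x)\<^sup>2) \<le> 4 * (\<eta> x)\<^sup>2" for n
    proof (rule AE_I2)
      fix x
      have "\<bar>f x\<bar> \<le> \<bar>\<eta> x\<bar>" by (simp add: f_def)
      then have "\<bar>f x - F n x\<bar> \<le> \<bar>2 * \<eta> x\<bar>" using F_le[of n x] by simp
      then show "norm ((f x - F n x)\<^sup>2) \<le> 4 * (\<eta> x)\<^sup>2"
        unfolding abs_le_square_iff by (simp add: power_mult_distrib)
    qed
    show "(\<lambda>x. (f x - F n x)\<^sup>2) \<in> borel_measurable M" for n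
      using square_integrable_measurable[OF F_sq] by measurable
  qed simp
  then have "(\<lambda>n. LINT x|M. (f x - F n x)\<^sup>2) \<longlonglongrightarrow> 0" by simp
  from order_tendstoD(2)[OF this, of "\<epsilon> / 4"] \<epsilon>
  obtain n where n: "(LINT x|M. (f x - F n x)\<^sup>2) < \<epsilon> / 4" by (auto dest: eventually_happens)
  define a where "a = inverse (real (Suc n))"
  have a: "a > 0" by (simp add: a_def)
  \<comment> \<open>The total factor in front of \<open>\<epsilon>'\<^sup>2\<close> in the error of
    the second approximation; \<open>\<epsilon>'\<close> is chosen so that
    \<open>Q * \<epsilon>'\<^sup>2 = \<epsilon> / 4\<close>.\<close>
  define Q where "Q = 2 + 2 * K\<^sup>2 * (3 / a)\<^sup>2"
  have Q: "Q > 0" unfolding Q_def by (intro add_pos_nonneg) auto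
  define \<epsilon>' where "\<epsilon>' = sqrt (\<epsilon> / (4 * Q))"
  have \<epsilon>': "\<epsilon>' > 0" "\<epsilon>'\<^sup>2 = \<epsilon> / (4 * Q)" using \<epsilon> Q by (auto simp: \<epsilon>'_def)
  obtain \<phi> where \<phi>: "\<phi> \<in> Cc_inf \<Omega>" "(LINT x|M. (w x - \<phi> x)\<^sup>2) \<le> \<epsilon>'\<^sup>2"
    using HH_approx[OF w \<epsilon>'(1)] by blast
  obtain \<theta> where \<theta>: "\<theta> \<in> Cc_inf \<Omega>" "(LINT x|M. (\<eta> x - \<theta> x)\<^sup>2) \<le> \<epsilon>'\<^sup>2"
    using HH_approx[OF \<eta>(1) \<epsilon>'(1)] by blast
  define \<psi> where "\<psi> x = smooth_step a (\<phi> x) * \<theta> x" for x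
  have \<psi>: "\<psi> \<in> Cc_inf \<Omega>" unfolding \<psi>_def by (rule Cc_inf_smooth_step_mult[OF \<phi>(1) \<theta>(1) a])
  note \<phi>_sq = Cc_inf_square_integrable[OF \<phi>(1)] and \<theta>_sq = Cc_inf_square_integrable[OF \<theta>(1)]
    and \<psi>_sq = Cc_inf_square_integrable[OF \<psi>]
  have "(LINT x|M. (F n x - \<psi> x)\<^sup>2)
      \<le> (LINT x|M. 2 * (\<eta> x - \<theta> x)\<^sup>2 + (2 * K\<^sup>2 * (3 / a)\<^sup>2) * (w x - \<phi> x)\<^sup>2)"
  proof (rule integral_mono)
    show "integrable M (\<lambda>x. (F n x - \<psi> x)\<^sup>2)"
      by (intro square_integrableD square_integrable_diff F_sq \<psi>_sq)
    show "integrable M (\<lambda>x. 2 * (\<eta> x - \<theta> x)\<^sup>2 + (2 * K\<^sup>2 * (3 / a)\<^sup>2) * (w x - \<phi> x)\<^sup>2)"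
      by (intro Bochner_Integration.integrable_add integrable_mult_right square_integrableD
          square_integrable_diff w_sq \<eta>_sq \<phi>_sq \<theta>_sq)
    fix x assume x: "x \<in> space M"
    define X where "X = smooth_step a (\<phi> x) * (\<eta> x - \<theta> x)"
    define Y where "Y = (smooth_step a (w x) - smooth_step a (\<phi> x)) * \<eta> x"
    have "F n x - \<psi> x = X + Y" unfolding F_def a_def[symmetric] \<psi>_def X_def Y_def by (simp only: algebra_simps)
    moreover have "(X + Y)\<^sup>2 \<le> 2 * X\<^sup>2 + 2 * Y\<^sup>2"
      using zero_le_power2[of "X - Y"] by (simp add: power2_eq_square algebra_simps)
    moreover have "X\<^sup>2 \<le> (\<eta> x - \<theta> x)\<^sup>2"
      unfolding abs_le_square_iff[symmetric] X_def abs_mult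
      by (rule mult_left_le_one_le) (auto simp: abs_smooth_step_le)
    moreover have "Y\<^sup>2 \<le> (3 / a * \<bar>w x - \<phi> x\<bar> * K)\<^sup>2"
    proof -
      have "\<bar>Y\<bar> \<le> 3 / a * \<bar>w x - \<phi> x\<bar> * K"
        unfolding Y_def abs_mult using x a
        by (intro mult_mono smooth_step_lipschitz \<eta>(2)) (auto simp: space_M)
      then show ?thesis by (metis abs_ge_zero power2_abs power_mono)
    qed
    moreover have "(3 / a * \<bar>w x - \<phi> x\<bar> * K)\<^sup>2 = K\<^sup>2 * (3 / a)\<^sup>2 * (w x - \<phi> x)\<^sup>2"
      by (simp only: power_mult_distrib power2_abs mult_ac)
    ultimately show "(F n x - \<psi> x)\<^sup>2 \<le> 2 * (\<eta> x - \<theta> x)\<^sup>2 + 2 * K\<^sup>2 * (3 / a)\<^sup>2 * (w x - \<phi> x)\<^sup>2"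
      by simp
  qed
  also have "\<dots> = 2 * (LINT x|M. (\<eta> x - \<theta> x)\<^sup>2) + (2 * K\<^sup>2 * (3 / a)\<^sup>2) * (LINT x|M. (w x - \<phi> x)\<^sup>2)"
    using square_integrableD[OF square_integrable_diff[OF \<eta>_sq \<theta>_sq]]
      square_integrableD[OF square_integrable_diff[OF w_sq \<phi>_sq]] by simp
  also have "\<dots> \<le> 2 * \<epsilon>'\<^sup>2 + (2 * K\<^sup>2 * (3 / a)\<^sup>2) * \<epsilon>'\<^sup>2"
    by (intro add_mono mult_left_mono \<theta> \<phi>) auto
  also have "\<dots> = Q * \<epsilon>'\<^sup>2" by (simp add: Q_def distrib_right)
  also have "\<dots> = \<epsilon> / 4" unfolding \<epsilon>'(2) using Q by simp
  finally have F\<psi>: "(LINT x|M. (F n x - \<psi> x)\<^sup>2) \<le> \<epsilon> / 4" .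
  have "(LINT x|M. (f x - \<psi> x)\<^sup>2) = (LINT x|M. ((f x - F n x) + (F n x - \<psi> x))\<^sup>2)" by simp
  also have "\<dots> \<le> 2 * (LINT x|M. (f x - F n x)\<^sup>2) + 2 * (LINT x|M. (F n x - \<psi> x)\<^sup>2)"
    by (intro integral_square_add_le square_integrable_diff f_sq F_sq \<psi>_sq)
  also have "\<dots> \<le> \<epsilon>" using n F\<psi> by simp
  finally show ?thesis using \<psi> unfolding f_def by blast
qed

end

section \<open>Green kernel estimates\<close>

lemma dyadic_scale:
  fixes r R :: real
  assumes "0 < r" "r < R"
  obtains k where "R * (1/2) ^ Suc k \<le> r" "r < R * (1/2) ^ k"
proof -
  obtain n where "(1/2) ^ n < r / R"
    using real_arch_pow_inv[of "r / R" "1/2"] assms by auto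
  then have ex: "R * (1/2) ^ n \<le> r" using assms by (simp add: field_simps)
  define m where "m = (LEAST n. R * (1/2) ^ n \<le> r)"
  have m: "R * (1/2) ^ m \<le> r" unfolding m_def by (rule LeastI[of "\<lambda>n. R * (1/2) ^ n \<le> r", OF ex])
  have "m \<noteq> 0" using m assms by (intro notI) simp
  then obtain k where k: "m = Suc k" by (cases m) auto
  have "\<not> R * (1/2) ^ k \<le> r"
    using not_less_Least[of k "\<lambda>n. R * (1/2) ^ n \<le> r"] k unfolding m_def by simp
  with m k show ?thesis by (intro that[of k]) auto
qed

text \<open>On the dyadic shell between the radii \<open>R * (1/2) ^ Suc k\<close> and
  \<open>R * (1/2) ^ k\<close> the kernel is at most its value \<open>e k\<close> at the inner
  radius, and the outer ball has volume \<open>V * (R * (1/2) ^ k) ^ N\<close>. The products form a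
  geometric series of ratio \<open>(1/2) powr (N - a)\<close>, below 1 because \<open>a < N\<close>,
  and do not depend on the centre.\<close>

lemma riesz_potential_bounded:
  assumes a: "0 \<le> a" "a < real DIM('a::euclidean_space)" and R: "0 < R"
  obtains C where "0 \<le> C"
    "\<And>x::'a. (\<integral>\<^sup>+y. ennreal (1 / norm (x - y) powr a) * indicator (ball x R) y \<partial>lborel) \<le> ennreal C"
proof -
  define N where "N = DIM('a)"
  define e where "e k = (R * (1/2) ^ Suc k) powr (- a)" for k
  define V where "V = unit_ball_vol (real N)"
  have V0: "V \<ge> 0" by (simp add: V_def)
  define b where "b k = e k * (V * (R * (1/2) ^ k) ^ N)" for k
  define q where "q = (1/2) powr (real N - a)"
  have q: "0 \<le> q" "q < 1" using a powr_less_mono2[of "real N - a" "1/2" 1] by (auto simp: q_def N_def)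
  have b_eq: "b k = (V * (R / 2) powr (- a) * R ^ N) * q ^ k" for k
  proof -
    have "e k = (R / 2) powr (- a) * ((1/2) ^ k) powr (- a)"
      using R by (simp add: e_def powr_mult[symmetric] mult_ac)
    moreover have "((1/2::real) ^ k) powr (- a) * ((1/2) ^ k) ^ N = q ^ k"
    proof -
      have "((1/2::real) ^ k) ^ N = ((1/2) ^ k) powr real N" by (simp add: powr_realpow)
      then have "((1/2::real) ^ k) powr (- a) * ((1/2) ^ k) ^ N = ((1/2) ^ k) powr (real N - a)"
        by (simp add: powr_add[symmetric])
      also have "\<dots> = ((1/2) powr real k) powr (real N - a)" by (simp add: powr_realpow)
      also have "\<dots> = q powr real k" by (simp add: q_def powr_powr mult.commute)
      also have "\<dots> = q ^ k" by (rule powr_realpow) (simp add: q_def)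
      finally show ?thesis .
    qed
    ultimately show ?thesis
      by (simp add: b_def power_mult_distrib mult_ac)
  qed
  have sum_b: "summable b"
    unfolding b_eq[abs_def] using q by (intro summable_mult summable_geometric) simp
  have b0: "b k \<ge> 0" for k using R V0 by (simp add: b_def e_def)
  show ?thesis
  proof (rule that)
    show "0 \<le> suminf b" by (intro suminf_nonneg sum_b b0)
    fix x :: 'a
    have term_le: "f k \<le> (\<Sum>k. f k)" for f :: "nat \<Rightarrow> ennreal" and k
      using sum_le_suminf[of f "{k}"] by simp
    have le: "ennreal (1 / norm (x - y) powr a) * indicator (ball x R) y
        \<le> (\<Sum>k. ennreal (e k) * indicator (ball x (R * (1/2) ^ k)) y)" for y
    \<comment> \<open>Outside the ball, and at \<open>y = x\<close> where division by 0 yields 0,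
      the left side vanishes.\<close>
    proof (cases "y \<in> ball x R \<and> y \<noteq> x")
      case True
      then have "0 < norm (x - y)" "norm (x - y) < R" by (auto simp: dist_norm)
      then obtain k where k: "R * (1/2) ^ Suc k \<le> norm (x - y)" "norm (x - y) < R * (1/2) ^ k"
        by (rule dyadic_scale)
      have "1 / norm (x - y) powr a = norm (x - y) powr (- a)" by (simp add: powr_minus_divide)
      also have "\<dots> \<le> e k"
        unfolding e_def using k(1) R a by (intro powr_mono2') auto
      finally have "ennreal (1 / norm (x - y) powr a) * indicator (ball x R) y
          \<le> ennreal (e k) * indicator (ball x (R * (1/2) ^ k)) y"
        using True k(2) by (auto simp: dist_norm intro: ennreal_leI)
      also have "\<dots> \<le> (\<Sum>k. ennreal (e k) * indicator (ball x (R * (1/2) ^ k)) y)"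
        by (rule term_le)
      finally show ?thesis .
    qed auto
    have "(\<integral>\<^sup>+y. ennreal (1 / norm (x - y) powr a) * indicator (ball x R) y \<partial>lborel)
        \<le> (\<integral>\<^sup>+y. (\<Sum>k. ennreal (e k) * indicator (ball x (R * (1/2) ^ k)) y) \<partial>lborel)"
      by (rule nn_integral_mono) (rule le)
    also have "\<dots> = (\<Sum>k. \<integral>\<^sup>+y. ennreal (e k) * indicator (ball x (R * (1/2) ^ k)) y \<partial>lborel)"
      by (intro nn_integral_suminf borel_measurable_times_ennreal borel_measurable_indicator) auto
    also have "\<dots> = (\<Sum>k. ennreal (b k))"
    proof (intro suminf_cong)
      fix k
      have "(\<integral>\<^sup>+y. ennreal (e k) * indicator (ball x (R * (1/2) ^ k)) y \<partial>lborel)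
          = ennreal (e k) * emeasure lborel (ball x (R * (1/2) ^ k))"
        by (rule nn_integral_cmult_indicator) simp
      also have "\<dots> = ennreal (b k)"
        using R by (simp add: emeasure_ball b_def V_def N_def e_def ennreal_mult[symmetric])
      finally show "(\<integral>\<^sup>+y. ennreal (e k) * indicator (ball x (R * (1/2) ^ k)) y \<partial>lborel) = ennreal (b k)" .
    qed
    also have "\<dots> = ennreal (suminf b)" by (rule suminf_ennreal2[OF b0 sum_b])
    finally show "(\<integral>\<^sup>+y. ennreal (1 / norm (x - y) powr a) * indicator (ball x R) y \<partial>lborel)
        \<le> ennreal (suminf b)" .
  qed
qed

section \<open>Pointwise bounds for the Green profile\<close>

lemma green_profile_le:
  fixes x y :: "'a::euclidean_space"
  assumes "0 \<le> \<gamma>"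
  shows "green_profile \<Omega> s \<gamma> x y \<le> 1 / norm (x - y) powr (real DIM('a) - 2 * s)"
proof -
  have m: "0 \<le> min (bdist \<Omega> z / norm (x - y)) 1" "min (bdist \<Omega> z / norm (x - y)) 1 \<le> 1" for z
    by (auto simp: bdist_def infdist_nonneg)
  have p: "min (bdist \<Omega> z / norm (x - y)) 1 powr \<gamma> \<le> 1" for z
    using powr_mono2[OF assms m[of z]] by simp
  show ?thesis
    unfolding green_profile_def
    by (intro mult_right_le_one_le mult_nonneg_nonneg order_trans[OF mult_right_le_one_le] p) auto
qed

text \<open>If \<open>r = |x - y| \<le> \<delta>(x)\<close> then \<open>\<delta>(y) \<le> 2 \<delta>(x)\<close>, and otherwise \<open>\<delta>(x) / r \<cdot> \<delta>(y) \<le> \<delta>(x) / r \<cdot> 2 r\<close>.\<close>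

lemma green_profile_weight_le:
  fixes x y :: "'a::euclidean_space"
  assumes \<gamma>: "0 \<le> \<gamma>" "\<gamma> \<le> 1" and xy: "x \<noteq> y"
  shows "green_profile \<Omega> s \<gamma> x y * bdist \<Omega> y powr \<gamma>
    \<le> 1 / norm (x - y) powr (real DIM('a) - 2 * s) * (2 * bdist \<Omega> x powr \<gamma>)"
proof -
  define r where "r = norm (x - y)"
  have r: "r > 0" using xy by (simp add: r_def)
  define m where "m z = min (bdist \<Omega> z / r) 1" for z
  have d0: "0 \<le> bdist \<Omega> z" for z by (simp add: bdist_def infdist_nonneg)
  have m: "0 \<le> m z" "m z \<le> 1" for z using r d0[of z] by (auto simp: m_def)
  have p: "m z powr \<gamma> \<le> 1" for z using powr_mono2[OF \<gamma>(1) m[of z]] by simp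
  have tri: "bdist \<Omega> y \<le> bdist \<Omega> x + r"
    unfolding bdist_def r_def using infdist_triangle[of y "- \<Omega>" x] by (simp add: dist_norm norm_minus_commute)
  have "m x * bdist \<Omega> y \<le> 2 * bdist \<Omega> x"
  proof (cases "r \<le> bdist \<Omega> x")
    case True
    have "m x * bdist \<Omega> y \<le> 1 * bdist \<Omega> y" by (rule mult_right_mono[OF m(2) d0])
    with tri True show ?thesis by simp
  next
    case False
    then have "m x * bdist \<Omega> y \<le> bdist \<Omega> x / r * (2 * r)"
      using tri r d0 by (intro mult_mono) (auto simp: m_def)
    also have "\<dots> = 2 * bdist \<Omega> x" using r by simp
    finally show ?thesis .
  qed
  then have "(m x * bdist \<Omega> y) powr \<gamma> \<le> (2 * bdist \<Omega> x) powr \<gamma>"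
    using m d0 by (intro powr_mono2 \<gamma> mult_nonneg_nonneg)
  also have "\<dots> = 2 powr \<gamma> * bdist \<Omega> x powr \<gamma>" using d0 by (simp add: powr_mult)
  also have "\<dots> \<le> 2 * bdist \<Omega> x powr \<gamma>"
  proof (rule mult_right_mono)
    have "(2::real) powr \<gamma> \<le> 2 powr 1" by (rule powr_mono) (use \<gamma> in auto)
    then show "(2::real) powr \<gamma> \<le> 2" by simp
  qed simp
  finally have *: "m x powr \<gamma> * bdist \<Omega> y powr \<gamma> \<le> 2 * bdist \<Omega> x powr \<gamma>"
    using m d0 by (simp add: powr_mult)
  have "green_profile \<Omega> s \<gamma> x y * bdist \<Omega> y powr \<gamma>
      = 1 / r powr (real DIM('a) - 2 * s) * (m x powr \<gamma> * bdist \<Omega> y powr \<gamma>) * m y powr \<gamma>"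
    by (simp add: green_profile_def r_def m_def)
  also have "\<dots> \<le> 1 / r powr (real DIM('a) - 2 * s) * (m x powr \<gamma> * bdist \<Omega> y powr \<gamma>)"
    by (rule mult_right_le_one_le) (use p in auto)
  also have "\<dots> \<le> 1 / r powr (real DIM('a) - 2 * s) * (2 * bdist \<Omega> x powr \<gamma>)"
    by (rule mult_left_mono[OF *]) simp
  finally show ?thesis by (simp add: r_def)
qed

text \<open>Replacing the distance of the points by the larger \<open>R\<close> lowers every factor.
  The power of \<open>bdist \<Omega> x\<close> is kept, since a lower bound by a multiple of the
  weight at \<open>x\<close> is the goal.\<close>

lemma green_profile_ge:
  fixes x y :: "'a::euclidean_space"
  assumes \<gamma>: "0 \<le> \<gamma>" and N: "0 \<le> real DIM('a) - 2 * s" and xy: "x \<noteq> y"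
    and R: "norm (x - y) \<le> R" "bdist \<Omega> x \<le> R" and \<rho>: "0 \<le> \<rho>" "\<rho> \<le> bdist \<Omega> y" "\<rho> \<le> R"
  shows "1 / R powr (real DIM('a) - 2 * s) * (bdist \<Omega> x / R) powr \<gamma> * (\<rho> / R) powr \<gamma>
    \<le> green_profile \<Omega> s \<gamma> x y"
proof -
  have r: "norm (x - y) > 0" using xy by simp
  then have R0: "R > 0" using R(1) by linarith
  have d0: "0 \<le> bdist \<Omega> x" by (simp add: bdist_def infdist_nonneg)
  have 1: "bdist \<Omega> x / R \<le> min (bdist \<Omega> x / norm (x - y)) 1"
    using divide_left_mono[OF R(1) d0 mult_pos_pos[OF R0 r]] R(2) R0 by simp
  have "\<rho> / R \<le> \<rho> / norm (x - y)" by (rule divide_left_mono[OF R(1) \<rho>(1) mult_pos_pos[OF R0 r]])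
  also have "\<dots> \<le> bdist \<Omega> y / norm (x - y)" using r \<rho> by (intro divide_right_mono) auto
  finally have 2: "\<rho> / R \<le> min (bdist \<Omega> y / norm (x - y)) 1"
    using R0 \<rho> by auto
  have 3: "norm (x - y) powr (real DIM('a) - 2 * s) \<le> R powr (real DIM('a) - 2 * s)"
    by (rule powr_mono2[OF N _ R(1)]) simp
  show ?thesis
    unfolding green_profile_def
    using R0 r \<rho> d0 by (intro mult_mono powr_mono2[OF \<gamma> _ 1] powr_mono2[OF \<gamma> _ 2] divide_left_mono 3) auto
qed

locale green_form = jump_form +
  fixes G :: "'a \<Rightarrow> 'a \<Rightarrow> real" and s \<gamma> :: real
  assumes domain_nonempty: "\<Omega> \<noteq> {}" and cond_G1: "cond_G1 \<Omega> J B G s \<gamma>"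
begin

text \<open>\<open>G\<close> is unspecified on the diagonal and off \<open>\<Omega>\<close>.\<close>

definition G0 :: "'a \<Rightarrow> 'a \<Rightarrow> real" where
  "G0 x y = (if (x, y) \<in> offdiag \<Omega> then G x y else 0)"

definition wt :: "'a \<Rightarrow> real" where
  "wt x = bdist \<Omega> x powr \<gamma>"

lemma parameters: "0 < s" "s \<le> 1" "0 < \<gamma>" "\<gamma> \<le> 1" "2 * s < real DIM('a)"
  using cond_G1 by (auto simp: cond_G1_def)

lemma offdiag_iff: "(x, y) \<in> offdiag \<Omega> \<longleftrightarrow> x \<in> \<Omega> \<and> y \<in> \<Omega> \<and> x \<noteq> y"
  by (auto simp: offdiag_def)

lemma G0_nonneg: "0 \<le> G0 x y"
  using cond_G1 by (auto simp: G0_def cond_G1_def less_imp_le)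

lemma G0_sym: "G0 x y = G0 y x"
  using cond_G1 by (auto simp: G0_def cond_G1_def offdiag_iff)

lemma G0_borel: "case_prod G0 \<in> borel_measurable borel"
proof -
  have "offdiag \<Omega> = (\<Omega> \<times> \<Omega>) \<inter> {z. fst z \<noteq> snd z}" by (auto simp: offdiag_def)
  moreover have "open {z :: 'a \<times> 'a. fst z \<noteq> snd z}" by (intro open_Collect_neq continuous_intros)
  ultimately have "open (offdiag \<Omega>)" using open_domain by (auto intro: open_Times)
  then have S: "offdiag \<Omega> \<in> sets borel" by simp
  have "(\<lambda>(x, y). G x y) \<in> borel_measurable (restrict_space borel (offdiag \<Omega>))"
    using cond_G1 by (simp add: cond_G1_def)
  then have "(\<lambda>z. if z \<in> offdiag \<Omega> then (case z of (x, y) \<Rightarrow> G x y) else 0) \<in> borel_measurable borel"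
    using S by (subst (asm) measurable_restrict_space_iff[of _ _ 0]) auto
  also have "(\<lambda>z. if z \<in> offdiag \<Omega> then (case z of (x, y) \<Rightarrow> G x y) else 0) = case_prod G0"
    by (auto simp: G0_def fun_eq_iff)
  finally show ?thesis .
qed

lemma id_measurable_M: "(\<lambda>x. x) \<in> M \<rightarrow>\<^sub>M borel"
  by (intro measurable_restrict_space1 measurable_completion) simp

text \<open>The product of two Lebesgue sigma-algebras is smaller than the Lebesgue sigma-algebra of
  the product space; Borel measurability of the kernel avoids this difficulty.\<close>

lemma G0_measurable: "case_prod G0 \<in> borel_measurable (M \<Otimes>\<^sub>M M)"
proof -
  have "(\<lambda>z. (fst z, snd z)) \<in> M \<Otimes>\<^sub>M M \<rightarrow>\<^sub>M (borel \<Otimes>\<^sub>M borel :: ('a \<times> 'a) measure)"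
    by (intro measurable_Pair measurable_compose[OF measurable_fst id_measurable_M]
        measurable_compose[OF measurable_snd id_measurable_M])
  then have "(\<lambda>z. z) \<in> M \<Otimes>\<^sub>M M \<rightarrow>\<^sub>M (borel :: ('a \<times> 'a) measure)" by (simp add: borel_prod)
  from measurable_compose[OF this G0_borel] show ?thesis by simp
qed

lemma wt_measurable: "wt \<in> borel_measurable M"
proof -
  have "(bdist \<Omega>) \<in> borel_measurable borel"
    unfolding bdist_def by (intro borel_measurable_continuous_onI continuous_intros)
  then have "wt \<in> borel_measurable borel" unfolding wt_def by measurable
  from measurable_compose[OF id_measurable_M this] show ?thesis by simp
qed

lemma compl_nonempty: "- \<Omega> \<noteq> {}"
proof
  assume "- \<Omega> = {}"
  then have "\<Omega> = UNIV" by auto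
  with bounded_domain show False using not_bounded_UNIV by simp
qed

lemma bdist_pos: "x \<in> \<Omega> \<Longrightarrow> 0 < bdist \<Omega> x"
  unfolding bdist_def
  by (rule infdist_pos_not_in_closed[OF _ compl_nonempty]) (use open_domain in auto)

lemma wt_pos: "x \<in> \<Omega> \<Longrightarrow> 0 < wt x"
  using bdist_pos[of x] by (simp add: wt_def)

lemma domain_scale:
  obtains R where "0 < R" "\<And>x y. x \<in> \<Omega> \<Longrightarrow> y \<in> \<Omega> \<Longrightarrow> norm (x - y) < R" "\<And>x. x \<in> \<Omega> \<Longrightarrow> bdist \<Omega> x \<le> R"
proof -
  obtain z where z: "z \<notin> \<Omega>" using compl_nonempty by auto
  obtain m where m: "\<And>x. x \<in> \<Omega> \<Longrightarrow> norm x \<le> m" using bounded_domain by (auto simp: bounded_iff)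
  define R where "R = 2 * \<bar>m\<bar> + norm z + 1"
  have "norm (x - y) < R" if "x \<in> \<Omega>" "y \<in> \<Omega>" for x y
    using norm_triangle_ineq4[of x y] m[OF that(1)] m[OF that(2)] norm_ge_zero[of z] unfolding R_def by linarith
  moreover have "bdist \<Omega> x \<le> R" if "x \<in> \<Omega>" for x
  proof -
    have "bdist \<Omega> x \<le> norm (x - z)"
      unfolding bdist_def using infdist_le[of z "- \<Omega>" x] z by (simp add: dist_norm)
    also have "\<dots> \<le> R" using norm_triangle_ineq4[of x z] m[OF that] unfolding R_def by linarith
    finally show ?thesis .
  qed
  moreover have "R > 0" unfolding R_def using norm_ge_zero[of z] by linarith
  ultimately show ?thesis by (rule that[rotated])
qed

lemma nn_integral_M_le:
  assumes "x \<in> \<Omega>" and R: "\<And>y. y \<in> \<Omega> \<Longrightarrow> norm (x - y) < R"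
    and f: "\<And>y. y \<in> \<Omega> \<Longrightarrow> y \<noteq> x \<Longrightarrow> f y \<le> K / norm (x - y) powr a" and K: "0 \<le> K"
    and f0: "f x \<le> 0"
    and C: "(\<integral>\<^sup>+y. ennreal (1 / norm (x - y) powr a) * indicator (ball x R) y \<partial>lborel) \<le> ennreal C"
    and C0: "0 \<le> C"
  shows "(\<integral>\<^sup>+y. ennreal (f y) \<partial>M) \<le> ennreal (K * C)"
proof -
  have "(\<integral>\<^sup>+y. ennreal (f y) \<partial>M) = (\<integral>\<^sup>+y. ennreal (f y) * indicator \<Omega> y \<partial>lebesgue)"
    by (rule nn_integral_restrict_space) (simp add: domain_sets)
  also have "\<dots> \<le> (\<integral>\<^sup>+y. ennreal K * (ennreal (1 / norm (x - y) powr a) * indicator (ball x R) y) \<partial>lebesgue)"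
  proof (rule nn_integral_mono)
    fix y
    show "ennreal (f y) * indicator \<Omega> y
        \<le> ennreal K * (ennreal (1 / norm (x - y) powr a) * indicator (ball x R) y)"
    proof (cases "y \<in> \<Omega> \<and> y \<noteq> x")
      case True
      then have "ennreal (f y) \<le> ennreal (K * (1 / norm (x - y) powr a))"
        using f[of y] by (intro ennreal_leI) simp
      also have "\<dots> = ennreal K * ennreal (1 / norm (x - y) powr a)"
        using K by (intro ennreal_mult) auto
      finally show ?thesis using True R[of y] by (auto simp: dist_norm)
    next
      case False
      then show ?thesis using f0 by (auto simp: ennreal_neg)
    qed
  qed
  also have "\<dots> = (\<integral>\<^sup>+y. ennreal K * (ennreal (1 / norm (x - y) powr a) * indicator (ball x R) y) \<partial>lborel)"
    by (rule nn_integral_completion)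
  also have "\<dots> = ennreal K * (\<integral>\<^sup>+y. ennreal (1 / norm (x - y) powr a) * indicator (ball x R) y \<partial>lborel)"
    by (intro nn_integral_cmult borel_measurable_times_ennreal borel_measurable_indicator) auto
  also have "\<dots> \<le> ennreal K * ennreal C" by (rule mult_left_mono[OF C]) simp
  also have "\<dots> = ennreal (K * C)" using K C0 by (simp add: ennreal_mult)
  finally show ?thesis .
qed

lemma AE_neq: "AE y in M. y \<noteq> x"
proof -
  have "{x} \<in> null_sets (lebesgue :: 'a measure)" by (simp add: null_sets_completionI)
  then have "AE y in lebesgue. y \<notin> {x}" by (rule AE_not_in)
  then show ?thesis by (subst AE_restrict_space_iff) (auto simp: domain_sets)
qed

text \<open>For \<open>x\<close> in the domain the two kernels differ only at \<open>y = x\<close>,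
  a null set. Changing one value also carries measurability over from \<open>G0\<close> to
  \<open>G\<close>.\<close>

lemma green_eq_kernel_op:
  assumes x: "x \<in> \<Omega>" and f: "f \<in> borel_measurable M"
  shows "green \<Omega> G f x = kernel_op M G0 f x"
  unfolding green_def kernel_op_def
proof (rule integral_cong_AE)
  note [measurable] = f
  have xM: "x \<in> space M" using x by (simp add: space_M)
  have "(\<lambda>y. case_prod G0 (x, y)) \<in> borel_measurable M"
    by (rule measurable_compose[OF measurable_Pair1'[OF xM] G0_measurable])
  then have G0x [measurable]: "(\<lambda>y. G0 x y) \<in> borel_measurable M" by simp
  have [measurable]: "{x} \<in> sets M" using x by (simp add: sets_restrict_space_iff domain_sets)
  have "(\<lambda>y. if y \<in> {x} then G x x else G0 x y) \<in> borel_measurable M"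
    by (rule measurable_If_set) auto
  also have "?this \<longleftrightarrow> (\<lambda>y. G x y) \<in> borel_measurable M"
    by (rule measurable_cong) (use x in \<open>auto simp: G0_def offdiag_iff space_M\<close>)
  finally have [measurable]: "(\<lambda>y. G x y) \<in> borel_measurable M" .
  show "(\<lambda>y. G x y * f y) \<in> borel_measurable M" "(\<lambda>y. G0 x y * f y) \<in> borel_measurable M"
    by measurable
  show "AE y in M. G x y * f y = G0 x y * f y"
    using AE_neq[of x] AE_space
    by eventually_elim (use x in \<open>auto simp: G0_def offdiag_iff space_M\<close>)
qed

lemma green_image:
  assumes "square_integrable M k"
  shows "is_green_image \<Omega> J B k (green \<Omega> G k)"
  using assms cond_G1 by (simp add: cond_G1_def L2_iff_square_integrable)

lemma G0_bounds:
  "\<exists>A>0. \<forall>x\<in>\<Omega>. \<forall>y\<in>\<Omega>. x \<noteq> y \<longrightarrow>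
     inverse A * green_profile \<Omega> s \<gamma> x y \<le> G0 x y \<and> G0 x y \<le> A * green_profile \<Omega> s \<gamma> x y"
proof -
  obtain A where "A > 0" "\<forall>(x, y)\<in>offdiag \<Omega>. inverse A * green_profile \<Omega> s \<gamma> x y \<le> G x y
      \<and> G x y \<le> A * green_profile \<Omega> s \<gamma> x y"
    using cond_G1 unfolding cond_G1_def by blast
  then show ?thesis by (intro exI[of _ A]) (auto simp: G0_def offdiag_iff)
qed

lemma symmetric_kernel_G0: "\<exists>C. symmetric_kernel M G0 wt C"
proof -
  define a where "a = real DIM('a) - 2 * s"
  have a: "0 \<le> a" "a < real DIM('a)" using parameters by (auto simp: a_def)
  obtain R where R: "0 < R" "\<And>x y. x \<in> \<Omega> \<Longrightarrow> y \<in> \<Omega> \<Longrightarrow> norm (x - y) < R" "\<And>x. x \<in> \<Omega> \<Longrightarrow> bdist \<Omega> x \<le> R"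
    using domain_scale by blast
  obtain C1 where C1: "0 \<le> C1"
    "\<And>x::'a. (\<integral>\<^sup>+y. ennreal (1 / norm (x - y) powr a) * indicator (ball x R) y \<partial>lborel) \<le> ennreal C1"
    using riesz_potential_bounded[OF a R(1)] by blast
  obtain A where A0: "0 < A" "\<forall>x\<in>\<Omega>. \<forall>y\<in>\<Omega>. x \<noteq> y \<longrightarrow>
      inverse A * green_profile \<Omega> s \<gamma> x y \<le> G0 x y \<and> G0 x y \<le> A * green_profile \<Omega> s \<gamma> x y"
    using G0_bounds by blast
  note A = A0(1) A0(2)[rule_format, THEN conjunct2]
  have G0xx: "G0 x x = 0" for x by (simp add: G0_def offdiag_iff)
  have 1: "(\<integral>\<^sup>+y. ennreal (G0 x y) \<partial>M) \<le> ennreal (2 * A * C1)" if x: "x \<in> \<Omega>" for x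
  proof -
    have "(\<integral>\<^sup>+y. ennreal (G0 x y) \<partial>M) \<le> ennreal (A * C1)"
    proof (rule nn_integral_M_le[OF x R(2)[OF x] _ _ _ C1(2) C1(1)])
      fix y assume y: "y \<in> \<Omega>" "y \<noteq> x"
      have "G0 x y \<le> A * green_profile \<Omega> s \<gamma> x y" by (rule A(2)) (use x y in auto)
      also have "\<dots> \<le> A * (1 / norm (x - y) powr a)"
        unfolding a_def using parameters A(1) by (intro mult_left_mono green_profile_le) auto
      finally show "G0 x y \<le> A / norm (x - y) powr a" by simp
    qed (use A G0xx in auto)
    also have "\<dots> \<le> ennreal (2 * A * C1)" using A(1) C1(1) by (intro ennreal_leI) simp
    finally show ?thesis .
  qed
  have 2: "(\<integral>\<^sup>+y. ennreal (G0 x y * wt y) \<partial>M) \<le> ennreal (2 * A * C1 * wt x)" if x: "x \<in> \<Omega>" for x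
  proof -
    have "(\<integral>\<^sup>+y. ennreal (G0 x y * wt y) \<partial>M) \<le> ennreal ((A * (2 * wt x)) * C1)"
    proof (rule nn_integral_M_le[OF x R(2)[OF x] _ _ _ C1(2) C1(1)])
      fix y assume y: "y \<in> \<Omega>" "y \<noteq> x"
      have "G0 x y * wt y \<le> (A * green_profile \<Omega> s \<gamma> x y) * wt y"
        by (intro mult_right_mono A(2)) (use x y in \<open>auto simp: wt_def\<close>)
      also have "\<dots> = A * (green_profile \<Omega> s \<gamma> x y * bdist \<Omega> y powr \<gamma>)" by (simp add: wt_def)
      also have "\<dots> \<le> A * (1 / norm (x - y) powr a * (2 * bdist \<Omega> x powr \<gamma>))"
        unfolding a_def using parameters A(1) y by (intro mult_left_mono green_profile_weight_le) auto
      finally show "G0 x y * wt y \<le> A * (2 * wt x) / norm (x - y) powr a" by (simp add: wt_def)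
    qed (use A G0xx in \<open>auto simp: wt_def\<close>)
    then show ?thesis by (simp add: mult_ac)
  qed
  \<comment> \<open>One constant must serve both Schur conditions; the factor 2 is the one in
    \<open>green_profile_weight_le\<close>.\<close>
  have "symmetric_kernel M G0 wt (2 * A * C1)"
  proof unfold_locales
    show "case_prod G0 \<in> borel_measurable (M \<Otimes>\<^sub>M M)" by (rule G0_measurable)
    show "0 \<le> G0 x y" "G0 x y = G0 y x" for x y by (rule G0_nonneg, rule G0_sym)
    show "wt \<in> borel_measurable M" by (rule wt_measurable)
    show "0 < wt x" if "x \<in> space M" for x using that by (simp add: space_M wt_pos)
    have "wt x \<le> R powr \<gamma>" if "x \<in> \<Omega>" for x
      unfolding wt_def using parameters R(3)[OF that] bdist_pos[OF that] by (intro powr_mono2) auto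
    then show "\<exists>D. \<forall>x\<in>space M. wt x \<le> D" by (auto simp: space_M)
    show "0 \<le> 2 * A * C1" using A C1 by simp
    show "(\<integral>\<^sup>+y. ennreal (G0 x y) \<partial>M) \<le> ennreal (2 * A * C1)" if "x \<in> space M" for x
      using 1 that by (simp add: space_M)
    show "(\<integral>\<^sup>+y. ennreal (G0 x y * wt y) \<partial>M) \<le> ennreal (2 * A * C1 * wt x)" if "x \<in> space M" for x
      using 2 that by (simp add: space_M)
  qed
  then show ?thesis ..
qed

text \<open>It suffices to integrate over one fixed ball well inside the domain, where the weight is
  bounded below and the kernel is at least a constant times \<open>wt x\<close>.\<close>

lemma weight_lower_bound: "\<exists>c>0. \<forall>x\<in>\<Omega>. c * wt x \<le> kernel_op M G0 wt x"
proof -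
  obtain C where "symmetric_kernel M G0 wt C" using symmetric_kernel_G0 by blast
  then interpret K: symmetric_kernel M G0 wt C .
  define a where "a = real DIM('a) - 2 * s"
  have a: "0 \<le> a" using parameters by (auto simp: a_def)
  obtain R where R: "0 < R" "\<And>x y. x \<in> \<Omega> \<Longrightarrow> y \<in> \<Omega> \<Longrightarrow> norm (x - y) < R" "\<And>x. x \<in> \<Omega> \<Longrightarrow> bdist \<Omega> x \<le> R"
    using domain_scale by blast
  obtain A where A0: "0 < A" "\<forall>x\<in>\<Omega>. \<forall>y\<in>\<Omega>. x \<noteq> y \<longrightarrow>
      inverse A * green_profile \<Omega> s \<gamma> x y \<le> G0 x y \<and> G0 x y \<le> A * green_profile \<Omega> s \<gamma> x y"
    using G0_bounds by blast
  note A = A0(1) A0(2)[rule_format, THEN conjunct1]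
  obtain y0 where y0: "y0 \<in> \<Omega>" using domain_nonempty by blast
  \<comment> \<open>Half the distance of \<open>y0\<close> to the complement, so that points of the
    ball keep distance at least \<open>\<rho>\<close> from it.\<close>
  define \<rho> where "\<rho> = bdist \<Omega> y0 / 2"
  have \<rho>: "0 < \<rho>" using bdist_pos[OF y0] by (simp add: \<rho>_def)
  have \<rho>_le: "\<rho> \<le> bdist \<Omega> y" if "y \<in> ball y0 \<rho>" for y
    using infdist_triangle[of y0 "- \<Omega>" y] that by (simp add: \<rho>_def bdist_def)
  have sub: "ball y0 \<rho> \<subseteq> \<Omega>"
  proof
    fix y assume "y \<in> ball y0 \<rho>"
    from \<rho>_le[OF this] \<rho> have "infdist y (- \<Omega>) \<noteq> 0" by (simp add: bdist_def)
    then show "y \<in> \<Omega>" using infdist_zero[of y "- \<Omega>"] by blast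
  qed
  have \<rho>R: "\<rho> \<le> R" using R(3)[OF y0] \<rho> by (simp add: \<rho>_def)
  \<comment> \<open>The lower bound of \<open>green_profile_ge\<close> with \<open>wt x\<close>
    taken out, times the lower bound \<open>\<rho> powr \<gamma>\<close> for the weight on the
    ball.\<close>
  define \<kappa> where "\<kappa> = inverse A * (1 / R powr a * (1 / R) powr \<gamma> * (\<rho> / R) powr \<gamma>) * \<rho> powr \<gamma>"
  have \<kappa>: "\<kappa> > 0" using A R(1) \<rho> by (simp add: \<kappa>_def)
  have low: "\<kappa> * wt x \<le> G0 x y * wt y" if x: "x \<in> \<Omega>" and y: "y \<in> ball y0 \<rho>" "y \<noteq> x" for x y
  proof -
    have yO: "y \<in> \<Omega>" using sub y by blast
    have "(bdist \<Omega> x / R) powr \<gamma> = wt x * (1 / R) powr \<gamma>"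
      using R(1) by (simp add: wt_def bdist_def infdist_nonneg powr_divide)
    then have "\<kappa> * wt x = inverse A
        * (1 / R powr a * (bdist \<Omega> x / R) powr \<gamma> * (\<rho> / R) powr \<gamma>) * \<rho> powr \<gamma>"
      by (simp add: \<kappa>_def mult_ac)
    also have "\<dots> \<le> G0 x y * wt y"
    proof (rule mult_mono)
      have "inverse A * (1 / R powr a * (bdist \<Omega> x / R) powr \<gamma> * (\<rho> / R) powr \<gamma>)
          \<le> inverse A * green_profile \<Omega> s \<gamma> x y"
        unfolding a_def
        by (rule mult_left_mono[OF green_profile_ge])
          (use parameters A(1) R(2)[OF x yO] R(3)[OF x] \<rho> \<rho>_le[OF y(1)] \<rho>R y in auto)
      also have "\<dots> \<le> G0 x y" using A(2)[OF x yO] y by auto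
      finally show "inverse A * (1 / R powr a * (bdist \<Omega> x / R) powr \<gamma> * (\<rho> / R) powr \<gamma>) \<le> G0 x y" .
      show "\<rho> powr \<gamma> \<le> wt y"
        unfolding wt_def using parameters \<rho> \<rho>_le[OF y(1)] by (intro powr_mono2) auto
    qed (use G0_nonneg in auto)
    finally show ?thesis .
  qed
  have ball_sets: "ball y0 \<rho> \<in> sets M" using sub by (simp add: sets_restrict_space_iff domain_sets)
  define c where "c = \<kappa> * measure M (ball y0 \<rho>)"
  have "measure M (ball y0 \<rho>) = measure lebesgue (ball y0 \<rho>)"
    by (rule measure_restrict_space) (use sub domain_sets in auto)
  then have "c > 0" using \<kappa> content_ball_pos[OF \<rho>, of y0] by (simp add: c_def)
  moreover have "c * wt x \<le> kernel_op M G0 wt x" if x: "x \<in> \<Omega>" for x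
  proof -
    have "c * wt x = (LINT y|M. indicator (ball y0 \<rho>) y * (\<kappa> * wt x))"
      using ball_sets by (simp add: c_def space_M Int_absorb2[OF sub])
    also have "\<dots> \<le> (LINT y|M. G0 x y * wt y)"
    proof (rule integral_mono_AE)
      show "integrable M (\<lambda>y. indicator (ball y0 \<rho>) y * (\<kappa> * wt x))"
        using ball_sets by (intro integrable_mult_left) (simp add: emeasure_finite less_top[symmetric])
      show "integrable M (\<lambda>y. G0 x y * wt y)"
        by (rule K.integrable_kernel_bounded[OF K.schur_weight_weight K.weight_measurable, where K=1])
          (use x in \<open>auto simp: space_M wt_def\<close>)
      show "AE y in M. indicator (ball y0 \<rho>) y * (\<kappa> * wt x) \<le> G0 x y * wt y"
        using AE_neq[of x]
      proof eventually_elim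
        case (elim y)
        have "0 \<le> G0 x y * wt y" using G0_nonneg by (simp add: wt_def)
        then show ?case using low[OF x _ elim] by (auto split: split_indicator)
      qed
    qed
    finally show ?thesis by (simp add: kernel_op_def)
  qed
  ultimately show ?thesis by blast
qed

text \<open>The approximating functions are test functions \<open>\<psi>\<close>, and the constant
  attached to \<open>\<psi>\<close> is its energy
  \<open>form \<Omega> J B \<psi> \<psi>\<close>.\<close>

lemma maximum_principle_kernel_G0: "\<exists>C c. maximum_principle_kernel M G0 wt C c"
proof -
  obtain C where "symmetric_kernel M G0 wt C" using symmetric_kernel_G0 by blast
  then interpret K: symmetric_kernel M G0 wt C .
  obtain c where c: "0 < c" "\<And>x. x \<in> \<Omega> \<Longrightarrow> c * wt x \<le> K.T wt x" using weight_lower_bound by blast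
  have T_eq: "K.T k x = green \<Omega> G k x" if "x \<in> space M" "k \<in> borel_measurable M" for k x
    using green_eq_kernel_op[of x k] that by (simp add: space_M)
  have "maximum_principle_kernel M G0 wt C c"
  proof unfold_locales
    show "0 < c" by (rule c)
    show "c * wt x \<le> K.T wt x" if "x \<in> space M" for x using c that by (simp add: space_M)
    show "0 \<le> (LINT x|M. k x * min (K.T k x) 0)" if k: "square_integrable M k" for k
    proof -
      have "(LINT x|M. k x * min (K.T k x) 0) = (LINT x|M. k x * min (green \<Omega> G k x) 0)"
        by (rule Bochner_Integration.integral_cong)
          (use T_eq square_integrable_measurable[OF k] in auto)
      with green_image_weak_maximum_principle[OF k green_image[OF k]] show ?thesis by simp
    qed
    fix h \<xi> :: "'a \<Rightarrow> real" and K1 K2 \<epsilon> :: real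
    assume h: "h \<in> borel_measurable M" "\<And>x. x \<in> space M \<Longrightarrow> \<bar>h x\<bar> \<le> K1"
      and \<xi>: "\<xi> \<in> borel_measurable M" "\<And>x. x \<in> space M \<Longrightarrow> \<bar>\<xi> x\<bar> \<le> K2" and \<epsilon>: "0 < \<epsilon>"
    note sq = square_integrable_const_bound[OF h] square_integrable_const_bound[OF \<xi>]
    have HH: "green \<Omega> G h \<in> HH \<Omega> J B" "green \<Omega> G \<xi> \<in> HH \<Omega> J B"
      using green_image[OF sq(1)] green_image[OF sq(2)] by (auto simp: is_green_image_def)
    have T_le: "\<bar>K.T \<xi> x\<bar> \<le> K2 * (C * 1)" if "x \<in> space M" for x
      by (rule K.abs_T_bounded[OF K.schur_weight_one \<xi>(1) _ that]) (use \<xi>(2) in auto)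
    have bd: "\<bar>green \<Omega> G \<xi> x\<bar> \<le> K2 * C" if "x \<in> \<Omega>" for x
      using that T_le[of x] T_eq[of x \<xi>] \<xi>(1) by (simp add: space_M)
    obtain \<psi> where \<psi>: "\<psi> \<in> Cc_inf \<Omega>"
      "(LINT x|M. ((if 0 < green \<Omega> G h x then green \<Omega> G \<xi> x else 0) - \<psi> x)\<^sup>2) \<le> \<epsilon>"
      using HH_positive_part_approx[OF HH bd \<epsilon>] by blast
    have "(LINT x|M. ((if 0 < K.T h x then K.T \<xi> x else 0) - \<psi> x)\<^sup>2)
        = (LINT x|M. ((if 0 < green \<Omega> G h x then green \<Omega> G \<xi> x else 0) - \<psi> x)\<^sup>2)"
      by (rule Bochner_Integration.integral_cong) (use T_eq h(1) \<xi>(1) in auto)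
    moreover have "(LINT x|M. k x * \<psi> x)\<^sup>2 \<le> form \<Omega> J B \<psi> \<psi> * (LINT x|M. k x * K.T k x)"
      if k: "square_integrable M k" for k
    proof -
      have "(LINT x|M. k x * K.T k x) = (LINT x|M. k x * green \<Omega> G k x)"
        by (rule Bochner_Integration.integral_cong) (use T_eq square_integrable_measurable[OF k] in auto)
      with green_image_pairing[OF green_image[OF k] \<psi>(1)] show ?thesis by simp
    qed
    ultimately show "\<exists>\<psi> K. square_integrable M \<psi> \<and>
        (LINT x|M. ((if 0 < K.T h x then K.T \<xi> x else 0) - \<psi> x)\<^sup>2) \<le> \<epsilon> \<and>
        (\<forall>k. square_integrable M k \<longrightarrow> (LINT x|M. k x * \<psi> x)\<^sup>2 \<le> K * (LINT x|M. k x * K.T k x))"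
      using \<psi> Cc_inf_square_integrable[OF \<psi>(1)] by (intro exI[of _ \<psi>] exI[of _ "form \<Omega> J B \<psi> \<psi>"]) simp
  qed
  then show ?thesis by blast
qed

text \<open>Two differences have to be bridged: \<open>G\<close> against its modification
  \<open>G0\<close>, and essential against pointwise bounds on test functions.\<close>

lemma weak_dual_solution_iff:
  assumes "maximum_principle_kernel M G0 wt C c"
    and f: "f \<in> L1_weighted \<Omega> \<gamma>"
  shows "weak_dual_solution \<Omega> G \<gamma> g f u \<longleftrightarrow> maximum_principle_kernel.weak_solution M G0 wt g f u"
proof -
  interpret K: maximum_principle_kernel M G0 wt C c by (rule assms)
  have L1: "h \<in> L1_weighted \<Omega> \<gamma> \<longleftrightarrow> K.weighted_integrable h" for h
    by (simp add: L1_weighted_def K.weighted_integrable_def wt_def)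
  have T_eq: "(LINT x|M. h x * green \<Omega> G \<xi> x) = (LINT x|M. h x * K.T \<xi> x)"
    if "\<xi> \<in> borel_measurable M" for h \<xi>
    by (rule Bochner_Integration.integral_cong) (use that green_eq_kernel_op in \<open>auto simp: space_M\<close>)
  have to_Linf: "\<xi> \<in> Linf_weighted \<Omega> \<gamma>"
    if \<xi>: "\<xi> \<in> borel_measurable M" "\<forall>x\<in>space M. \<bar>\<xi> x\<bar> \<le> K * wt x" for \<xi> K
    unfolding Linf_weighted_def mem_Collect_eq
  proof (rule bexI[of _ "\<lambda>x. \<xi> x / wt x"])
    note [measurable] = \<xi>(1)
    show "\<forall>x\<in>\<Omega>. \<xi> x = bdist \<Omega> x powr \<gamma> * (\<xi> x / wt x)"
    proof
      fix x assume "x \<in> \<Omega>"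
      from wt_pos[OF this] show "\<xi> x = bdist \<Omega> x powr \<gamma> * (\<xi> x / wt x)" by (simp add: wt_def)
    qed
    have "\<bar>\<xi> x / wt x\<bar> \<le> K" if "x \<in> space M" for x
      using \<xi>(2) that wt_pos[of x] by (simp add: space_M divide_le_eq)
    then have "AE x in M. \<bar>\<xi> x / wt x\<bar> \<le> K" by (rule AE_I2)
    then show "(\<lambda>x. \<xi> x / wt x) \<in> Linf \<Omega>" unfolding Linf_def by auto
  qed
  have from_Linf: "\<exists>\<xi>' K. \<xi>' \<in> borel_measurable M \<and> (\<forall>x\<in>space M. \<bar>\<xi>' x\<bar> \<le> K * wt x) \<and>
      \<xi> \<in> borel_measurable M \<and> (AE x in M. \<xi> x = \<xi>' x)" if \<xi>L: "\<xi> \<in> Linf_weighted \<Omega> \<gamma>" for \<xi>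
  proof -
    obtain w where wL: "w \<in> Linf \<Omega>" and \<xi>: "\<And>x. x \<in> \<Omega> \<Longrightarrow> \<xi> x = wt x * w x"
      using \<xi>L unfolding Linf_weighted_def wt_def by blast
    obtain K where w: "w \<in> borel_measurable M" "AE x in M. \<bar>w x\<bar> \<le> K"
      using wL unfolding Linf_def by blast
    note [measurable] = w(1)
    \<comment> \<open>Clipping \<open>w\<close> at its essential bound changes it on a null set only
      and makes the bound hold at every point; \<open>\<bar>K\<bar>\<close> keeps the clipping
      interval nonempty.\<close>
    define \<xi>' where "\<xi>' x = wt x * max (- \<bar>K\<bar>) (min \<bar>K\<bar> (w x))" for x
    have "\<xi>' \<in> borel_measurable M" unfolding \<xi>'_def by measurable
    moreover have "\<bar>\<xi>' x\<bar> \<le> \<bar>K\<bar> * wt x" if "x \<in> space M" for x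
    proof -
      have "\<bar>max (- \<bar>K\<bar>) (min \<bar>K\<bar> (w x))\<bar> \<le> \<bar>K\<bar>" by auto
      from mult_right_mono[OF this, of "wt x"] show ?thesis
        by (simp add: \<xi>'_def abs_mult wt_def mult.commute)
    qed
    moreover have "\<xi> \<in> borel_measurable M \<longleftrightarrow> (\<lambda>x. wt x * w x) \<in> borel_measurable M"
      by (rule measurable_cong) (simp add: space_M \<xi>)
    then have "\<xi> \<in> borel_measurable M" by simp
    moreover have "AE x in M. \<xi> x = \<xi>' x"
      using w(2) AE_space by eventually_elim (auto simp: \<xi> \<xi>'_def space_M)
    ultimately show ?thesis by blast
  qed
  show ?thesis
  proof
    assume u: "weak_dual_solution \<Omega> G \<gamma> g f u"
    then have test: "(LINT x|M. u x * \<xi> x) + (LINT x|M. g (u x) * green \<Omega> G \<xi> x)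
        = (LINT x|M. f x * green \<Omega> G \<xi> x)" if "\<xi> \<in> Linf_weighted \<Omega> \<gamma>" for \<xi>
      using that unfolding weak_dual_solution_def by blast
    show "K.weak_solution g f u"
      unfolding K.weak_solution_def
    proof (intro conjI allI impI)
      show "K.weighted_integrable u" "K.weighted_integrable (\<lambda>x. g (u x))"
        using u by (simp_all add: weak_dual_solution_def L1)
      fix \<xi> K assume "\<xi> \<in> borel_measurable M \<and> (\<forall>x\<in>space M. \<bar>\<xi> x\<bar> \<le> K * wt x)"
      then have \<xi>: "\<xi> \<in> borel_measurable M" "\<xi> \<in> Linf_weighted \<Omega> \<gamma>" using to_Linf by blast+
      show "(LINT x|M. u x * \<xi> x) + (LINT x|M. g (u x) * K.T \<xi> x) = (LINT x|M. f x * K.T \<xi> x)"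
        using test[OF \<xi>(2)] by (simp only: T_eq[OF \<xi>(1)])
    qed
  next
    assume u: "K.weak_solution g f u"
    then have uw: "K.weighted_integrable u" "K.weighted_integrable (\<lambda>x. g (u x))"
      and test: "\<And>\<xi> K. \<xi> \<in> borel_measurable M \<Longrightarrow> \<forall>x\<in>space M. \<bar>\<xi> x\<bar> \<le> K * wt x \<Longrightarrow>
        (LINT x|M. u x * \<xi> x) + (LINT x|M. g (u x) * K.T \<xi> x) = (LINT x|M. f x * K.T \<xi> x)"
      by (auto simp: K.weak_solution_def)
    show "weak_dual_solution \<Omega> G \<gamma> g f u"
      unfolding weak_dual_solution_def
    proof (intro conjI ballI)
      show "u \<in> L1_weighted \<Omega> \<gamma>" "(\<lambda>x. g (u x)) \<in> L1_weighted \<Omega> \<gamma>"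
        using uw by (simp_all add: L1)
      fix \<xi> assume "\<xi> \<in> Linf_weighted \<Omega> \<gamma>"
      from from_Linf[OF this] obtain \<xi>' K where \<xi>': "\<xi>' \<in> borel_measurable M"
        "\<forall>x\<in>space M. \<bar>\<xi>' x\<bar> \<le> K * wt x" and \<xi>: "\<xi> \<in> borel_measurable M" "AE x in M. \<xi> x = \<xi>' x"
        by blast
      have T': "(LINT x|M. h x * K.T \<xi> x) = (LINT x|M. h x * K.T \<xi>' x)" for h
        by (rule Bochner_Integration.integral_cong) (use K.T_cong_AE[OF \<xi>(2,1) \<xi>'(1)] in auto)
      note [measurable] = K.weighted_integrable_measurable[OF uw(1)] \<xi>(1) \<xi>'(1)
      have "(LINT x|M. u x * \<xi> x) = (LINT x|M. u x * \<xi>' x)"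
        by (rule integral_cong_AE) (use \<xi>(2) in \<open>auto elim!: eventually_mono\<close>)
      with test[OF \<xi>'] show "(LINT x|M. u x * \<xi> x) + (LINT x|M. g (u x) * green \<Omega> G \<xi> x)
          = (LINT x|M. f x * green \<Omega> G \<xi> x)"
        by (simp only: T_eq[OF \<xi>(1)] T')
    qed
  qed
qed

lemma weak_dual_problem_well_posed:
  assumes g: "mono g" "continuous_on UNIV g" "g 0 = 0"
  shows "f \<in> L1_weighted \<Omega> \<gamma> \<Longrightarrow> \<exists>u. weak_dual_solution \<Omega> G \<gamma> g f u"
    and "f1 \<in> L1_weighted \<Omega> \<gamma> \<Longrightarrow> f2 \<in> L1_weighted \<Omega> \<gamma> \<Longrightarrow> AE x in M. f1 x \<le> f2 x \<Longrightarrow>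
      weak_dual_solution \<Omega> G \<gamma> g f1 u1 \<Longrightarrow> weak_dual_solution \<Omega> G \<gamma> g f2 u2 \<Longrightarrow>
      AE x in M. u1 x \<le> u2 x"
proof -
  obtain C c where K: "maximum_principle_kernel M G0 wt C c" using maximum_principle_kernel_G0 by blast
  interpret K: maximum_principle_kernel M G0 wt C c by (rule K)
  have L1: "h \<in> L1_weighted \<Omega> \<gamma> \<longleftrightarrow> K.weighted_integrable h" for h
    by (simp add: L1_weighted_def K.weighted_integrable_def wt_def)
  show "\<exists>u. weak_dual_solution \<Omega> G \<gamma> g f u" if "f \<in> L1_weighted \<Omega> \<gamma>"
    using K.weak_solution_exists[OF _ g, of f] that weak_dual_solution_iff[OF K that] L1 by blast
  show "AE x in M. u1 x \<le> u2 x"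
    if "f1 \<in> L1_weighted \<Omega> \<gamma>" "f2 \<in> L1_weighted \<Omega> \<gamma>" "AE x in M. f1 x \<le> f2 x"
      "weak_dual_solution \<Omega> G \<gamma> g f1 u1" "weak_dual_solution \<Omega> G \<gamma> g f2 u2"
    using that g(1) by (intro K.weak_solution_mono[of f1 f2 g u1 u2])
      (simp_all add: L1 weak_dual_solution_iff[OF K, symmetric])
qed

end

theorem corollary3p4:
  fixes \<Omega> :: "(real ^ 'n) set"
    and J G :: "real ^ 'n \<Rightarrow> real ^ 'n \<Rightarrow> real"
    and B :: "real ^ 'n \<Rightarrow> real"
    and s \<gamma> :: real
    and g :: "real \<Rightarrow> real"
  assumes "CARD('n) \<ge> 3"
    and "bounded_C2_domain \<Omega>"
    and "cond_L1 \<Omega> J B"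
    and "cond_L2 \<Omega> J B"
    and "cond_L3 \<Omega> J B"
    and "cond_L4 \<Omega> J B s"
    and "cond_G1 \<Omega> J B G s \<gamma>"
    and "cond_G2 \<Omega> G"
    and "cond_G3 \<Omega> G \<gamma>"
    and "mono g"
    and "continuous_on UNIV g"
    and "g 0 = 0"
  shows "(\<forall>f\<in>L1_weighted \<Omega> \<gamma>.
            \<exists>u. weak_dual_solution \<Omega> G \<gamma> g f u \<and>
                (\<forall>v. weak_dual_solution \<Omega> G \<gamma> g f v \<longrightarrow> (AE x in lebesgue_on \<Omega>. v x = u x)))
       \<and> (\<forall>f1\<in>L1_weighted \<Omega> \<gamma>. \<forall>f2\<in>L1_weighted \<Omega> \<gamma>. \<forall>u1 u2.
            (AE x in lebesgue_on \<Omega>. f1 x \<le> f2 x) \<and>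
            weak_dual_solution \<Omega> G \<gamma> g f1 u1 \<and> weak_dual_solution \<Omega> G \<gamma> g f2 u2
            \<longrightarrow> (AE x in lebesgue_on \<Omega>. u1 x \<le> u2 x))"
proof -
  interpret green_form \<Omega> J B G s \<gamma>
    using assms by unfold_locales (auto simp: bounded_C2_domain_def)
  note exists = weak_dual_problem_well_posed(1)[OF assms(10-12)]
    and mono = weak_dual_problem_well_posed(2)[OF assms(10-12)]
  \<comment> \<open>Monotonicity with equal data, applied in both orders.\<close>
  have unique: "AE x in lebesgue_on \<Omega>. v x = u x"
    if f: "f \<in> L1_weighted \<Omega> \<gamma>" and uv: "weak_dual_solution \<Omega> G \<gamma> g f u" "weak_dual_solution \<Omega> G \<gamma> g f v"
    for f u v
    using mono[OF f f _ uv] mono[OF f f _ uv(2,1)] by (auto elim: eventually_elim2)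
  show ?thesis
  proof (intro conjI ballI allI impI)
    fix f assume f: "f \<in> L1_weighted \<Omega> \<gamma>"
    then obtain u where "weak_dual_solution \<Omega> G \<gamma> g f u" using exists by blast
    with unique[OF f] show "\<exists>u. weak_dual_solution \<Omega> G \<gamma> g f u \<and>
        (\<forall>v. weak_dual_solution \<Omega> G \<gamma> g f v \<longrightarrow> (AE x in lebesgue_on \<Omega>. v x = u x))" by blast
  qed (use mono in blast)
qed

end
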